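(* Let $X$ be a sigma-finite measure space with measure denoted $dx$, let $t$ be a closed non-negative quadratic form in $L^2(X)$ with domain $\mathrm{dom}\,t$, and let $T$ be the corresponding self-adjoint operator. Let $1<\kappa<\infty$ and assume that $t$ satisfies the generalized Beurling--Deny conditions with parameter $\kappa$. Put $q=2\kappa/(\kappa-1)$. Then the following are equivalent: (1) $T$ satisfies a Sobolev inequality with exponent $q$, that is, there is a constant $S>0$ such that for all $u\in\mathrm{dom}\,t$, $$ t[u]\ \geq\ S\left(\int_X |u|^q\,dx\right)^{2/q}. $$ (2) $T$ satisfies a CLR inequality with exponent $\kappa$, that is, there is a constant $L>0$ such that for all $0\leq V\in L^\kappa(X)$, $$ N(0,T-V)\ \leq\ L\int_X V^\kappa\,dx. $$ Moreover, the respective sharp constants (the largest possible $S$ in (1) and the smallest possible $L$ in (2)) are related by $$ S^{-\kappa}\ \leq\ L\ \leq\ e^{\kappa-1}S^{-\kappa}. $$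
   Context: $L^2(X)$ is the complex Hilbert space of square-integrable functions with respect to $dx$; $L^p(X)$ is the usual $L^p$ space, and for a non-negative function $w$ on $X$, $L^p(X,w)$ is the $L^p$ space with respect to the measure $w(x)\,dx$. The form $t$ is densely defined (so that $T$ exists). Generalized Beurling--Deny conditions with parameter $\kappa\in(1,\infty)$: (i) if $u,v\in\mathrm{dom}\,t$ are real-valued then $t[u+iv]=t[u]+t[v]$; (ii) if $u\in\mathrm{dom}\,t$ is real-valued then $|u|\in\mathrm{dom}\,t$ and $t[|u|]\leq t[u]$; (iii) there is a measurable, a.e. positive function $\omega$ on $X$ such that if $u\in\mathrm{dom}\,t$ is non-negative then $\min(u,\omega)\in\mathrm{dom}\,t$ and $t[\min(u,\omega)]\leq t[u]$; moreover, there is a form core $\mathcal Q$ of $t$ such that $\omega^{-1}\mathcal Q$ is dense in $L^2(X,\omega^{2\kappa/(\kappa-1)})$. For $\tau\geq0$, $N(-\tau,T-V)$ denotes the number of eigenvalues of the operator $T-V$ less than $-\tau$, counted with multiplicity. The operator $T-V$ is understood in the sense of quadratic forms, and by the variational principle $N(-\tau,T-V)$ is the supremum of $\dim M$ over subspaces $M\subset\mathrm{dom}\,t$ such that $t[u]+\tau\int_X|u|^2\,dx<\int_X V|u|^2\,dx$ for all $0\neq u\in M$.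
   Formalization: Condition (i) is read as also requiring that dom t is closed under taking real parts; without this the stated equivalence fails for forms whose domain contains no non-zero real-valued function. *)

theory Defs
  imports "HOL-Analysis.Analysis"
begin

text \<open>
  Elements of the complex space \<open>L\<^sup>2(M)\<close> are represented by measurable, square-integrable
  functions. A form on \<open>L\<^sup>2(M)\<close> is given by its domain \<open>D\<close>, a set of such functions, and its
  values \<open>t\<close> on \<open>D\<close>; both are required to depend only on almost-everywhere classes
  (see \<open>quadratic_form\<close>). Values of \<open>t\<close> outside \<open>D\<close> are irrelevant.
\<close>

definition L2 :: "'a measure \<Rightarrow> ('a \<Rightarrow> complex) set" where
  "L2 M = {u \<in> borel_measurable M. integrable M (\<lambda>x. (cmod (u x))\<^sup>2)}"

definition L2_sq :: "'a measure \<Rightarrow> ('a \<Rightarrow> complex) \<Rightarrow> real" where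
  "L2_sq M u = (\<integral>x. (cmod (u x))\<^sup>2 \<partial>M)"

definition csubspace_fun :: "('a \<Rightarrow> complex) set \<Rightarrow> bool" where
  "csubspace_fun A \<longleftrightarrow>
     (\<lambda>x. 0) \<in> A \<and>
     (\<forall>u\<in>A. \<forall>v\<in>A. (\<lambda>x. u x + v x) \<in> A) \<and>
     (\<forall>c. \<forall>u\<in>A. (\<lambda>x. c * u x) \<in> A)"

definition dense_in_L2 :: "'a measure \<Rightarrow> ('a \<Rightarrow> complex) set \<Rightarrow> bool" where
  "dense_in_L2 M A \<longleftrightarrow>
     A \<subseteq> L2 M \<and> (\<forall>f\<in>L2 M. \<forall>\<epsilon>>0. \<exists>g\<in>A. L2_sq M (\<lambda>x. f x - g x) < \<epsilon>)"

definition sesquilinear_on ::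
  "('a \<Rightarrow> complex) set \<Rightarrow> (('a \<Rightarrow> complex) \<Rightarrow> ('a \<Rightarrow> complex) \<Rightarrow> complex) \<Rightarrow> bool" where
  "sesquilinear_on D a \<longleftrightarrow>
     (\<forall>u\<in>D. \<forall>v\<in>D. \<forall>w\<in>D.
        a (\<lambda>x. u x + v x) w = a u w + a v w \<and> a w (\<lambda>x. u x + v x) = a w u + a w v) \<and>
     (\<forall>c. \<forall>u\<in>D. \<forall>w\<in>D.
        a (\<lambda>x. c * u x) w = cnj c * a u w \<and> a w (\<lambda>x. c * u x) = c * a w u)"

definition quadratic_form ::
  "'a measure \<Rightarrow> ('a \<Rightarrow> complex) set \<Rightarrow> (('a \<Rightarrow> complex) \<Rightarrow> real) \<Rightarrow> bool" where
  "quadratic_form M D t \<longleftrightarrow>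
     D \<subseteq> L2 M \<and> csubspace_fun D \<and>
     (\<forall>u\<in>D. \<forall>v\<in>borel_measurable M. (AE x in M. u x = v x) \<longrightarrow> v \<in> D \<and> t v = t u) \<and>
     (\<exists>a. sesquilinear_on D a \<and> (\<forall>u\<in>D. complex_of_real (t u) = a u u))"

definition closed_form ::
  "'a measure \<Rightarrow> ('a \<Rightarrow> complex) set \<Rightarrow> (('a \<Rightarrow> complex) \<Rightarrow> real) \<Rightarrow> bool" where
  "closed_form M D t \<longleftrightarrow>
     (\<forall>s u. (\<forall>n. s n \<in> D) \<and> u \<in> L2 M \<and>
        (\<lambda>n. L2_sq M (\<lambda>x. s n x - u x)) \<longlonglongrightarrow> 0 \<and>
        (\<forall>\<epsilon>>0. \<exists>N. \<forall>m\<ge>N. \<forall>n\<ge>N. t (\<lambda>x. s m x - s n x) < \<epsilon>)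
      \<longrightarrow> u \<in> D \<and> (\<lambda>n. t (\<lambda>x. s n x - u x)) \<longlonglongrightarrow> 0)"

definition closed_nonneg_form ::
  "'a measure \<Rightarrow> ('a \<Rightarrow> complex) set \<Rightarrow> (('a \<Rightarrow> complex) \<Rightarrow> real) \<Rightarrow> bool" where
  "closed_nonneg_form M D t \<longleftrightarrow>
     quadratic_form M D t \<and> (\<forall>u\<in>D. 0 \<le> t u) \<and> dense_in_L2 M D \<and> closed_form M D t"

definition form_core ::
  "'a measure \<Rightarrow> ('a \<Rightarrow> complex) set \<Rightarrow> (('a \<Rightarrow> complex) \<Rightarrow> real) \<Rightarrow> ('a \<Rightarrow> complex) set \<Rightarrow> bool" where
  "form_core M D t Q \<longleftrightarrow>
     Q \<subseteq> D \<and> csubspace_fun Q \<and>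
     (\<forall>u\<in>D. \<forall>\<epsilon>>0. \<exists>v\<in>Q. t (\<lambda>x. u x - v x) + L2_sq M (\<lambda>x. u x - v x) < \<epsilon>)"

text \<open>
  Real-valued elements of \<open>D\<close> are quantified as real functions whose complexification lies in
  \<open>D\<close>; as \<open>D\<close> is closed under almost-everywhere equality, this also covers the elements that
  are real-valued only almost everywhere.

  The first conjunct, that \<open>D\<close> is closed under taking real parts (hence also imaginary parts and
  complex conjugates), is the usual convention behind condition (i): \<open>D\<close> consists exactly of the
  functions \<open>u + iv\<close> with \<open>u, v \<in> D\<close> real-valued. Without it (i)--(iii) say
  nothing about a form whose domain contains no real-valued function except zero.
\<close>

definition beurling_deny ::
  "'a measure \<Rightarrow> ('a \<Rightarrow> complex) set \<Rightarrow> (('a \<Rightarrow> complex) \<Rightarrow> real) \<Rightarrow> real \<Rightarrow> bool" where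
  "beurling_deny M D t \<kappa> \<longleftrightarrow>
     (\<forall>w\<in>D. (\<lambda>x. complex_of_real (Re (w x))) \<in> D) \<and>
     (\<forall>u v :: 'a \<Rightarrow> real.
        (\<lambda>x. complex_of_real (u x)) \<in> D \<and> (\<lambda>x. complex_of_real (v x)) \<in> D \<longrightarrow>
        t (\<lambda>x. complex_of_real (u x) + \<i> * complex_of_real (v x)) =
          t (\<lambda>x. complex_of_real (u x)) + t (\<lambda>x. complex_of_real (v x))) \<and>
     (\<forall>u :: 'a \<Rightarrow> real.
        (\<lambda>x. complex_of_real (u x)) \<in> D \<longrightarrow>
        (\<lambda>x. complex_of_real \<bar>u x\<bar>) \<in> D \<and>
        t (\<lambda>x. complex_of_real \<bar>u x\<bar>) \<le> t (\<lambda>x. complex_of_real (u x))) \<and>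
     (\<exists>\<omega> :: 'a \<Rightarrow> real.
        \<omega> \<in> borel_measurable M \<and> (AE x in M. 0 < \<omega> x) \<and>
        (\<forall>u :: 'a \<Rightarrow> real.
           (\<lambda>x. complex_of_real (u x)) \<in> D \<and> (AE x in M. 0 \<le> u x) \<longrightarrow>
           (\<lambda>x. complex_of_real (min (u x) (\<omega> x))) \<in> D \<and>
           t (\<lambda>x. complex_of_real (min (u x) (\<omega> x))) \<le> t (\<lambda>x. complex_of_real (u x))) \<and>
        (\<exists>Q. form_core M D t Q \<and>
           dense_in_L2 (density M (\<lambda>x. ennreal (\<omega> x powr (2 * \<kappa> / (\<kappa> - 1)))))
             ((\<lambda>u x. u x / complex_of_real (\<omega> x)) ` Q)))"

text \<open>
  Dimension (possibly infinite) of a space of functions modulo almost-everywhere equality.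
\<close>

definition ae_independent :: "'a measure \<Rightarrow> nat \<Rightarrow> (nat \<Rightarrow> 'a \<Rightarrow> complex) \<Rightarrow> bool" where
  "ae_independent M n b \<longleftrightarrow>
     (\<forall>c :: nat \<Rightarrow> complex. (AE x in M. (\<Sum>i<n. c i * b i x) = 0) \<longrightarrow> (\<forall>i<n. c i = 0))"

definition ae_dim :: "'a measure \<Rightarrow> ('a \<Rightarrow> complex) set \<Rightarrow> enat" where
  "ae_dim M K = Sup {enat n | n. \<exists>b. (\<forall>i<n. b i \<in> K) \<and> ae_independent M n b}"

text \<open>
  \<open>eigenvalue_count M D t \<tau> V\<close> is \<open>N(-\<tau>, T - V)\<close>, for \<open>\<tau> \<ge> 0\<close> and \<open>V \<ge> 0\<close>, where \<open>T\<close> is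
  the operator of the form \<open>(D, t)\<close>. Since \<open>T - V\<close> is understood in the sense of quadratic forms
  and \<open>V\<close> need not be form-bounded a priori, \<open>N\<close> is given by the variational principle;
  \<open>\<integral> V |u|\<^sup>2\<close> may be infinite.
\<close>

definition eigenvalue_count ::
  "'a measure \<Rightarrow> ('a \<Rightarrow> complex) set \<Rightarrow> (('a \<Rightarrow> complex) \<Rightarrow> real) \<Rightarrow> real \<Rightarrow> ('a \<Rightarrow> real) \<Rightarrow> enat" where
  "eigenvalue_count M D t \<tau> V =
     (SUP K \<in> {K. K \<subseteq> D \<and> csubspace_fun K \<and>
        (\<forall>u\<in>K. \<not> (AE x in M. u x = 0) \<longrightarrow>
           ennreal (t u + \<tau> * L2_sq M u) < (\<integral>\<^sup>+x. ennreal (V x * (cmod (u x))\<^sup>2) \<partial>M))}.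
      ae_dim M K)"

text \<open>The integrability conjunct expresses that the right-hand side is finite.\<close>

definition sobolev_inequality ::
  "'a measure \<Rightarrow> ('a \<Rightarrow> complex) set \<Rightarrow> (('a \<Rightarrow> complex) \<Rightarrow> real) \<Rightarrow> real \<Rightarrow> real \<Rightarrow> bool" where
  "sobolev_inequality M D t q S \<longleftrightarrow>
     (\<forall>u\<in>D. integrable M (\<lambda>x. cmod (u x) powr q) \<and>
        t u \<ge> S * (\<integral>x. cmod (u x) powr q \<partial>M) powr (2 / q))"

definition clr_inequality ::
  "'a measure \<Rightarrow> ('a \<Rightarrow> complex) set \<Rightarrow> (('a \<Rightarrow> complex) \<Rightarrow> real) \<Rightarrow> real \<Rightarrow> real \<Rightarrow> bool" where
  "clr_inequality M D t \<kappa> L \<longleftrightarrow>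
     (\<forall>V\<in>borel_measurable M.
        (AE x in M. 0 \<le> V x) \<and> integrable M (\<lambda>x. \<bar>V x\<bar> powr \<kappa>) \<longrightarrow>
        ennreal_of_enat (eigenvalue_count M D t 0 V) \<le> ennreal (L * (\<integral>x. \<bar>V x\<bar> powr \<kappa> \<partial>M)))"

text \<open>
  The sharp constants take values in \<open>[0, \<infinity>]\<close>. The sharp Sobolev constant is infinite, and the
  sharp CLR constant zero, if \<open>M\<close> is a null measure (so that \<open>L2 M\<close> is the zero space).
\<close>

definition sharp_sobolev_const ::
  "'a measure \<Rightarrow> ('a \<Rightarrow> complex) set \<Rightarrow> (('a \<Rightarrow> complex) \<Rightarrow> real) \<Rightarrow> real \<Rightarrow> ennreal" where
  "sharp_sobolev_const M D t q = (SUP S \<in> {S. 0 < S \<and> sobolev_inequality M D t q S}. ennreal S)"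

definition sharp_clr_const ::
  "'a measure \<Rightarrow> ('a \<Rightarrow> complex) set \<Rightarrow> (('a \<Rightarrow> complex) \<Rightarrow> real) \<Rightarrow> real \<Rightarrow> ennreal" where
  "sharp_clr_const M D t \<kappa> = (INF L \<in> {L. 0 < L \<and> clr_inequality M D t \<kappa> L}. ennreal L)"

text \<open>\<open>s\<close> to the power \<open>-p\<close> for \<open>p > 0\<close>, with the conventions \<open>0 \<mapsto> \<infinity>\<close> and \<open>\<infinity> \<mapsto> 0\<close>.\<close>

definition ennreal_neg_powr :: "ennreal \<Rightarrow> real \<Rightarrow> ennreal" where
  "ennreal_neg_powr s p =
     (if s = 0 then \<infinity> else if s = \<infinity> then 0 else ennreal (enn2real s powr (- p)))"

end

theory Submission
  imports Defs "HOL-Library.Function_Algebras" "HOL-Real_Asymp.Real_Asymp"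
begin

text \<open>
  Let \<open>B\<close> be the Birman--Schwinger operator of \<open>T + \<epsilon>\<close> and \<open>V\<close>, acting in \<open>L\<^sup>2(V dx)\<close>; formally
  \<open>B = (T + \<epsilon>)\<^sup>-\<^sup>1 V\<close>. On a space of dimension \<open>N\<close> on which \<open>T - V\<close> is negative, \<open>B \<ge> 1\<close>
  for small \<open>\<epsilon>\<close>. Put \<open>x(s) = Tr (B exp (- 2 s B\<^sup>-\<^sup>1))\<close>; then \<open>x(s) \<ge> N exp (- 2 s)\<close>, while
  \<open>x' = - 2 D\<close> with \<open>D(s) = Tr exp (- 2 s B\<^sup>-\<^sup>1)\<close>. Because the semigroup preserves positivity, the
  Sobolev inequality and Hoelder's inequality give
  \<open>x \<le> S\<^sup>-\<^sup>1 (\<integral> V\<^bsup>\<kappa>\<^esup>)\<^bsup>1/\<kappa>\<^esup> D\<^bsup>1 - 1/\<kappa>\<^esup>\<close>. Integrating this differential inequality up to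
  \<open>s = (\<kappa> - 1) / 2\<close> yields \<open>N \<le> exp (\<kappa> - 1) S\<^bsup>-\<kappa>\<^esup> \<integral> V\<^bsup>\<kappa>\<^esup>\<close>.

  To stay elementary, the semigroup is replaced by powers of the resolvent \<open>J = (1 + d B\<^sup>-\<^sup>1)\<^sup>-\<^sup>1\<close> and
  the trace by the partial trace over normalized indicators of the cells of a finite partition,
  chosen so fine that step functions approximate the \<open>N\<close>-dimensional space; \<open>d \<rightarrow> 0\<close> with the partition
  held fixed. Traces are taken over \<open>\<real>\<close>, with real dimension \<open>2 N\<close> and two copies of each indicator.

  Conversely, the CLR bound for a small enough multiple of
  \<open>V = min (\<bar>u\<bar>, n)\<^bsup>q - 2\<^esup>\<close> excludes a negative direction, in particular \<open>u\<close>, and this is the Sobolev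
  inequality for \<open>u\<close> after \<open>n \<rightarrow> \<infinity>\<close>.
\<close>

text \<open>Hoelder's inequality for products of powers needs nonnegative vectors along the whole
  evolution. This is why the trace runs over indicators, which stay nonnegative under
  \<open>J\<close>, and not over eigenvectors or a basis of the negative space. Step functions need
  not belong to the form domain, so the negative space cannot be moved to a nearby space of step
  functions inside the form. The inequality
  \<open>2 * ip \<phi> w - te w w \<le> b \<phi> \<phi>\<close> separates the two roles:
  \<open>\<phi>\<close> is a step function, \<open>w\<close> a nearby element of the negative space.
  Origin of the constant: with G = S^-1 (int V^\<kappa>)^(1/\<kappa>), decay up to time s gives N
  exp(-2 s) \<le> x(s) \<le> G^\<kappa> (2 s / (\<kappa> - 1))^-(\<kappa> - 1), and s = (\<kappa> -
  1) / 2 minimizes the resulting bound for N. The shift \<epsilon> lets the form control the L^2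
  norm, so that Riesz representation applies. In place of a spectral theorem, explicit identities
  between \<open>b\<close>, \<open>ip\<close> and \<open>J\<close> supply what functional calculus
  would give.\<close>

instantiation "fun" :: (type, real_vector) real_vector
begin

definition scaleR_fun :: "real \<Rightarrow> ('a \<Rightarrow> 'b) \<Rightarrow> 'a \<Rightarrow> 'b" where
  "scaleR_fun c f = (\<lambda>x. c *\<^sub>R f x)"

instance
  by standard (simp_all add: scaleR_fun_def fun_eq_iff scaleR_add_right scaleR_add_left)

end

lemma scaleR_fun_apply [simp]: "(c *\<^sub>R f) x = c *\<^sub>R f x"
  for f :: "'a \<Rightarrow> 'b::real_vector"
  by (simp add: scaleR_fun_def)

lemma sum_fun_apply [simp]: "(\<Sum>i\<in>I. f i) x = (\<Sum>i\<in>I. f i x)"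
  for f :: "'i \<Rightarrow> 'a \<Rightarrow> 'b::comm_monoid_add"
  by (induction I rule: infinite_finite_induct) simp_all

section \<open>Semi-inner products\<close>

text \<open>Vectors will be functions and not almost-everywhere classes, so a product may vanish on
  nonzero vectors. Carrier sets are explicit because one function type carries several products on
  different domains.\<close>

locale semi_inner =
  fixes X :: "'v::real_vector set" and E :: "'v \<Rightarrow> 'v \<Rightarrow> real"
  assumes subspace: "subspace X"
    and sym: "u \<in> X \<Longrightarrow> v \<in> X \<Longrightarrow> E u v = E v u"
    and add_left: "u \<in> X \<Longrightarrow> v \<in> X \<Longrightarrow> w \<in> X \<Longrightarrow> E (u + v) w = E u w + E v w"
    and scale_left: "u \<in> X \<Longrightarrow> w \<in> X \<Longrightarrow> E (c *\<^sub>R u) w = c * E u w"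
    and nonneg: "u \<in> X \<Longrightarrow> 0 \<le> E u u"
begin

lemma mem [simp]:
  "0 \<in> X" "u \<in> X \<Longrightarrow> v \<in> X \<Longrightarrow> u + v \<in> X" "u \<in> X \<Longrightarrow> v \<in> X \<Longrightarrow> u - v \<in> X"
  "u \<in> X \<Longrightarrow> c *\<^sub>R u \<in> X"
  using subspace by (auto intro: subspace_0 subspace_add subspace_diff subspace_scale)

lemma sum_mem [simp]: "(\<And>i. i \<in> I \<Longrightarrow> f i \<in> X) \<Longrightarrow> sum f I \<in> X"
  by (rule subspace_sum[OF subspace])

lemma zero_left [simp]: "w \<in> X \<Longrightarrow> E 0 w = 0"
  using scale_left[of 0 w 0] by simp

lemma zero_right [simp]: "w \<in> X \<Longrightarrow> E w 0 = 0"
  using sym[of 0 w] by simp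

lemma add_right: "u \<in> X \<Longrightarrow> v \<in> X \<Longrightarrow> w \<in> X \<Longrightarrow> E w (u + v) = E w u + E w v"
  using add_left[of u v w] by (simp add: sym)

lemma scale_right: "u \<in> X \<Longrightarrow> w \<in> X \<Longrightarrow> E w (c *\<^sub>R u) = c * E w u"
  using scale_left[of u w c] by (simp add: sym)

lemma diff_left: "u \<in> X \<Longrightarrow> v \<in> X \<Longrightarrow> w \<in> X \<Longrightarrow> E (u - v) w = E u w - E v w"
  using add_left[of "u - v" v w] by simp

lemma diff_right: "u \<in> X \<Longrightarrow> v \<in> X \<Longrightarrow> w \<in> X \<Longrightarrow> E w (u - v) = E w u - E w v"
  using add_right[of "u - v" v w] by simp

lemmas bilinear = add_left add_right diff_left diff_right scale_left scale_right

lemma sum_left: "(\<And>i. i \<in> I \<Longrightarrow> f i \<in> X) \<Longrightarrow> w \<in> X \<Longrightarrow> E (sum f I) w = (\<Sum>i\<in>I. E (f i) w)"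
  by (induction I rule: infinite_finite_induct) (simp_all add: add_left)

lemma sum_right: "(\<And>i. i \<in> I \<Longrightarrow> f i \<in> X) \<Longrightarrow> w \<in> X \<Longrightarrow> E w (sum f I) = (\<Sum>i\<in>I. E w (f i))"
  by (induction I rule: infinite_finite_induct) (simp_all add: add_right)

lemma double_sum:
  assumes "\<And>i. i \<in> I \<Longrightarrow> u i \<in> X" "\<And>j. j \<in> K \<Longrightarrow> v j \<in> X"
  shows "E (\<Sum>i\<in>I. a i *\<^sub>R u i) (\<Sum>j\<in>K. c j *\<^sub>R v j) = (\<Sum>i\<in>I. \<Sum>j\<in>K. a i * (c j * E (u i) (v j)))"
proof -
  have "E (\<Sum>i\<in>I. a i *\<^sub>R u i) (\<Sum>j\<in>K. c j *\<^sub>R v j) = (\<Sum>i\<in>I. a i * E (u i) (\<Sum>j\<in>K. c j *\<^sub>R v j))"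
    using assms by (simp add: sum_left scale_left)
  also have "\<dots> = (\<Sum>i\<in>I. \<Sum>j\<in>K. a i * (c j * E (u i) (v j)))"
    using assms by (intro sum.cong refl) (simp add: sum_right scale_right sum_distrib_left)
  finally show ?thesis .
qed

lemma Cauchy_Schwarz:
  assumes "u \<in> X" "v \<in> X"
  shows "(E u v)\<^sup>2 \<le> E u u * E v v"
proof -
  have q: "0 \<le> E u u + 2 * r * E u v + r\<^sup>2 * E v v" for r
    using nonneg[of "u + r *\<^sub>R v"] assms
    by (simp add: bilinear sym[of v u] algebra_simps power2_eq_square)
  show ?thesis
  proof (cases "E v v = 0")
    case True
    have "E u v = 0"
    proof (rule ccontr)
      assume n: "E u v \<noteq> 0"
      \<comment> \<open>At this argument the polynomial in \<open>q\<close> takes the value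
        -1.\<close>
      show False
        using q[of "- (E u u + 1) / (2 * E u v)"] n True by (simp add: field_simps)
    qed
    then show ?thesis using True by simp
  next
    case False
    then have pos: "E v v > 0" using nonneg[of v] assms by simp
    have "0 \<le> E u u - (E u v)\<^sup>2 / E v v"
      using q[of "- E u v / E v v"] pos by (simp add: field_simps power2_eq_square)
    then show ?thesis using pos by (simp add: field_simps)
  qed
qed

lemma null_left:
  assumes "u \<in> X" "v \<in> X" "E u u = 0"
  shows "E u v = 0"
  using Cauchy_Schwarz[OF assms(1,2)] assms(3) by simp

lemma abs_le_sqrt:
  assumes "u \<in> X" "v \<in> X"
  shows "\<bar>E u v\<bar> \<le> sqrt (E u u) * sqrt (E v v)"
  using real_sqrt_le_mono[OF Cauchy_Schwarz[OF assms]] by (simp add: real_sqrt_mult)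

lemma norm_sum_le:
  assumes "\<And>i. i \<in> I \<Longrightarrow> u i \<in> X"
  shows "E (\<Sum>i\<in>I. a i *\<^sub>R u i) (\<Sum>i\<in>I. a i *\<^sub>R u i) \<le> (\<Sum>i\<in>I. (a i)\<^sup>2) * (\<Sum>i\<in>I. E (u i) (u i))"
proof -
  have "E (\<Sum>i\<in>I. a i *\<^sub>R u i) (\<Sum>i\<in>I. a i *\<^sub>R u i) = (\<Sum>i\<in>I. \<Sum>j\<in>I. a i * (a j * E (u i) (u j)))"
    by (rule double_sum) (rule assms, assumption)+
  also have "\<dots> \<le> (\<Sum>i\<in>I. \<Sum>j\<in>I. (\<bar>a i\<bar> * sqrt (E (u i) (u i))) * (\<bar>a j\<bar> * sqrt (E (u j) (u j))))"
  proof (intro sum_mono)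
    fix i j assume ij: "i \<in> I" "j \<in> I"
    have "a i * (a j * E (u i) (u j)) \<le> \<bar>a i\<bar> * (\<bar>a j\<bar> * \<bar>E (u i) (u j)\<bar>)"
      by (metis abs_ge_self abs_mult)
    also have "\<dots> \<le> \<bar>a i\<bar> * (\<bar>a j\<bar> * (sqrt (E (u i) (u i)) * sqrt (E (u j) (u j))))"
      using assms ij by (intro mult_left_mono abs_le_sqrt) auto
    finally show "a i * (a j * E (u i) (u j))
        \<le> (\<bar>a i\<bar> * sqrt (E (u i) (u i))) * (\<bar>a j\<bar> * sqrt (E (u j) (u j)))"
      by (simp add: mult_ac)
  qed
  also have "\<dots> = (\<Sum>i\<in>I. \<bar>a i\<bar> * sqrt (E (u i) (u i)))\<^sup>2"
    by (simp add: power2_eq_square sum_product)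
  also have "\<dots> \<le> (\<Sum>i\<in>I. \<bar>a i\<bar>\<^sup>2) * (\<Sum>i\<in>I. (sqrt (E (u i) (u i)))\<^sup>2)"
    by (rule Cauchy_Schwarz_ineq_sum)
  also have "\<dots> = (\<Sum>i\<in>I. (a i)\<^sup>2) * (\<Sum>i\<in>I. E (u i) (u i))"
    using assms by (simp add: nonneg)
  finally show ?thesis .
qed

text \<open>The second assumption is linear independence modulo vectors of length zero. Coefficients
  are returned instead of vectors, so that hypotheses stated for all linear combinations of the old
  system apply to the new one.\<close>

lemma Gram_Schmidt:
  fixes x :: "nat \<Rightarrow> 'v"
  assumes "\<And>i. i < n \<Longrightarrow> x i \<in> X"
    and "\<And>i c. i < n \<Longrightarrow> E (x i - (\<Sum>j<i. c j *\<^sub>R x j)) (x i - (\<Sum>j<i. c j *\<^sub>R x j)) > 0"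
  shows "\<exists>a. \<forall>i<n. \<forall>j<n. E (\<Sum>k<n. a i k *\<^sub>R x k) (\<Sum>k<n. a j k *\<^sub>R x k)
                          = (if i = j then 1 else 0)"
  using assms
proof (induction n)
  case 0
  then show ?case by simp
next
  case (Suc n)
  have xX: "x i \<in> X" if "i \<le> n" for i using that Suc.prems(1) by simp
  have "\<exists>a. \<forall>i<n. \<forall>j<n. E (\<Sum>k<n. a i k *\<^sub>R x k) (\<Sum>k<n. a j k *\<^sub>R x k)
                          = (if i = j then 1 else 0)"
    by (rule Suc.IH) (rule Suc.prems, simp)+
  then obtain a where a: "\<forall>i<n. \<forall>j<n. E (\<Sum>k<n. a i k *\<^sub>R x k) (\<Sum>k<n. a j k *\<^sub>R x k)
                          = (if i = j then 1 else 0)" by blast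
  define z where "z i = (\<Sum>k<n. a i k *\<^sub>R x k)" for i
  have zX: "z i \<in> X" for i using xX by (auto simp: z_def intro!: sum_mem)
  have zz: "E (z i) (z j) = (if i = j then 1 else 0)" if "i < n" "j < n" for i j
    using a that by (simp add: z_def)
  \<comment> \<open>The projection of \<open>x n\<close> on the span of the \<open>z i\<close>,
    rewritten in the \<open>x k\<close>; this brings \<open>w\<close> into the shape of the
    positivity assumption.\<close>
  define c where "c k = (\<Sum>i<n. E (x n) (z i) * a i k)" for k
  define w where "w = x n - (\<Sum>k<n. c k *\<^sub>R x k)"
  have wz: "w = x n - (\<Sum>i<n. E (x n) (z i) *\<^sub>R z i)"
    unfolding w_def c_def z_def scaleR_sum_right scaleR_sum_left scaleR_scaleR
    by (subst sum.swap) (rule refl)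
  have wX: "w \<in> X" using xX unfolding w_def by (intro mem sum_mem) auto
  have wpos: "E w w > 0" using Suc.prems(2)[of n c] by (simp add: w_def)
  have orth: "E w (z j) = 0" if "j < n" for j
  proof -
    have "E w (z j) = E (x n) (z j) - (\<Sum>i<n. E (x n) (z i) * E (z i) (z j))"
      using zX xX by (simp add: wz diff_left sum_left scale_left)
    also have "(\<Sum>i<n. E (x n) (z i) * E (z i) (z j))
        = (\<Sum>i<n. if i = j then E (x n) (z i) else 0)"
      using that by (intro sum.cong) (auto simp: zz)
    finally show ?thesis using that by simp
  qed
  define r where "r = 1 / sqrt (E w w)"
  have rr: "r * (r * E w w) = 1" using wpos by (simp add: r_def field_simps)
  define a' where "a' i k = (if i < n then (if k < n then a i k else 0)
      else (if k < n then - r * c k else r))" for i k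
  have new: "(\<Sum>k<Suc n. a' i k *\<^sub>R x k) = (if i < n then z i else r *\<^sub>R w)" for i
  proof (cases "i < n")
    case False
    have "(\<Sum>k<n. a' i k *\<^sub>R x k) = (\<Sum>k<n. r *\<^sub>R - (c k *\<^sub>R x k))"
      using False by (intro sum.cong) (auto simp: a'_def)
    also have "\<dots> = - r *\<^sub>R (\<Sum>k<n. c k *\<^sub>R x k)"
      by (simp add: scaleR_sum_right sum_negf)
    finally show ?thesis using False by (simp add: a'_def w_def scaleR_diff_right)
  qed (simp add: a'_def z_def)
  show ?case
  proof (intro exI[of _ a'] allI impI)
    fix i j assume ij: "i < Suc n" "j < Suc n"
    have "E w (z j) = 0" "E (z j) w = 0" if "j < n" for j
      using orth[OF that] sym[OF wX zX, of j] by simp_all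
    then show "E (\<Sum>k<Suc n. a' i k *\<^sub>R x k) (\<Sum>k<Suc n. a' j k *\<^sub>R x k)
        = (if i = j then 1 else 0)"
      unfolding new using ij wX zX rr by (auto simp: zz bilinear)
  qed
qed

lemma Bessel:
  assumes "finite I" "\<And>y. y \<in> I \<Longrightarrow> e y \<in> X" "f \<in> X"
    and "\<And>y y'. y \<in> I \<Longrightarrow> y' \<in> I \<Longrightarrow> E (e y) (e y') = (if y = y' then 1 else 0)"
  shows "(\<Sum>y\<in>I. (E f (e y))\<^sup>2) \<le> E f f"
proof -
  define p where "p = (\<Sum>y\<in>I. E f (e y) *\<^sub>R e y)"
  have pX: "p \<in> X" using assms by (auto simp: p_def intro!: sum_mem)
  have fp: "E f p = (\<Sum>y\<in>I. (E f (e y))\<^sup>2)"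
    using assms by (simp add: p_def sum_right scale_right power2_eq_square)
  have "E p p = (\<Sum>y\<in>I. E f (e y) * E (e y) p)"
    using assms(2,3) pX by (subst (1) p_def) (simp add: sum_left scale_left)
  also have "\<dots> = (\<Sum>y\<in>I. \<Sum>y'\<in>I. E f (e y) * (E f (e y') * E (e y) (e y')))"
    using assms(2,3) by (simp add: p_def sum_right scale_right sum_distrib_left)
  also have "\<dots> = (\<Sum>y\<in>I. (E f (e y))\<^sup>2)"
  proof (rule sum.cong)
    fix y assume y: "y \<in> I"
    have "(\<Sum>y'\<in>I. E f (e y) * (E f (e y') * E (e y) (e y')))
        = (\<Sum>y'\<in>I. if y = y' then E f (e y) * E f (e y') else 0)"
      using y assms by (intro sum.cong) auto
    then show "(\<Sum>y'\<in>I. E f (e y) * (E f (e y') * E (e y) (e y'))) = (E f (e y))\<^sup>2"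
      using y assms by (simp add: power2_eq_square)
  qed simp
  finally have pp: "E p p = (\<Sum>y\<in>I. (E f (e y))\<^sup>2)" .
  show ?thesis
    using nonneg[of "f - p"] pX assms(3) sym[of p f] by (simp add: bilinear fp pp)
qed

text \<open>With \<open>G\<close> the orthogonal projection \<open>G\<^bsub>yy'\<^esub> = (\<Sum>i<n. c i y * c i y')\<close>, this is the inequality
  \<open>Tr (E G) \<le> Tr E\<close>, and the proof expands \<open>Tr ((1 - G) E (1 - G)) \<ge> 0\<close>.\<close>

lemma trace_le:
  fixes n :: nat
  assumes "finite I" "\<And>y. y \<in> I \<Longrightarrow> e y \<in> X"
    and z: "\<And>i. i < n \<Longrightarrow> z i = (\<Sum>y\<in>I. c i y *\<^sub>R e y)"
    and c: "\<And>i j. i < n \<Longrightarrow> j < n \<Longrightarrow> (\<Sum>y\<in>I. c i y * c j y) = (if i = j then 1 else 0)"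
  shows "(\<Sum>i<n. E (z i) (z i)) \<le> (\<Sum>y\<in>I. E (e y) (e y))"
proof -
  have zX: "z i \<in> X" if "i < n" for i using that assms by (auto intro!: sum_mem)
  \<comment> \<open>The projection applied to the system \<open>e\<close>: \<open>p y\<close> is the
    sum of G_yy' e_y' over y'.\<close>
  define p where "p y = (\<Sum>i<n. c i y *\<^sub>R z i)" for y
  have pX: "p y \<in> X" for y using zX by (auto simp: p_def intro!: sum_mem)
  have left: "E (p y) v = (\<Sum>i<n. c i y * E (z i) v)" if "v \<in> X" for y v
    unfolding p_def using zX that by (subst sum_left) (auto simp: scale_left)
  have right: "E v (p y) = (\<Sum>i<n. c i y * E v (z i))" if "v \<in> X" for y v
    unfolding p_def using zX that by (subst sum_right) (auto simp: scale_right)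
  have ep: "(\<Sum>y\<in>I. E (e y) (p y)) = (\<Sum>i<n. E (z i) (z i))"
  proof -
    have "(\<Sum>y\<in>I. E (e y) (p y)) = (\<Sum>y\<in>I. \<Sum>i<n. c i y * E (e y) (z i))"
      using assms(2) by (simp add: right)
    also have "\<dots> = (\<Sum>i<n. \<Sum>y\<in>I. c i y * E (e y) (z i))" by (rule sum.swap)
    also have "\<dots> = (\<Sum>i<n. E (z i) (z i))"
    proof (rule sum.cong)
      fix i assume "i \<in> {..<n}"
      then have i: "i < n" by simp
      have "E (z i) (z i) = E (\<Sum>y\<in>I. c i y *\<^sub>R e y) (z i)" using z[OF i] by simp
      also have "\<dots> = (\<Sum>y\<in>I. c i y * E (e y) (z i))"
        using zX[OF i] assms by (simp add: sum_left scale_left)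
      finally show "(\<Sum>y\<in>I. c i y * E (e y) (z i)) = E (z i) (z i)" by simp
    qed simp
    finally show ?thesis .
  qed
  have pp: "(\<Sum>y\<in>I. E (p y) (p y)) = (\<Sum>i<n. E (z i) (z i))"
  proof -
    have "(\<Sum>y\<in>I. E (p y) (p y)) = (\<Sum>y\<in>I. \<Sum>i<n. c i y * E (z i) (p y))"
      by (intro sum.cong refl left pX)
    also have "\<dots> = (\<Sum>y\<in>I. \<Sum>i<n. \<Sum>j<n. c i y * c j y * E (z i) (z j))"
      using zX by (simp add: right sum_distrib_left mult.assoc cong: sum.cong_simp)
    also have "\<dots> = (\<Sum>i<n. \<Sum>y\<in>I. \<Sum>j<n. c i y * c j y * E (z i) (z j))" by (rule sum.swap)
    also have "\<dots> = (\<Sum>i<n. \<Sum>j<n. \<Sum>y\<in>I. c i y * c j y * E (z i) (z j))"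
      by (intro sum.cong refl sum.swap)
    also have "\<dots> = (\<Sum>i<n. \<Sum>j<n. if i = j then E (z i) (z j) else 0)"
      by (intro sum.cong refl) (simp add: c flip: sum_distrib_right)
    finally show ?thesis by simp
  qed
  have "0 \<le> (\<Sum>y\<in>I. E (e y - p y) (e y - p y))"
    using pX assms by (intro sum_nonneg nonneg) auto
  also have "\<dots> = (\<Sum>y\<in>I. E (e y) (e y) - 2 * E (e y) (p y) + E (p y) (p y))"
    using pX assms by (intro sum.cong) (auto simp: bilinear sym[of "p _" "e _"])
  also have "\<dots> = (\<Sum>y\<in>I. E (e y) (e y)) - (\<Sum>i<n. E (z i) (z i))"
    by (simp add: sum.distrib sum_subtractf ep pp flip: sum_distrib_left)
  finally show ?thesis by simp
qed

definition complete :: bool where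
  "complete \<longleftrightarrow> (\<forall>s. (\<forall>n. s n \<in> X) \<and>
      (\<forall>\<epsilon>>0. \<exists>N. \<forall>m\<ge>N. \<forall>n\<ge>N. E (s m - s n) (s m - s n) < \<epsilon>) \<longrightarrow>
      (\<exists>u\<in>X. (\<lambda>n. E (s n - u) (s n - u)) \<longlonglongrightarrow> 0))"

text \<open>Direct method: by the parallelogram identity a minimizing sequence of
  \<open>E w w - 2 * l w\<close> is Cauchy in the seminorm, and its limit represents
  \<open>l\<close>. Working with the seminorm avoids a quotient by null vectors.\<close>

lemma Riesz:
  assumes "complete"
    and ladd: "\<And>u v. u \<in> X \<Longrightarrow> v \<in> X \<Longrightarrow> l (u + v) = l u + l v"
    and lscale: "\<And>u c. u \<in> X \<Longrightarrow> l (c *\<^sub>R u) = c * l u"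
    and bound: "\<And>u. u \<in> X \<Longrightarrow> (l u)\<^sup>2 \<le> C * E u u" and "0 \<le> C"
  shows "\<exists>v\<in>X. \<forall>w\<in>X. E v w = l w"
proof -
  define F where "F w = E w w - 2 * l w" for w
  have Fge: "- C \<le> F w" if "w \<in> X" for w
  proof -
    have "0 \<le> (C - E w w)\<^sup>2" by simp
    then have "C * E w w \<le> ((C + E w w) / 2)\<^sup>2"
      by (simp add: power2_eq_square algebra_simps)
    then have "(l w)\<^sup>2 \<le> ((C + E w w) / 2)\<^sup>2" using bound[OF that] by linarith
    then have "l w \<le> (C + E w w) / 2"
      using power2_le_imp_le nonneg[OF that] \<open>0 \<le> C\<close> by (smt (verit) divide_nonneg_nonneg)
    then show ?thesis by (simp add: F_def)
  qed
  define m where "m = Inf (F ` X)"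
  have bdd: "bdd_below (F ` X)" using Fge by (auto intro!: bdd_belowI[of _ "- C"])
  have m_le: "m \<le> F w" if "w \<in> X" for w using bdd that by (auto simp: m_def intro: cInf_lower)
  have "\<exists>w\<in>X. F w < m + 1 / real (Suc n)" for n
  proof -
    have "F ` X \<noteq> {}" using mem(1) by blast
    then have "\<exists>y\<in>F ` X. y < m + 1 / real (Suc n)"
      by (intro cInf_lessD) (auto simp: m_def[symmetric])
    then show ?thesis by auto
  qed
  then obtain s where sX: "\<And>n. s n \<in> X" and sF: "\<And>n. F (s n) < m + 1 / real (Suc n)"
    by metis
  have gap: "E (s n - s k) (s n - s k) \<le> 2 / real (Suc n) + 2 / real (Suc k)" for n k
  proof -
    have "4 * F ((1/2) *\<^sub>R (s n + s k))
        = 2 * F (s n) + 2 * F (s k) - E (s n - s k) (s n - s k)"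
      using sX[of n] sX[of k] sym[of "s k" "s n"]
      by (simp add: F_def bilinear ladd lscale field_simps)
    moreover have "4 * m \<le> 4 * F ((1/2) *\<^sub>R (s n + s k))"
      using m_le sX by simp
    ultimately show ?thesis
      using sF[of n] sF[of k] add_divide_distrib[of 1 1 "real (Suc n)"]
        add_divide_distrib[of 1 1 "real (Suc k)"] by linarith
  qed
  have "\<exists>N. \<forall>m\<ge>N. \<forall>n\<ge>N. E (s m - s n) (s m - s n) < \<epsilon>" if e: "\<epsilon> > 0" for \<epsilon>
  proof -
    obtain N where N: "1 / real (Suc N) < \<epsilon> / 4"
      using e nat_approx_posE[of "\<epsilon> / 4"] by auto
    have "E (s i - s j) (s i - s j) < \<epsilon>" if "i \<ge> N" "j \<ge> N" for i j
    proof -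
      have "1 / real (Suc i) \<le> 1 / real (Suc N)" "1 / real (Suc j) \<le> 1 / real (Suc N)"
        using that by (auto simp: frac_le)
      then show ?thesis using gap[of i j] N by simp
    qed
    then show ?thesis by blast
  qed
  then obtain u where uX: "u \<in> X" and lim: "(\<lambda>n. E (s n - u) (s n - u)) \<longlonglongrightarrow> 0"
    using \<open>complete\<close> sX unfolding complete_def by blast
  show ?thesis
  proof (intro bexI[OF _ uX] ballI)
    fix w assume w: "w \<in> X"
    \<comment> \<open>Near-minimality of \<open>s n\<close> makes a quadratic polynomial in
      \<open>r\<close> nonnegative up to 1/(n+1); this bounds the first variation at
      \<open>s n\<close>, and the limit is taken afterwards.\<close>
    have bnd: "(E (s n) w - l w)\<^sup>2 \<le> (E w w + 1) * (1 / real (Suc n))" for n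
    proof -
      define d where "d = E (s n) w - l w"
      have q: "0 \<le> 1 / real (Suc n) + 2 * r * d + r\<^sup>2 * E w w" for r
      proof -
        have "F (s n + r *\<^sub>R w) = F (s n) + 2 * r * d + r\<^sup>2 * E w w"
          using w sX[of n] sym[of w "s n"]
          by (simp add: F_def d_def bilinear ladd lscale algebra_simps power2_eq_square)
        then show ?thesis using m_le[of "s n + r *\<^sub>R w"] w sX sF[of n] by simp
      qed
      \<comment> \<open>The added 1 keeps the divisor positive when \<open>w\<close> has length
        zero.\<close>
      define k where "k = E w w + 1"
      have k: "k > 0" using nonneg[OF w] by (simp add: k_def)
      have "0 \<le> 1 / real (Suc n) + 2 * (- d / k) * d + (- d / k)\<^sup>2 * k"
        using q[of "- d / k"] by (simp add: k_def algebra_simps) (smt (verit) zero_le_power2)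
      moreover have "(- d / k)\<^sup>2 * k = d\<^sup>2 / k" "2 * (- d / k) * d = - 2 * (d\<^sup>2 / k)"
        using k by (simp_all add: power2_eq_square)
      ultimately have "d\<^sup>2 / k \<le> 1 / real (Suc n)" by linarith
      then have "d\<^sup>2 \<le> k * (1 / real (Suc n))"
        using k by (simp add: pos_divide_le_eq mult.commute)
      then show ?thesis by (simp add: d_def k_def)
    qed
    have g0: "(\<lambda>n. (E w w + 1) * (1 / real (Suc n))) \<longlonglongrightarrow> 0"
      by (rule tendsto_mult_right_zero[OF LIMSEQ_Suc[OF lim_1_over_n]])
    have "(\<lambda>n. (E (s n) w - l w)\<^sup>2) \<longlonglongrightarrow> 0"
      by (intro Lim_null_comparison[OF _ g0] always_eventually allI)
        (simp only: real_norm_def abs_power2 bnd)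
    then have 1: "(\<lambda>n. E (s n) w - l w) \<longlonglongrightarrow> 0"
      by (subst (asm) power_tendsto_0_iff) simp_all
    have g0: "(\<lambda>n. E (s n - u) (s n - u) * E w w) \<longlonglongrightarrow> 0"
      by (rule tendsto_mult_left_zero[OF lim])
    have "(\<lambda>n. (E (s n - u) w)\<^sup>2) \<longlonglongrightarrow> 0"
      by (intro Lim_null_comparison[OF _ g0] always_eventually allI)
        (simp only: real_norm_def abs_power2 Cauchy_Schwarz[OF mem(3)[OF sX uX] w])
    then have 2: "(\<lambda>n. E (s n - u) w) \<longlonglongrightarrow> 0"
      by (subst (asm) power_tendsto_0_iff) simp_all
    have "(\<lambda>n. (E (s n) w - l w) - E (s n - u) w) \<longlonglongrightarrow> 0 - 0"
      by (intro tendsto_diff 1 2)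
    then have "(\<lambda>n. E u w - l w) \<longlonglongrightarrow> 0"
      using sX uX w by (simp add: bilinear)
    then show "E u w = l w" by (simp add: LIMSEQ_const_iff)
  qed
qed

end

text \<open>Used to treat a complex function as the pair of its real and imaginary parts.\<close>

lemma semi_inner_prod:
  assumes "semi_inner X E"
  shows "semi_inner (X \<times> X) (\<lambda>u v. E (fst u) (fst v) + E (snd u) (snd v))"
proof -
  interpret semi_inner X E by fact
  show ?thesis
    by standard (auto simp: subspace subspace_Times bilinear sym nonneg algebra_simps)
qed

section \<open>The Birman--Schwinger operator and its resolvent\<close>

text \<open>In the application \<open>ip\<close> is the product weighted by the potential and
  \<open>te\<close> the form shifted by \<epsilon>. The embedding of \<open>D\<close> into
  \<open>X\<close> is then bounded, \<open>B\<close> is its adjoint, and \<open>b\<close> is the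
  quadratic form of the Birman--Schwinger operator.\<close>

locale form_pair =
  ip: semi_inner X ip + te: semi_inner D te
  for X D :: "'v::real_vector set" and ip te :: "'v \<Rightarrow> 'v \<Rightarrow> real" +
  fixes C :: real
  assumes DX: "D \<subseteq> X"
    and complete: "te.complete"
    and bounded: "u \<in> D \<Longrightarrow> ip u u \<le> C * te u u"
    and C_nonneg: "0 \<le> C"
begin

lemma DX' [simp, intro]: "u \<in> D \<Longrightarrow> u \<in> X"
  using DX by auto

lemma B_ex: "\<phi> \<in> X \<Longrightarrow> \<exists>v\<in>D. \<forall>w\<in>D. te v w = ip \<phi> w"
proof (rule te.Riesz[OF complete, where C = "ip \<phi> \<phi> * C"])
  fix u assume "\<phi> \<in> X" "u \<in> D"
  have "(ip \<phi> u)\<^sup>2 \<le> ip \<phi> \<phi> * ip u u" using \<open>\<phi> \<in> X\<close> \<open>u \<in> D\<close> by (intro ip.Cauchy_Schwarz) auto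
  also have "\<dots> \<le> ip \<phi> \<phi> * (C * te u u)"
    using bounded \<open>\<phi> \<in> X\<close> \<open>u \<in> D\<close> ip.nonneg by (intro mult_left_mono) auto
  finally show "(ip \<phi> u)\<^sup>2 \<le> ip \<phi> \<phi> * C * te u u" by (simp add: mult.assoc)
qed (use ip.nonneg C_nonneg in \<open>auto simp: ip.bilinear\<close>)

text \<open>The choice is unique only up to \<open>te\<close>-null vectors, so \<open>B\<close>
  itself need not be linear. Linearity is recovered for \<open>b\<close>, which sees
  \<open>B\<close> only through products.\<close>

definition B :: "'v \<Rightarrow> 'v" where
  "B \<phi> = (SOME v. v \<in> D \<and> (\<forall>w\<in>D. te v w = ip \<phi> w))"

lemma B: "\<phi> \<in> X \<Longrightarrow> B \<phi> \<in> D" "\<phi> \<in> X \<Longrightarrow> w \<in> D \<Longrightarrow> te (B \<phi>) w = ip \<phi> w"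
  using someI_ex[of "\<lambda>v. v \<in> D \<and> (\<forall>w\<in>D. te v w = ip \<phi> w)"] B_ex[of \<phi>]
  unfolding B_def by (blast, blast)

definition b :: "'v \<Rightarrow> 'v \<Rightarrow> real" where
  "b \<phi> \<psi> = ip \<phi> (B \<psi>)"

lemma b_eq_te: "\<phi> \<in> X \<Longrightarrow> \<psi> \<in> X \<Longrightarrow> b \<phi> \<psi> = te (B \<phi>) (B \<psi>)"
  by (simp add: b_def B)

sublocale b: semi_inner X b
proof
  fix u v w :: 'v and c :: real
  show "subspace X" by (rule ip.subspace)
  assume u: "u \<in> X"
  then show "0 \<le> b u u" using te.nonneg[OF B(1)] b_eq_te by simp
  { assume v: "v \<in> X"
    show "b u v = b v u" using u v te.sym[of "B u" "B v"] by (simp add: b_eq_te B(1))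
    assume w: "w \<in> X"
    show "b (u + v) w = b u w + b v w" using u v w by (simp add: b_def B ip.bilinear) }
  assume w: "w \<in> X"
  show "b (c *\<^sub>R u) w = c * b u w" using u w by (simp add: b_def B ip.bilinear)
qed

text \<open>Expand \<open>te (B \<phi> - w) (B \<phi> - w) \<ge> 0\<close>. This bounds
  \<open>b\<close> from below at a vector that may lie outside \<open>D\<close>, by means of a trial
  vector inside \<open>D\<close>.\<close>

lemma b_ge:
  assumes "\<phi> \<in> X" "w \<in> D"
  shows "2 * ip \<phi> w - te w w \<le> b \<phi> \<phi>"
  using te.nonneg[of "B \<phi> - w"] te.sym[of w "B \<phi>"] assms
  by (simp add: te.bilinear B b_eq_te[of \<phi> \<phi>])

end

section \<open>The resolvent of the Birman--Schwinger operator and its powers\<close>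

locale form_resolvent = form_pair +
  fixes d :: real
  assumes d_pos: "0 < d"
begin

definition Q :: "'a \<Rightarrow> 'a \<Rightarrow> real" where
  "Q u v = d * te u v + ip u v"

sublocale Q: semi_inner D Q
proof
  show "subspace D" by (rule te.subspace)
  fix u v assume "u \<in> D" "v \<in> D"
  then show "Q u v = Q v u" by (simp add: Q_def te.sym[of u v] ip.sym[of u v])
qed (use d_pos in \<open>auto simp: Q_def te.nonneg ip.nonneg te.bilinear ip.bilinear algebra_simps\<close>)

lemma te_le_Q: "u \<in> D \<Longrightarrow> d * te u u \<le> Q u u"
  by (simp add: Q_def ip.nonneg)

lemma Q_complete: "Q.complete"
  unfolding Q.complete_def
proof (intro allI impI, elim conjE)
  fix s :: "nat \<Rightarrow> 'a"
  assume s: "\<forall>n. s n \<in> D"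
    and cau: "\<forall>\<epsilon>>0. \<exists>N. \<forall>m\<ge>N. \<forall>n\<ge>N. Q (s m - s n) (s m - s n) < \<epsilon>"
  have "\<exists>N. \<forall>m\<ge>N. \<forall>n\<ge>N. te (s m - s n) (s m - s n) < \<epsilon>" if "\<epsilon> > 0" for \<epsilon>
  proof -
    obtain N where N: "\<forall>m\<ge>N. \<forall>n\<ge>N. Q (s m - s n) (s m - s n) < d * \<epsilon>"
      using cau[rule_format, of "d * \<epsilon>"] d_pos \<open>\<epsilon> > 0\<close> by auto
    have "te (s m - s n) (s m - s n) < \<epsilon>" if "m \<ge> N" "n \<ge> N" for m n
    proof -
      have "s m - s n \<in> D" using s by simp
      then have "d * te (s m - s n) (s m - s n) < d * \<epsilon>"
        using N[rule_format, OF that] te_le_Q[of "s m - s n"] by linarith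
      then show ?thesis using d_pos by simp
    qed
    then show ?thesis by blast
  qed
  then have "\<exists>u\<in>D. (\<lambda>n. te (s n - u) (s n - u)) \<longlonglongrightarrow> 0"
    using complete s unfolding te.complete_def by blast
  then obtain u where u: "u \<in> D" "(\<lambda>n. te (s n - u) (s n - u)) \<longlonglongrightarrow> 0"
    by blast
  have g0: "(\<lambda>n. (d + C) * te (s n - u) (s n - u)) \<longlonglongrightarrow> 0"
    by (rule tendsto_mult_right_zero[OF u(2)])
  have "norm (Q (s n - u) (s n - u)) \<le> (d + C) * te (s n - u) (s n - u)" for n
  proof -
    have "s n - u \<in> D" using s u by simp
    then show ?thesis
      using bounded[of "s n - u"] Q.nonneg[of "s n - u"] by (simp add: Q_def algebra_simps)
  qed
  then have "(\<lambda>n. Q (s n - u) (s n - u)) \<longlonglongrightarrow> 0"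
    by (intro Lim_null_comparison[OF _ g0] always_eventually allI)
  then show "\<exists>u\<in>D. (\<lambda>n. Q (s n - u) (s n - u)) \<longlonglongrightarrow> 0" using u by blast
qed

lemma J_ex: "\<phi> \<in> X \<Longrightarrow> \<exists>v\<in>D. \<forall>w\<in>D. Q v w = ip \<phi> w"
proof (rule Q.Riesz[OF Q_complete, where C = "ip \<phi> \<phi>"])
  fix u assume "\<phi> \<in> X" "u \<in> D"
  have "(ip \<phi> u)\<^sup>2 \<le> ip \<phi> \<phi> * ip u u" using \<open>\<phi> \<in> X\<close> \<open>u \<in> D\<close> by (intro ip.Cauchy_Schwarz) auto
  also have "\<dots> \<le> ip \<phi> \<phi> * Q u u"
    using \<open>\<phi> \<in> X\<close> \<open>u \<in> D\<close> ip.nonneg te.nonneg d_pos by (intro mult_left_mono) (auto simp: Q_def)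
  finally show "(ip \<phi> u)\<^sup>2 \<le> ip \<phi> \<phi> * Q u u" .
qed (use ip.nonneg in \<open>auto simp: ip.bilinear\<close>)

definition J :: "'a \<Rightarrow> 'a" where
  "J \<phi> = (SOME v. v \<in> D \<and> (\<forall>w\<in>D. Q v w = ip \<phi> w))"

lemma J: "\<phi> \<in> X \<Longrightarrow> J \<phi> \<in> D" "\<phi> \<in> X \<Longrightarrow> w \<in> D \<Longrightarrow> d * te (J \<phi>) w + ip (J \<phi>) w = ip \<phi> w"
  using someI_ex[of "\<lambda>v. v \<in> D \<and> (\<forall>w\<in>D. Q v w = ip \<phi> w)"] J_ex[of \<phi>]
  unfolding J_def Q_def by (blast, blast)

lemma J_X [simp, intro]: "\<phi> \<in> X \<Longrightarrow> J \<phi> \<in> X"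
  using J(1) by auto

text \<open>Weak form of B (1 - J) = d J. It is the source of the relations between \<open>b\<close>
  and \<open>ip\<close> along the resolvent.\<close>

lemma b_diff_J:
  assumes "\<phi> \<in> X" "w \<in> X"
  shows "b (\<phi> - J \<phi>) w = d * ip (J \<phi>) w"
proof -
  have "b (\<phi> - J \<phi>) w = d * te (J \<phi>) (B w)"
    using J(2)[of \<phi> "B w"] assms by (simp add: b_def ip.bilinear B)
  also have "te (J \<phi>) (B w) = te (B w) (J \<phi>)"
    using assms B(1) J(1) te.sym by blast
  also have "\<dots> = ip (J \<phi>) w"
    using assms J(1) B(2)[of w "J \<phi>"] ip.sym[of w "J \<phi>"] by simp
  finally show ?thesis .
qed

lemma ip_J_sym:
  assumes "\<phi> \<in> X" "\<psi> \<in> X"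
  shows "ip (J \<phi>) \<psi> = ip \<phi> (J \<psi>)"
  using J(2)[of \<phi> "J \<psi>"] J(2)[of \<psi> "J \<phi>"] J(1) assms
    te.sym[of "J \<phi>" "J \<psi>"] ip.sym[of "J \<phi>" "J \<psi>"] ip.sym[of \<psi> "J \<phi>"] by simp

lemma b_J_sym:
  assumes "\<phi> \<in> X" "\<psi> \<in> X"
  shows "b (J \<phi>) \<psi> = b \<phi> (J \<psi>)"
proof -
  have "b \<phi> \<psi> - b (J \<phi>) \<psi> = d * ip (J \<phi>) \<psi>" "b \<psi> \<phi> - b (J \<psi>) \<phi> = d * ip (J \<psi>) \<phi>"
    using b_diff_J[of \<phi> \<psi>] b_diff_J[of \<psi> \<phi>] assms by (simp_all add: b.bilinear)
  then show ?thesis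
    using assms ip_J_sym[of \<phi> \<psi>] ip.sym[of \<phi> "J \<psi>"] b.sym[of \<phi> \<psi>] b.sym[of \<phi> "J \<psi>"] by simp
qed

lemma ip_J_le:
  assumes "\<phi> \<in> X"
  shows "ip (J \<phi>) (J \<phi>) \<le> ip \<phi> \<phi>"
proof -
  have "ip (J \<phi>) (J \<phi>) \<le> ip \<phi> (J \<phi>)"
    using J[OF assms] te.nonneg[of "J \<phi>"] d_pos by (smt (verit) mult_nonneg_nonneg)
  moreover have "0 \<le> ip (\<phi> - J \<phi>) (\<phi> - J \<phi>)" using assms by (intro ip.nonneg) auto
  ultimately show ?thesis
    using assms ip.sym[of "J \<phi>" \<phi>] by (simp add: ip.bilinear)
qed

abbreviation Jn :: "nat \<Rightarrow> 'a \<Rightarrow> 'a" where "Jn m \<equiv> J ^^ m"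

lemma Jn_X [simp, intro]: "\<phi> \<in> X \<Longrightarrow> Jn m \<phi> \<in> X"
  by (induction m) auto

lemma ip_Jn_sym: "\<phi> \<in> X \<Longrightarrow> \<psi> \<in> X \<Longrightarrow> ip (Jn m \<phi>) \<psi> = ip \<phi> (Jn m \<psi>)"
  by (induction m arbitrary: \<phi> \<psi>) (simp_all add: ip_J_sym flip: funpow_swap1)

lemma b_Jn_sym: "\<phi> \<in> X \<Longrightarrow> \<psi> \<in> X \<Longrightarrow> b (Jn m \<phi>) \<psi> = b \<phi> (Jn m \<psi>)"
  by (induction m arbitrary: \<phi> \<psi>) (simp_all add: b_J_sym flip: funpow_swap1)

lemma ip_Jn_le: "\<phi> \<in> X \<Longrightarrow> ip (Jn m \<phi>) (Jn m \<phi>) \<le> ip \<phi> \<phi>"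
  by (induction m) (auto intro: order_trans[OF ip_J_le])

text \<open>Discrete form of x' = -2 D. Two uses of \<open>b_diff_J\<close> show that the decrease
  equals \<open>d * (ip (J \<phi>) \<phi> + ip (J \<phi>) (J \<phi>))\<close>. The lower bound then
  follows from positivity of \<open>b\<close> at \<open>\<phi> - J \<phi>\<close>, the upper one
  from positivity of \<open>ip\<close> there and contractivity of \<open>J\<close>.\<close>

lemma b_decrease:
  assumes "\<phi> \<in> X"
  shows "2 * d * ip (J \<phi>) (J \<phi>) \<le> b \<phi> \<phi> - b (J \<phi>) (J \<phi>)"
    and "b \<phi> \<phi> - b (J \<phi>) (J \<phi>) \<le> 2 * d * ip \<phi> \<phi>"
proof -
  have 1: "b \<phi> \<phi> - b (J \<phi>) \<phi> = d * ip (J \<phi>) \<phi>" "b \<phi> (J \<phi>) - b (J \<phi>) (J \<phi>) = d * ip (J \<phi>) (J \<phi>)"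
    using b_diff_J[of \<phi> \<phi>] b_diff_J[of \<phi> "J \<phi>"] assms by (simp_all add: b.bilinear)
  have 2: "b \<phi> (J \<phi>) = b (J \<phi>) \<phi>" "ip \<phi> (J \<phi>) = ip (J \<phi>) \<phi>" using assms b.sym ip.sym by auto
  have "0 \<le> b (\<phi> - J \<phi>) (\<phi> - J \<phi>)" "0 \<le> ip (\<phi> - J \<phi>) (\<phi> - J \<phi>)"
    using assms by (auto intro: b.nonneg ip.nonneg)
  then have 3: "0 \<le> b \<phi> \<phi> - 2 * b (J \<phi>) \<phi> + b (J \<phi>) (J \<phi>)"
    "0 \<le> ip \<phi> \<phi> - 2 * ip (J \<phi>) \<phi> + ip (J \<phi>) (J \<phi>)"
    using assms 2 by (simp_all add: b.bilinear ip.bilinear)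
  show "2 * d * ip (J \<phi>) (J \<phi>) \<le> b \<phi> \<phi> - b (J \<phi>) (J \<phi>)"
    using 1 2 3(1) by linarith
  have "d * ip (J \<phi>) \<phi> + d * ip (J \<phi>) (J \<phi>) \<le> 2 * d * ip \<phi> \<phi>"
  proof -
    have "ip (J \<phi>) \<phi> + ip (J \<phi>) (J \<phi>) \<le> 2 * ip \<phi> \<phi>"
      using 3(2) ip_J_le[OF assms] by linarith
    from mult_left_mono[OF this, of d] show ?thesis using d_pos by (simp add: algebra_simps)
  qed
  then show "b \<phi> \<phi> - b (J \<phi>) (J \<phi>) \<le> 2 * d * ip \<phi> \<phi>"
    using 1 2 by linarith
qed

text \<open>The value of 1 / (1 + d a) at a = 1, the point of the spectrum of B^-1 at which
  \<open>b\<close> and \<open>ip\<close> balance.\<close>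

definition \<rho> :: real where "\<rho> = 1 / (1 + d)"

lemma \<rho>: "0 < \<rho>" "d * \<rho> = 1 - \<rho>"
  using d_pos by (auto simp: \<rho>_def field_simps)

text \<open>In terms of the generator \<open>a = B\<^sup>-\<^sup>1\<close> and \<open>r = 1 / (1 + d a)\<close>, the two bounds integrate the
  pointwise identities
  \<open>r\<^sup>2 - \<rho>\<^sup>2 - 2 d \<rho>\<^sup>3 (1 - a) = (r - \<rho>)\<^sup>2 (r + 2 \<rho>) / r\<close> and
  \<open>d \<rho> (1 - a) (r\<^sup>2 - \<rho>\<^sup>2) = (r - \<rho>)\<^sup>2 (r + \<rho>) / r\<close>.\<close>

lemma b_J_lower:
  assumes "\<phi> \<in> X"
  shows "\<rho>\<^sup>2 * b \<phi> \<phi> + 2 * d * \<rho> * \<rho>\<^sup>2 * (b \<phi> \<phi> - ip \<phi> \<phi>) \<le> b (J \<phi>) (J \<phi>)"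
    and "\<rho>\<^sup>2 * (b \<phi> \<phi> - ip \<phi> \<phi>) \<le> b (J \<phi>) (J \<phi>) - ip (J \<phi>) (J \<phi>)"
proof -
  define p where "p = b \<phi> \<phi>"
  define i0 where "i0 = ip \<phi> \<phi>"
  define m where "m = b (J \<phi>) \<phi>"
  define n where "n = b (J \<phi>) (J \<phi>)"
  define i1 where "i1 = ip (J \<phi>) \<phi>"
  define i2 where "i2 = ip (J \<phi>) (J \<phi>)"
  note defs = p_def i0_def m_def n_def i1_def i2_def
  have s: "b \<phi> (J \<phi>) = b (J \<phi>) \<phi>" "ip \<phi> (J \<phi>) = ip (J \<phi>) \<phi>" using assms b.sym ip.sym by auto
  have 1: "p = m + d * i1" "m = n + d * i2"
    using b_diff_J[of \<phi> \<phi>] b_diff_J[of \<phi> "J \<phi>"] assms s by (simp_all add: b.bilinear defs)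
  have "0 \<le> b (J \<phi> - \<rho> *\<^sub>R \<phi>) (J \<phi> - \<rho> *\<^sub>R \<phi>)" "0 \<le> ip (J \<phi> - \<rho> *\<^sub>R \<phi>) (J \<phi> - \<rho> *\<^sub>R \<phi>)"
    using assms by (auto intro: b.nonneg ip.nonneg)
  then have 2: "0 \<le> n - 2 * \<rho> * m + \<rho>\<^sup>2 * p" "0 \<le> i2 - 2 * \<rho> * i1 + \<rho>\<^sup>2 * i0"
    using assms s by (simp_all add: b.bilinear ip.bilinear defs power2_eq_square algebra_simps)
  \<comment> \<open>The weights come from d a = 1 / r - 1: the factor (r + 2 \<rho>) / r equals 1 +
    2 \<rho> + 2 \<rho> d a, and an extra factor a turns \<open>b\<close> into \<open>ip\<close>.
    The second bound uses (r + \<rho>) / r = 1 + \<rho> + \<rho> d a in the same way.\<close>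
  have "0 \<le> (1 + 2 * \<rho>) * (n - 2 * \<rho> * m + \<rho>\<^sup>2 * p) + 2 * (d * \<rho>) * (i2 - 2 * \<rho> * i1 + \<rho>\<^sup>2 * i0)"
    by (intro add_nonneg_nonneg mult_nonneg_nonneg[OF _ 2(1)] mult_nonneg_nonneg[OF _ 2(2)])
      (use \<rho>(1) d_pos in simp_all)
  also have "\<dots> = n - (\<rho>\<^sup>2 * p + 2 * d * \<rho> * \<rho>\<^sup>2 * (p - i0))"
    using 1 \<rho>(2) by algebra
  finally show "\<rho>\<^sup>2 * b \<phi> \<phi> + 2 * d * \<rho> * \<rho>\<^sup>2 * (b \<phi> \<phi> - ip \<phi> \<phi>) \<le> b (J \<phi>) (J \<phi>)"
    by (simp add: defs)
  have "0 \<le> (1 + \<rho>) * (n - 2 * \<rho> * m + \<rho>\<^sup>2 * p) + d * \<rho> * (i2 - 2 * \<rho> * i1 + \<rho>\<^sup>2 * i0)"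
    by (intro add_nonneg_nonneg mult_nonneg_nonneg[OF _ 2(1)] mult_nonneg_nonneg[OF _ 2(2)])
      (use \<rho>(1) d_pos in simp_all)
  also have "\<dots> = d * \<rho> * ((n - i2) - \<rho>\<^sup>2 * (p - i0))"
    using 1 \<rho>(2) by algebra
  finally show "\<rho>\<^sup>2 * (b \<phi> \<phi> - ip \<phi> \<phi>) \<le> b (J \<phi>) (J \<phi>) - ip (J \<phi>) (J \<phi>)"
    using mult_pos_pos[OF d_pos \<rho>(1)] by (simp add: defs zero_le_mult_iff)
qed

text \<open>The left-hand side is kept linear in \<open>b\<close> and \<open>ip\<close>, with no
  comparison of the two assumed. Later \<open>ip \<le> b\<close> is known only for the sum over a
  real and an imaginary part, and can be inserted after the two bounds are added.\<close>

lemma Jn_lower: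
  assumes "\<phi> \<in> X"
  shows "\<rho> ^ (2 * m) * (b \<phi> \<phi> + 2 * d * \<rho> * m * (b \<phi> \<phi> - ip \<phi> \<phi>)) \<le> b (Jn m \<phi>) (Jn m \<phi>)"
proof -
  have 1: "\<rho> ^ (2 * m) * (b \<phi> \<phi> - ip \<phi> \<phi>) \<le> b (Jn m \<phi>) (Jn m \<phi>) - ip (Jn m \<phi>) (Jn m \<phi>)" for m
  proof (induction m)
    case (Suc m)
    have "\<rho> ^ (2 * Suc m) * (b \<phi> \<phi> - ip \<phi> \<phi>) = \<rho>\<^sup>2 * (\<rho> ^ (2 * m) * (b \<phi> \<phi> - ip \<phi> \<phi>))"
      by (simp add: power2_eq_square)
    also have "\<dots> \<le> \<rho>\<^sup>2 * (b (Jn m \<phi>) (Jn m \<phi>) - ip (Jn m \<phi>) (Jn m \<phi>))"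
      using Suc.IH by (intro mult_left_mono) auto
    also have "\<dots> \<le> b (Jn (Suc m) \<phi>) (Jn (Suc m) \<phi>) - ip (Jn (Suc m) \<phi>) (Jn (Suc m) \<phi>)"
      using b_J_lower(2)[of "Jn m \<phi>"] assms by simp
    finally show ?case .
  qed simp
  show ?thesis
  proof (induction m)
    case (Suc m)
    have "\<rho> ^ (2 * Suc m) * (b \<phi> \<phi> + 2 * d * \<rho> * Suc m * (b \<phi> \<phi> - ip \<phi> \<phi>))
        = \<rho>\<^sup>2 * (\<rho> ^ (2 * m) * (b \<phi> \<phi> + 2 * d * \<rho> * m * (b \<phi> \<phi> - ip \<phi> \<phi>)))
          + 2 * d * \<rho> * \<rho>\<^sup>2 * (\<rho> ^ (2 * m) * (b \<phi> \<phi> - ip \<phi> \<phi>))"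
      by (simp add: power2_eq_square algebra_simps)
    also have "\<dots> \<le> \<rho>\<^sup>2 * b (Jn m \<phi>) (Jn m \<phi>)
        + 2 * d * \<rho> * \<rho>\<^sup>2 * (b (Jn m \<phi>) (Jn m \<phi>) - ip (Jn m \<phi>) (Jn m \<phi>))"
      using Suc.IH 1[of m] d_pos \<rho> by (intro add_mono mult_left_mono) auto
    also have "\<dots> \<le> b (Jn (Suc m) \<phi>) (Jn (Suc m) \<phi>)"
      using b_J_lower(1)[of "Jn m \<phi>"] assms by simp
    finally show ?case .
  qed simp
qed

text \<open>\<open>J\<close> is determined only up to null vectors and need not be additive.
  Symmetry moves all its powers to the other argument, where nothing has to be added.\<close>

lemma alpha_semi_inner: "semi_inner X (\<lambda>\<phi> \<psi>. b (Jn m \<phi>) (Jn m \<psi>))"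
proof
  fix u v w :: 'a and c :: real
  show "subspace X" by (rule ip.subspace)
  assume u: "u \<in> X"
  then show "0 \<le> b (Jn m u) (Jn m u)" by (simp add: b.nonneg)
  { assume v: "v \<in> X"
    show "b (Jn m u) (Jn m v) = b (Jn m v) (Jn m u)" using u v by (simp add: b.sym)
    assume w: "w \<in> X"
    show "b (Jn m (u + v)) (Jn m w) = b (Jn m u) (Jn m w) + b (Jn m v) (Jn m w)"
      using u v w by (simp add: b_Jn_sym b.add_left) }
  assume w: "w \<in> X"
  show "b (Jn m (c *\<^sub>R u)) (Jn m w) = c * b (Jn m u) (Jn m w)"
    using u w by (simp add: b_Jn_sym b.scale_left)
qed

text \<open>By \<open>pos\<close> and \<open>ge\<close> the pairs \<open>\<sigma> i\<close> span a
  space of real dimension \<open>n\<close> on which \<open>b\<close> dominates \<open>ip\<close>.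
  Each vector of an orthonormal basis of it contributes at least \<open>\<rho> ^ (2 * m)\<close>,
  and \<open>trace_le\<close> compares the sum with the trace over the whole system.\<close>

lemma trace_lower:
  fixes \<sigma> :: "nat \<Rightarrow> 'a \<times> 'a"
  assumes I: "finite I" and e: "\<And>y. y \<in> I \<Longrightarrow> e y \<in> X"
    and orth: "\<And>y y'. y \<in> I \<Longrightarrow> y' \<in> I \<Longrightarrow> ip (e y) (e y') = (if y = y' then 1 else 0)"
    and \<sigma>: "\<And>i. i < n \<Longrightarrow> \<sigma> i = ((\<Sum>y\<in>I. p i y *\<^sub>R e y), (\<Sum>y\<in>I. r i y *\<^sub>R e y))"
    and pos: "\<And>c i0. i0 < n \<Longrightarrow> c i0 = 1 \<Longrightarrow>
        0 < ip (fst (\<Sum>i<n. c i *\<^sub>R \<sigma> i)) (fst (\<Sum>i<n. c i *\<^sub>R \<sigma> i))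
          + ip (snd (\<Sum>i<n. c i *\<^sub>R \<sigma> i)) (snd (\<Sum>i<n. c i *\<^sub>R \<sigma> i))"
    and ge: "\<And>c. ip (fst (\<Sum>i<n. c i *\<^sub>R \<sigma> i)) (fst (\<Sum>i<n. c i *\<^sub>R \<sigma> i))
          + ip (snd (\<Sum>i<n. c i *\<^sub>R \<sigma> i)) (snd (\<Sum>i<n. c i *\<^sub>R \<sigma> i))
        \<le> b (fst (\<Sum>i<n. c i *\<^sub>R \<sigma> i)) (fst (\<Sum>i<n. c i *\<^sub>R \<sigma> i))
          + b (snd (\<Sum>i<n. c i *\<^sub>R \<sigma> i)) (snd (\<Sum>i<n. c i *\<^sub>R \<sigma> i))"
  shows "\<rho> ^ (2 * m) * n \<le> 2 * (\<Sum>y\<in>I. b (Jn m (e y)) (Jn m (e y)))"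
proof -
  define ip2 where "ip2 u v = ip (fst u) (fst v) + ip (snd u) (snd v)" for u v
  define b2 where "b2 u v = b (fst u) (fst v) + b (snd u) (snd v)" for u v
  define al where "al u v = b (Jn m u) (Jn m v)" for u v
  define al2 where "al2 u v = al (fst u) (fst v) + al (snd u) (snd v)" for u v
  interpret i2: semi_inner "X \<times> X" ip2
    unfolding ip2_def by (rule semi_inner_prod) (rule ip.semi_inner_axioms)
  interpret a: semi_inner X al
    unfolding al_def by (rule alpha_semi_inner)
  interpret a2: semi_inner "X \<times> X" al2
    unfolding al2_def by (rule semi_inner_prod) (rule a.semi_inner_axioms)
  have \<sigma>X: "\<sigma> i \<in> X \<times> X" if "i < n" for i using that e by (auto simp: \<sigma>)
  have "ip2 (\<sigma> i - (\<Sum>j<i. c j *\<^sub>R \<sigma> j)) (\<sigma> i - (\<Sum>j<i. c j *\<^sub>R \<sigma> j)) > 0"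
    if i: "i < n" for i c
  proof -
    define c' where "c' j = (if j < i then - c j else if j = i then 1 else 0)" for j
    have "(\<Sum>j<n. c' j *\<^sub>R \<sigma> j) = (\<Sum>j<Suc i. c' j *\<^sub>R \<sigma> j)"
      using i by (intro sum.mono_neutral_right) (auto simp: c'_def)
    also have "\<dots> = \<sigma> i - (\<Sum>j<i. c j *\<^sub>R \<sigma> j)"
      by (simp add: c'_def sum_negf)
    finally show ?thesis using pos[OF i, of c'] by (simp add: c'_def ip2_def)
  qed
  from i2.Gram_Schmidt[OF \<sigma>X this] obtain a where
    a: "\<forall>i<n. \<forall>j<n. ip2 (\<Sum>k<n. a i k *\<^sub>R \<sigma> k) (\<Sum>k<n. a j k *\<^sub>R \<sigma> k)
                          = (if i = j then 1 else 0)" by blast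
  define z where "z i = (\<Sum>k<n. a i k *\<^sub>R \<sigma> k)" for i
  have zX: "z i \<in> X \<times> X" for i
    unfolding z_def by (intro i2.sum_mem i2.mem(4)) (use \<sigma>X in simp)
  have z: "ip2 (z i) (z j) = (if i = j then 1 else 0)" if "i < n" "j < n" for i j
    using a that by (simp add: z_def)
  have z_ge: "\<rho> ^ (2 * m) * ip2 (z i) (z i) \<le> al2 (z i) (z i)" for i
  proof -
    have g: "ip2 (z i) (z i) \<le> b2 (z i) (z i)"
      using ge[of "a i"] by (simp add: z_def ip2_def b2_def)
    have "0 \<le> 2 * d * \<rho> * m * (b2 (z i) (z i) - ip2 (z i) (z i))"
      using g d_pos \<rho>(1) by (intro mult_nonneg_nonneg) auto
    then have le: "ip2 (z i) (z i) \<le> b2 (z i) (z i) + 2 * d * \<rho> * m * (b2 (z i) (z i) - ip2 (z i) (z i))"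
      using g by linarith
    have "\<rho> ^ (2 * m) * ip2 (z i) (z i)
        \<le> \<rho> ^ (2 * m) * (b2 (z i) (z i) + 2 * d * \<rho> * m * (b2 (z i) (z i) - ip2 (z i) (z i)))"
      using \<rho>(1) by (intro mult_left_mono le) simp
    also have "\<dots> \<le> al2 (z i) (z i)"
      using Jn_lower[of "fst (z i)" m] Jn_lower[of "snd (z i)" m] zX[of i]
      by (auto simp: b2_def ip2_def al2_def al_def algebra_simps mem_Times_iff)
    finally show ?thesis .
  qed
  \<comment> \<open>Two copies of the system, one for each component of a pair; they produce the
    factor 2.\<close>
  define e' where "e' y = (case y of Inl y \<Rightarrow> (e y, 0) | Inr y \<Rightarrow> (0, e y))" for y :: "'b + 'b"
  define co where "co i y = (case y of Inl y \<Rightarrow> \<Sum>k<n. a i k * p k y | Inr y \<Rightarrow> \<Sum>k<n. a i k * r k y)" for i y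
  have zco: "z i = (\<Sum>y\<in>I <+> I. co i y *\<^sub>R e' y)" for i
  proof -
    have "z i = (\<Sum>k<n. a i k *\<^sub>R ((\<Sum>y\<in>I. p k y *\<^sub>R e y), (\<Sum>y\<in>I. r k y *\<^sub>R e y)))"
      unfolding z_def using \<sigma> by simp
    also have "\<dots> = ((\<Sum>k<n. \<Sum>y\<in>I. (a i k * p k y) *\<^sub>R e y), (\<Sum>k<n. \<Sum>y\<in>I. (a i k * r k y) *\<^sub>R e y))"
      by (simp add: prod_eq_iff fst_sum snd_sum scaleR_sum_right)
    also have "\<dots> = ((\<Sum>y\<in>I. (\<Sum>k<n. a i k * p k y) *\<^sub>R e y), (\<Sum>y\<in>I. (\<Sum>k<n. a i k * r k y) *\<^sub>R e y))"
      unfolding scaleR_sum_left by (simp add: sum.swap[of _ I])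
    also have "\<dots> = (\<Sum>y\<in>I <+> I. co i y *\<^sub>R e' y)"
      using I by (simp add: sum.Plus prod_eq_iff fst_sum snd_sum co_def e'_def)
    finally show ?thesis .
  qed
  have e'X: "e' y \<in> X \<times> X" if "y \<in> I <+> I" for y using that e by (auto simp: e'_def)
  have e'orth: "ip2 (e' y) (e' y') = (if y = y' then 1 else 0)" if "y \<in> I <+> I" "y' \<in> I <+> I" for y y'
    using that e orth by (auto simp: e'_def ip2_def split: if_splits)
  have fin: "finite (I <+> I)" using I by simp
  \<comment> \<open>Both \<open>z\<close> and \<open>e'\<close> are orthonormal, hence so are the
    rows of coefficients, as \<open>trace_le\<close> requires.\<close>
  have cc: "(\<Sum>y\<in>I <+> I. co i y * co j y) = (if i = j then 1 else 0)" if "i < n" "j < n" for i j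
  proof -
    have "ip2 (z i) (z j) = (\<Sum>y\<in>I <+> I. \<Sum>y'\<in>I <+> I. co i y * (co j y' * ip2 (e' y) (e' y')))"
      unfolding zco by (rule i2.double_sum) (rule e'X, assumption)+
    also have "\<dots> = (\<Sum>y\<in>I <+> I. \<Sum>y'\<in>I <+> I. if y = y' then co i y * co j y' else 0)"
      by (intro sum.cong refl) (auto simp: e'orth)
    also have "\<dots> = (\<Sum>y\<in>I <+> I. co i y * co j y)" using fin by simp
    finally show ?thesis using z[OF that] by simp
  qed
  have "\<rho> ^ (2 * m) * n = (\<Sum>i<n. \<rho> ^ (2 * m) * ip2 (z i) (z i))" using z by simp
  also have "\<dots> \<le> (\<Sum>i<n. al2 (z i) (z i))" by (intro sum_mono z_ge)
  also have "\<dots> \<le> (\<Sum>y\<in>I <+> I. al2 (e' y) (e' y))"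
    using fin e'X zco cc by (rule a2.trace_le)
  also have "\<dots> = 2 * (\<Sum>y\<in>I. al (e y) (e y))"
    using I e by (simp add: sum.Plus e'_def al2_def)
  finally show ?thesis by (simp add: al_def)
qed

end

section \<open>Discrete decay and Hoelder inequalities\<close>

text \<open>Convexity of \<open>y powr - \<alpha>\<close>: the graph lies above its tangent at
  \<open>x\<close>.\<close>

lemma powr_minus_tangent:
  fixes x y \<alpha> :: real
  assumes "0 < x" "0 < y" "0 < \<alpha>"
  shows "\<alpha> * x powr (- \<alpha> - 1) * (x - y) \<le> y powr - \<alpha> - x powr - \<alpha>"
proof -
  have "1 - \<alpha> * (y / x - 1) \<le> 1 - \<alpha> * ln (y / x)"
    using ln_le_minus_one[of "y / x"] assms by simp
  also have "\<dots> \<le> exp (- \<alpha> * ln (y / x))"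
    using exp_ge_add_one_self[of "- \<alpha> * ln (y / x)"] by simp
  also have "\<dots> = (y / x) powr - \<alpha>" using assms by (simp add: powr_def)
  finally have "x powr - \<alpha> * (1 - \<alpha> * (y / x - 1)) \<le> x powr - \<alpha> * (y / x) powr - \<alpha>"
    by (intro mult_left_mono) auto
  also have "\<dots> = y powr - \<alpha>" using assms by (simp flip: powr_mult)
  also have "x powr - \<alpha> * (1 - \<alpha> * (y / x - 1)) = x powr - \<alpha> + \<alpha> * (x powr - \<alpha> / x) * (x - y)"
    using assms by (simp add: field_simps)
  also have "x powr - \<alpha> / x = x powr (- \<alpha> - 1)" using assms by (simp add: powr_diff)
  finally show ?thesis by simp
qed

text \<open>Implicit Euler steps for \<open>x' = - 2 (x / G)\<^bsup>1 + \<alpha>\<^esup>\<close> up to time \<open>1 / (2 \<alpha>)\<close>: the quantity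
  \<open>x\<^bsup>-\<alpha>\<^esup>\<close> grows at rate \<open>2 \<alpha> G\<^bsup>-1-\<alpha>\<^esup>\<close>. The step bound \<open>K\<close> is needed because the decay is governed by the
  end point of each step.\<close>

lemma discrete_decay_step:
  fixes x D :: "nat \<Rightarrow> real" and \<alpha> d G K X0 :: real
  assumes "0 < \<alpha>" "0 < d" "0 < G" "0 \<le> K" "0 < X0" "0 < n"
    and d: "d * (2 * \<alpha> * n) = 1"
    and "X0 \<le> x n"
    and D: "\<And>m. m < n \<Longrightarrow> 0 \<le> D (Suc m)"
    and xD: "\<And>m. m < n \<Longrightarrow> x (Suc m) \<le> G * D (Suc m) powr (1 / (1 + \<alpha>))"
    and lower: "\<And>m. m < n \<Longrightarrow> 2 * d * D (Suc m) \<le> x m - x (Suc m)"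
    and upper: "\<And>m. m < n \<Longrightarrow> x m - x (Suc m) \<le> 2 * d * K"
    and small: "2 * d * K < X0"
  shows "G powr (- \<alpha> - 1) * (1 - 2 * d * K / X0) powr (1 + \<alpha>) \<le> X0 powr - \<alpha>"
proof -
  \<comment> \<open>Lower bound for the ratio of consecutive values: a step loses at most
    \<open>2 * d * K\<close>, and \<open>x m\<close> is at least \<open>X0\<close>.\<close>
  define r where "r = 1 - 2 * d * K / X0"
  have r: "0 < r" "r \<le> 1" using assms by (auto simp: r_def)
  have dec: "x (Suc m) \<le> x m" if "m < n" for m
    using lower[OF that] D[OF that] \<open>0 < d\<close> by (smt (verit) mult_nonneg_nonneg)
  have ge: "X0 \<le> x m" if "m \<le> n" for m
    using that
  proof (induction "n - m" arbitrary: m)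
    case 0
    then show ?case using \<open>X0 \<le> x n\<close> by simp
  next
    case (Suc k)
    then have "X0 \<le> x (Suc m)" by simp
    also have "\<dots> \<le> x m" using dec Suc by simp
    finally show ?case .
  qed
  have step: "2 * d * \<alpha> * (G powr (- \<alpha> - 1) * r powr (1 + \<alpha>)) \<le> x (Suc m) powr - \<alpha> - x m powr - \<alpha>"
    if m: "m < n" for m
  proof -
    have pos: "0 < x m" "0 < x (Suc m)" using ge[of m] ge[of "Suc m"] m \<open>0 < X0\<close> by auto
    have "r * x m \<le> x (Suc m)"
    proof -
      have "2 * d * K \<le> 2 * d * K / X0 * x m"
        using ge[of m] m assms mult_left_mono[of X0 "x m" "2 * d * K / X0"] by simp
      then show ?thesis using upper[OF m] by (simp add: r_def algebra_simps)
    qed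
    also have "\<dots> \<le> G * D (Suc m) powr (1 / (1 + \<alpha>))" by (rule xD[OF m])
    finally have "r * x m / G \<le> D (Suc m) powr (1 / (1 + \<alpha>))"
      using \<open>0 < G\<close> by (simp add: field_simps)
    then have "(r * x m / G) powr (1 + \<alpha>) \<le> (D (Suc m) powr (1 / (1 + \<alpha>))) powr (1 + \<alpha>)"
      using r pos \<open>0 < \<alpha>\<close> \<open>0 < G\<close> by (intro powr_mono2) auto
    also have "\<dots> = D (Suc m)"
      using D[OF m] \<open>0 < \<alpha>\<close> by (simp add: powr_powr)
    finally have "2 * d * (r * x m / G) powr (1 + \<alpha>) \<le> x m - x (Suc m)"
      using lower[OF m] \<open>0 < d\<close> by (smt (verit) mult_left_mono)
    then have "\<alpha> * x m powr (- \<alpha> - 1) * (2 * d * (r * x m / G) powr (1 + \<alpha>))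
        \<le> \<alpha> * x m powr (- \<alpha> - 1) * (x m - x (Suc m))"
      using \<open>0 < \<alpha>\<close> by (intro mult_left_mono) auto
    also have "\<dots> \<le> x (Suc m) powr - \<alpha> - x m powr - \<alpha>"
      using pos \<open>0 < \<alpha>\<close> by (rule powr_minus_tangent)
    also have "\<alpha> * x m powr (- \<alpha> - 1) * (2 * d * (r * x m / G) powr (1 + \<alpha>))
        = 2 * d * \<alpha> * ((1 / G) powr (1 + \<alpha>) * r powr (1 + \<alpha>)) * (x m powr (- \<alpha> - 1) * x m powr (1 + \<alpha>))"
      using r pos \<open>0 < G\<close> by (simp add: powr_mult powr_divide)
    also have "x m powr (- \<alpha> - 1) * x m powr (1 + \<alpha>) = 1"
      using pos by (simp flip: powr_add)
    also have "(1 / G) powr (1 + \<alpha>) = G powr (- \<alpha> - 1)"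
    proof -
      have e: "- \<alpha> - 1 = - (1 + \<alpha>)" by simp
      show ?thesis unfolding e powr_minus_divide using \<open>0 < G\<close> by (simp add: powr_divide)
    qed
    finally show ?thesis by simp
  qed
  have "2 * d * \<alpha> * n * (G powr (- \<alpha> - 1) * r powr (1 + \<alpha>))
      = (\<Sum>m<n. 2 * d * \<alpha> * (G powr (- \<alpha> - 1) * r powr (1 + \<alpha>)))" by simp
  also have "\<dots> \<le> (\<Sum>m<n. x (Suc m) powr - \<alpha> - x m powr - \<alpha>)"
    by (intro sum_mono step) simp
  also have "\<dots> = x n powr - \<alpha> - x 0 powr - \<alpha>" by (rule sum_lessThan_telescope)
  also have "\<dots> \<le> x n powr - \<alpha>" by simp
  also have "\<dots> \<le> X0 powr - \<alpha>"
    using \<open>X0 \<le> x n\<close> \<open>0 < X0\<close> \<open>0 < \<alpha>\<close> by (intro powr_mono2') auto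
  finally have "d * (2 * \<alpha> * n) * (G powr (- \<alpha> - 1) * r powr (1 + \<alpha>)) \<le> X0 powr - \<alpha>"
    by (simp add: mult_ac)
  then show ?thesis unfolding d by (simp add: r_def)
qed

text \<open>With \<alpha> = 1 / (\<kappa> - 1), \<open>n\<close> steps of this length reach the time
  1 / (2 \<alpha>). The sequences may change with \<open>n\<close>, but \<open>K\<close> and
  \<open>G\<close> may not, so the correction factor of a single run tends to 1.\<close>

lemma discrete_decay:
  fixes \<kappa> G K X0 :: real
  assumes "1 < \<kappa>" "0 < G" "0 \<le> K" "0 < X0"
    and ex: "\<And>n d. 0 < n \<Longrightarrow> d = (\<kappa> - 1) / (2 * real n) \<Longrightarrow> \<exists>x D. X0 \<le> x n \<and>
      (\<forall>m<n. 0 \<le> D (Suc m) \<and> x (Suc m) \<le> G * D (Suc m) powr (1 - 1 / \<kappa>) \<and>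
         2 * d * D (Suc m) \<le> x m - x (Suc m) \<and> x m - x (Suc m) \<le> 2 * d * K)"
  shows "X0 \<le> G powr \<kappa>"
proof -
  define \<alpha> where "\<alpha> = 1 / (\<kappa> - 1)"
  have \<alpha>: "0 < \<alpha>" "1 / (1 + \<alpha>) = 1 - 1 / \<kappa>" "(\<kappa> - 1) * \<alpha> = 1" "(1 + \<alpha>) * (\<kappa> - 1) = \<kappa>"
    using \<open>1 < \<kappa>\<close> by (auto simp: \<alpha>_def field_simps)
  define dd where "dd n = (\<kappa> - 1) / (2 * real n)" for n
  have dd: "dd \<longlonglongrightarrow> 0" unfolding dd_def by real_asymp
  have "(\<lambda>n. 2 * dd n * K) \<longlonglongrightarrow> 2 * 0 * K" by (intro tendsto_intros dd)
  then have "\<forall>\<^sub>F n in sequentially. 2 * dd n * K < X0"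
    using \<open>0 < X0\<close> by (intro order_tendstoD(2)[of _ 0]) auto
  then have ev: "\<forall>\<^sub>F n in sequentially.
      G powr (- \<alpha> - 1) * (1 - 2 * dd n * K / X0) powr (1 + \<alpha>) \<le> X0 powr - \<alpha>"
    using eventually_gt_at_top[of 0]
  proof eventually_elim
    case (elim n)
    obtain x D where xD: "X0 \<le> x n" "\<forall>m<n. 0 \<le> D (Suc m) \<and> x (Suc m) \<le> G * D (Suc m) powr (1 - 1 / \<kappa>) \<and>
         2 * dd n * D (Suc m) \<le> x m - x (Suc m) \<and> x m - x (Suc m) \<le> 2 * dd n * K"
      using ex[OF elim(2) dd_def] by blast
    have "dd n * (2 * \<alpha> * n) = (\<kappa> - 1) * \<alpha>" using elim(2) by (simp add: dd_def)
    then have 1: "dd n * (2 * \<alpha> * n) = 1" using \<alpha>(3) by simp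
    have 2: "0 < dd n" using elim(2) \<open>1 < \<kappa>\<close> by (simp add: dd_def)
    show ?case
      by (rule discrete_decay_step[of \<alpha> "dd n" G K X0 n x D, OF \<alpha>(1) 2 assms(2-4) _ 1 xD(1)])
        (use xD(2) elim in \<open>auto simp: \<alpha>(2)\<close>)
  qed
  have lim: "(\<lambda>n. G powr (- \<alpha> - 1) * (1 - 2 * dd n * K / X0) powr (1 + \<alpha>))
      \<longlonglongrightarrow> G powr (- \<alpha> - 1) * (1 - 2 * 0 * K / X0) powr (1 + \<alpha>)"
    by (intro tendsto_intros dd) (use \<open>0 < X0\<close> in auto)
  have "G powr (- \<alpha> - 1) \<le> X0 powr - \<alpha>"
    using tendsto_upperbound[OF lim ev] by simp
  \<comment> \<open>The exponent is -1 / \<alpha>; being negative, it reverses the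
    inequality.\<close>
  then have "(X0 powr - \<alpha>) powr - (\<kappa> - 1) \<le> (G powr (- \<alpha> - 1)) powr - (\<kappa> - 1)"
    using assms by (intro powr_mono2') auto
  then have "X0 powr (- \<alpha> * - (\<kappa> - 1)) \<le> G powr ((- \<alpha> - 1) * - (\<kappa> - 1))"
    by (simp only: powr_powr)
  also have "- \<alpha> * - (\<kappa> - 1) = 1" using \<alpha> by (simp add: algebra_simps)
  also have "(- \<alpha> - 1) * - (\<kappa> - 1) = \<kappa>" using \<alpha> by (simp add: algebra_simps)
  finally show ?thesis using \<open>0 < X0\<close> by simp
qed

text \<open>Young's inequality for \<open>f / F\<close> and \<open>g / G\<close>. With the exponents
  placed on the integrands, powers of integrals come out directly, and finite sums are the case of
  counting measure.\<close>

lemma Hoelder: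
  fixes f g :: "'a \<Rightarrow> real"
  assumes p: "0 < p" "p < 1"
    and f: "integrable M f" "AE x in M. 0 \<le> f x"
    and g: "integrable M g" "AE x in M. 0 \<le> g x"
  shows "integrable M (\<lambda>x. f x powr p * g x powr (1 - p))"
    and "(\<integral>x. f x powr p * g x powr (1 - p) \<partial>M) \<le> (\<integral>x. f x \<partial>M) powr p * (\<integral>x. g x \<partial>M) powr (1 - p)"
proof -
  have [measurable]: "f \<in> borel_measurable M" "g \<in> borel_measurable M"
    using f g by auto
  have young: "a powr p * b powr (1 - p) \<le> p * a + (1 - p) * b" if "0 \<le> a" "0 \<le> b" for a b :: real
    using Youngs_inequality_0[of p "1 - p" a b] p that by (cases "a = 0 \<or> b = 0") auto
  show int: "integrable M (\<lambda>x. f x powr p * g x powr (1 - p))"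
  proof (rule Bochner_Integration.integrable_bound)
    show "integrable M (\<lambda>x. p * f x + (1 - p) * g x)" using f g by simp
    show "AE x in M. norm (f x powr p * g x powr (1 - p)) \<le> norm (p * f x + (1 - p) * g x)"
      using f(2) g(2)
    proof eventually_elim
      case (elim x)
      then show ?case using young[of "f x" "g x"] p by simp
    qed
  qed simp
  define F where "F = (\<integral>x. f x \<partial>M)"
  define G where "G = (\<integral>x. g x \<partial>M)"
  have FG: "0 \<le> F" "0 \<le> G" using f g by (auto simp: F_def G_def intro: integral_nonneg_AE)
  show "(\<integral>x. f x powr p * g x powr (1 - p) \<partial>M) \<le> F powr p * G powr (1 - p)"
  proof (cases "F = 0 \<or> G = 0")
    case True
    then have "(AE x in M. f x = 0) \<or> (AE x in M. g x = 0)"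
      using f g by (auto simp: F_def G_def integral_nonneg_eq_0_iff_AE)
    then have "AE x in M. f x powr p * g x powr (1 - p) = 0" by auto
    then have "(\<integral>x. f x powr p * g x powr (1 - p) \<partial>M) = 0"
      by (intro integral_eq_zero_AE)
    then show ?thesis by simp
  next
    case False
    then have pos: "0 < F" "0 < G" using FG by auto
    have "(\<integral>x. f x powr p * g x powr (1 - p) \<partial>M)
        \<le> (\<integral>x. F powr p * G powr (1 - p) * (p * (f x / F) + (1 - p) * (g x / G)) \<partial>M)"
    proof (rule integral_mono_AE[OF int])
      show "integrable M (\<lambda>x. F powr p * G powr (1 - p) * (p * (f x / F) + (1 - p) * (g x / G)))"
        using f g by simp
      show "AE x in M. f x powr p * g x powr (1 - p)
          \<le> F powr p * G powr (1 - p) * (p * (f x / F) + (1 - p) * (g x / G))"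
        using f(2) g(2)
      proof eventually_elim
        case (elim x)
        have "f x powr p * g x powr (1 - p)
            = F powr p * G powr (1 - p) * ((f x / F) powr p * (g x / G) powr (1 - p))"
          using elim pos by (simp add: powr_divide)
        also have "\<dots> \<le> F powr p * G powr (1 - p) * (p * (f x / F) + (1 - p) * (g x / G))"
          using elim pos by (intro mult_left_mono young) auto
        finally show ?case .
      qed
    qed
    also have "\<dots> = F powr p * G powr (1 - p) * (p * (F / F) + (1 - p) * (G / G))"
      using f g unfolding F_def G_def by simp
    also have "\<dots> = F powr p * G powr (1 - p)" using pos by simp
    finally show ?thesis .
  qed
qed

lemma Hoelder_sum:
  fixes f g :: "'a \<Rightarrow> real"
  assumes "0 < p" "p < 1" "finite I" "\<And>y. y \<in> I \<Longrightarrow> 0 \<le> f y" "\<And>y. y \<in> I \<Longrightarrow> 0 \<le> g y"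
  shows "(\<Sum>y\<in>I. f y powr p * g y powr (1 - p)) \<le> (\<Sum>y\<in>I. f y) powr p * (\<Sum>y\<in>I. g y) powr (1 - p)"
  using Hoelder(2)[of p "count_space I" f g] assms
  by (simp add: integrable_count_space lebesgue_integral_count_space_finite AE_count_space)

lemma Hoelder3:
  fixes f g h :: "'a \<Rightarrow> real"
  assumes p: "0 < p" "0 < r" "p + r < 1"
    and f: "integrable M f" "AE x in M. 0 \<le> f x"
    and g: "integrable M g" "AE x in M. 0 \<le> g x"
    and h: "integrable M h" "AE x in M. 0 \<le> h x"
  shows "integrable M (\<lambda>x. f x powr p * g x powr r * h x powr (1 - p - r))"
    and "(\<integral>x. f x powr p * g x powr r * h x powr (1 - p - r) \<partial>M)
      \<le> (\<integral>x. f x \<partial>M) powr p * (\<integral>x. g x \<partial>M) powr r * (\<integral>x. h x \<partial>M) powr (1 - p - r)"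
proof -
  define s where "s = r / (1 - p)"
  have s: "0 < s" "s < 1" "s * (1 - p) = r" "(1 - s) * (1 - p) = 1 - p - r"
    using p by (auto simp: s_def field_simps)
  define k where "k x = g x powr s * h x powr (1 - s)" for x
  have k: "integrable M k" "AE x in M. 0 \<le> k x"
    unfolding k_def using Hoelder(1)[OF s(1,2) g h] by auto
  have eq: "f x powr p * g x powr r * h x powr (1 - p - r) = f x powr p * k x powr (1 - p)" for x
    by (simp add: k_def powr_mult powr_powr s)
  show "integrable M (\<lambda>x. f x powr p * g x powr r * h x powr (1 - p - r))"
    unfolding eq using p by (intro Hoelder(1) f k) auto
  have "(\<integral>x. f x powr p * k x powr (1 - p) \<partial>M) \<le> (\<integral>x. f x \<partial>M) powr p * (\<integral>x. k x \<partial>M) powr (1 - p)"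
    using p by (intro Hoelder(2) f k) auto
  also have "\<dots> \<le> (\<integral>x. f x \<partial>M) powr p * ((\<integral>x. g x \<partial>M) powr s * (\<integral>x. h x \<partial>M) powr (1 - s)) powr (1 - p)"
    unfolding k_def using p Hoelder(2)[OF s(1,2) g h]
    by (intro mult_left_mono powr_mono2) (auto intro: integral_nonneg_AE)
  also have "\<dots> = (\<integral>x. f x \<partial>M) powr p * (\<integral>x. g x \<partial>M) powr r * (\<integral>x. h x \<partial>M) powr (1 - p - r)"
    by (simp add: powr_mult powr_powr s)
  finally show "(\<integral>x. f x powr p * g x powr r * h x powr (1 - p - r) \<partial>M)
      \<le> (\<integral>x. f x \<partial>M) powr p * (\<integral>x. g x \<partial>M) powr r * (\<integral>x. h x \<partial>M) powr (1 - p - r)"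
    unfolding eq .
qed

section \<open>Weighted square-integrable functions\<close>

definition wL2 :: "'a measure \<Rightarrow> ('a \<Rightarrow> real) \<Rightarrow> ('a \<Rightarrow> real) set" where
  "wL2 M w = {u \<in> borel_measurable M. integrable M (\<lambda>x. w x * (u x)\<^sup>2)}"

definition wip :: "'a measure \<Rightarrow> ('a \<Rightarrow> real) \<Rightarrow> ('a \<Rightarrow> real) \<Rightarrow> ('a \<Rightarrow> real) \<Rightarrow> real" where
  "wip M w u v = (\<integral>x. w x * (u x * v x) \<partial>M)"

lemma wL2_measurable: "u \<in> wL2 M w \<Longrightarrow> u \<in> borel_measurable M"
  by (simp add: wL2_def)

lemma wip_self: "wip M w u u = (\<integral>x. w x * (u x)\<^sup>2 \<partial>M)"
  by (simp add: wip_def power2_eq_square)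

lemma wip_integrable:
  assumes [measurable]: "w \<in> borel_measurable M" and w: "AE x in M. 0 \<le> w x"
    and u: "u \<in> wL2 M w" and v: "v \<in> wL2 M w"
  shows "integrable M (\<lambda>x. w x * (u x * v x))"
proof (rule Bochner_Integration.integrable_bound)
  have [measurable]: "u \<in> borel_measurable M" "v \<in> borel_measurable M"
    using u v by (auto simp: wL2_def)
  show "integrable M (\<lambda>x. w x * (u x)\<^sup>2 + w x * (v x)\<^sup>2)"
    using u v by (auto simp: wL2_def)
  show "(\<lambda>x. w x * (u x * v x)) \<in> borel_measurable M" by measurable
  show "AE x in M. norm (w x * (u x * v x)) \<le> norm (w x * (u x)\<^sup>2 + w x * (v x)\<^sup>2)"
    using w
  proof eventually_elim
    case (elim x)
    have "2 * \<bar>u x * v x\<bar> \<le> (u x)\<^sup>2 + (v x)\<^sup>2"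
      using sum_squares_bound[of "\<bar>u x\<bar>" "\<bar>v x\<bar>"] by (simp add: abs_mult)
    then have "\<bar>u x * v x\<bar> \<le> (u x)\<^sup>2 + (v x)\<^sup>2" by (smt (verit) abs_ge_zero)
    from mult_left_mono[OF this elim] show ?case
      using elim by (simp add: abs_mult distrib_left)
  qed
qed

lemma semi_inner_wip:
  assumes [measurable]: "w \<in> borel_measurable M" and w: "AE x in M. 0 \<le> w x"
  shows "semi_inner (wL2 M w) (wip M w)"
proof
  note int = wip_integrable[OF assms]
  show "subspace (wL2 M w)"
  proof (rule subspaceI)
    fix u v :: "'a \<Rightarrow> real" and c :: real
    assume u: "u \<in> wL2 M w"
    then have [measurable]: "u \<in> borel_measurable M" by (rule wL2_measurable)
    have "integrable M (\<lambda>x. c\<^sup>2 * (w x * (u x)\<^sup>2))" using u by (auto simp: wL2_def)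
    then show "c *\<^sub>R u \<in> wL2 M w"
      by (simp add: wL2_def scaleR_fun_def power_mult_distrib mult_ac)
    assume v: "v \<in> wL2 M w"
    then have [measurable]: "v \<in> borel_measurable M" by (rule wL2_measurable)
    have "integrable M (\<lambda>x. w x * (u x)\<^sup>2 + 2 * (w x * (u x * v x)) + w x * (v x)\<^sup>2)"
      using u v int[OF u v] by (auto simp: wL2_def)
    then show "u + v \<in> wL2 M w"
      by (simp add: wL2_def plus_fun_def power2_eq_square algebra_simps)
  qed (simp add: wL2_def zero_fun_def)
  fix u v z :: "'a \<Rightarrow> real" and c :: real
  show "wip M w u v = wip M w v u" by (simp add: wip_def mult.commute)
  show "wip M w (c *\<^sub>R u) z = c * wip M w u z"
    by (simp add: wip_def mult_ac)
  assume u: "u \<in> wL2 M w"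
  show "0 \<le> wip M w u u"
    unfolding wip_self by (rule integral_nonneg_AE) (use w in auto)
  assume "v \<in> wL2 M w" "z \<in> wL2 M w"
  then show "wip M w (u + v) z = wip M w u z + wip M w v z"
    using int[OF u, of z] int[of v z] by (simp add: wip_def algebra_simps)
qed

abbreviation "ip0 M \<equiv> wip M (\<lambda>x. 1)"
abbreviation "rL2 M \<equiv> wL2 M (\<lambda>x. 1)"

text \<open>Riesz--Fischer: a rapidly Cauchy subsequence converges almost everywhere, and Fatou's
  lemma along it bounds the distance of the full sequence to the limit.\<close>

lemma L2_complete:
  fixes s :: "nat \<Rightarrow> 'a \<Rightarrow> real"
  assumes meas [measurable]: "\<And>n. s n \<in> borel_measurable M"
    and int: "\<And>n. integrable M (\<lambda>x. (s n x)\<^sup>2)"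
    and Cau: "\<And>e. 0 < e \<Longrightarrow> \<exists>N. \<forall>m\<ge>N. \<forall>n\<ge>N. (\<integral>x. (s m x - s n x)\<^sup>2 \<partial>M) < e"
  shows "\<exists>u\<in>borel_measurable M. integrable M (\<lambda>x. (u x)\<^sup>2) \<and>
    (\<lambda>n. \<integral>x. (s n x - u x)\<^sup>2 \<partial>M) \<longlonglongrightarrow> 0"
proof -
  have sL: "s n \<in> rL2 M" for n using int by (simp add: wL2_def)
  interpret L: semi_inner "rL2 M" "ip0 M" by (rule semi_inner_wip) auto
  have dint: "integrable M (\<lambda>x. (s m x - s n x)\<^sup>2)" for m n
    using L.mem(3)[OF sL[of m] sL[of n]] by (simp add: wL2_def)
  define N where "N e = (SOME N. \<forall>m\<ge>N. \<forall>n\<ge>N. (\<integral>x. (s m x - s n x)\<^sup>2 \<partial>M) < e)" for e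
  have N: "(\<integral>x. (s m x - s n x)\<^sup>2 \<partial>M) < e" if "0 < e" "m \<ge> N e" "n \<ge> N e" for e m n
    using someI_ex[OF Cau[OF that(1)]] that unfolding N_def by blast
  define r where "r k = k + (\<Sum>j\<le>k. N ((1/4) ^ j))" for k :: nat
  have r_ge: "k \<le> r k" and rN: "N ((1/4) ^ k) \<le> r k" and r_suc: "r k \<le> r (Suc k)" for k
    by (auto simp: r_def intro: trans_le_add2 member_le_sum)
  \<comment> \<open>Squared distances along \<open>r\<close> are below \<open>(1/4) ^ k\<close>, so
    the weight leaves integrals below \<open>(1/2) ^ k\<close>. Pointwise, increments are at most
    \<open>(1/2) ^ k + h k x\<close> by the inequality of the means, which gives absolute
    convergence.\<close>
  define h where "h k x = 2 ^ k * (s (r (Suc k)) x - s (r k) x)\<^sup>2" for k x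
  have h_meas [measurable]: "h k \<in> borel_measurable M" for k unfolding h_def by measurable
  have h_int: "(\<integral>\<^sup>+x. ennreal (h k x) \<partial>M) \<le> ennreal ((1/2) ^ k)" for k
  proof -
    have "(\<integral>x. (s (r (Suc k)) x - s (r k) x)\<^sup>2 \<partial>M) < (1/4) ^ k"
      using rN[of k] r_suc[of k] by (intro N) auto
    then have "2 ^ k * (\<integral>x. (s (r (Suc k)) x - s (r k) x)\<^sup>2 \<partial>M) \<le> 2 ^ k * (1/4) ^ k"
      by (intro mult_left_mono) auto
    also have "(2::real) ^ k * (1/4) ^ k = (1/2) ^ k" by (simp flip: power_mult_distrib)
    finally have "(\<integral>x. h k x \<partial>M) \<le> (1/2) ^ k" by (simp add: h_def)
    moreover have "(\<integral>\<^sup>+x. ennreal (h k x) \<partial>M) = ennreal (\<integral>x. h k x \<partial>M)"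
      using dint by (intro nn_integral_eq_integral) (auto simp: h_def)
    ultimately show ?thesis by (simp add: ennreal_leI)
  qed
  have "(\<integral>\<^sup>+x. (\<Sum>k. ennreal (h k x)) \<partial>M) = (\<Sum>k. \<integral>\<^sup>+x. ennreal (h k x) \<partial>M)"
    by (intro nn_integral_suminf) measurable
  also have "\<dots> \<le> (\<Sum>k. ennreal ((1/2) ^ k))" by (intro suminf_le h_int) auto
  also have "\<dots> = ennreal (\<Sum>k. (1/2) ^ k)" by (intro suminf_ennreal2) auto
  also have "\<dots> < \<infinity>" by simp
  finally have "AE x in M. (\<Sum>k. ennreal (h k x)) \<noteq> \<infinity>"
    by (intro nn_integral_PInf_AE) auto
  then have conv: "AE x in M. convergent (\<lambda>k. s (r k) x)"
  proof eventually_elim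
    case (elim x)
    have "summable (\<lambda>k. h k x)"
      using elim by (intro summable_suminf_not_top) (auto simp: h_def)
    then have sm: "summable (\<lambda>k. (1/2) ^ k + h k x)" by (intro summable_add summable_geometric) auto
    have "\<bar>s (r (Suc k)) x - s (r k) x\<bar> \<le> (1/2) ^ k + h k x" for k
    proof -
      define y where "y = \<bar>s (r (Suc k)) x - s (r k) x\<bar>"
      have "0 \<le> (1 - 2 ^ k * y)\<^sup>2" by simp
      then have "2 * (2 ^ k * y) \<le> 1 + (2 ^ k * y)\<^sup>2" by (simp add: power2_eq_square algebra_simps)
      moreover have "0 \<le> 2 ^ k * y" by (simp add: y_def)
      ultimately have "2 ^ k * y \<le> 1 + (2 ^ k * y)\<^sup>2" by linarith
      then have "(1/2) ^ k * (2 ^ k * y) \<le> (1/2) ^ k * (1 + (2 ^ k * y)\<^sup>2)"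
        by (intro mult_left_mono) auto
      also have "(1/2) ^ k * (2 ^ k * y) = y" by (simp add: power_divide)
      also have "(1/2) ^ k * (1 + (2 ^ k * y)\<^sup>2) = (1/2) ^ k + 2 ^ k * y\<^sup>2"
        by (simp add: power_divide power2_eq_square field_simps)
      finally show ?thesis by (simp add: y_def h_def)
    qed
    then have "summable (\<lambda>k. s (r (Suc k)) x - s (r k) x)"
      by (intro summable_comparison_test'[OF sm, of 0]) auto
    then have "convergent (\<lambda>n. \<Sum>k<n. s (r (Suc k)) x - s (r k) x)"
      by (simp add: summable_iff_convergent)
    then have "convergent (\<lambda>n. s (r n) x - s (r 0) x)"
      by (simp add: sum_lessThan_telescope[of "\<lambda>k. s (r k) x"])
    then show ?case using convergent_add[OF _ convergent_const, of "\<lambda>n. s (r n) x - s (r 0) x" "s (r 0) x"]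
      by simp
  qed
  define u where "u x = lim (\<lambda>k. s (r k) x)" for x
  have [measurable]: "u \<in> borel_measurable M" unfolding u_def by measurable
  have lim: "AE x in M. (\<lambda>k. s (r k) x) \<longlonglongrightarrow> u x"
    using conv by eventually_elim (simp add: u_def convergent_LIMSEQ_iff)
  have bound: "(\<integral>\<^sup>+x. ennreal ((s m x - u x)\<^sup>2) \<partial>M) \<le> ennreal e" if "0 < e" "N e \<le> m" for e m
  proof -
    have "(\<integral>\<^sup>+x. ennreal ((s m x - u x)\<^sup>2) \<partial>M)
        = (\<integral>\<^sup>+x. liminf (\<lambda>k. ennreal ((s m x - s (r k) x)\<^sup>2)) \<partial>M)"
    proof (rule nn_integral_cong_AE, use lim in eventually_elim)
      case (elim x)
      then have "(\<lambda>k. ennreal ((s m x - s (r k) x)\<^sup>2)) \<longlonglongrightarrow> ennreal ((s m x - u x)\<^sup>2)"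
        by (intro tendsto_intros) auto
      then show ?case by (intro lim_imp_Liminf[symmetric]) auto
    qed
    also have "\<dots> \<le> liminf (\<lambda>k. \<integral>\<^sup>+x. ennreal ((s m x - s (r k) x)\<^sup>2) \<partial>M)"
      by (intro nn_integral_liminf) measurable
    also have "\<dots> \<le> limsup (\<lambda>k. \<integral>\<^sup>+x. ennreal ((s m x - s (r k) x)\<^sup>2) \<partial>M)"
      by (intro Liminf_le_Limsup) auto
    also have "\<dots> \<le> ennreal e"
    proof (rule Limsup_bounded)
      show "\<forall>\<^sub>F k in sequentially. (\<integral>\<^sup>+x. ennreal ((s m x - s (r k) x)\<^sup>2) \<partial>M) \<le> ennreal e"
        using eventually_ge_at_top[of "N e"]
      proof eventually_elim
        case (elim k)
        have "(\<integral>x. (s m x - s (r k) x)\<^sup>2 \<partial>M) < e"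
          using that elim r_ge[of k] by (intro N) auto
        then show ?case using dint by (simp add: nn_integral_eq_integral ennreal_leI)
      qed
    qed
    finally show ?thesis .
  qed
  have dI: "integrable M (\<lambda>x. (s m x - u x)\<^sup>2)" if "N 1 \<le> m" for m
    using bound[of 1 m] that by (intro integrableI_bounded) (auto simp: order_le_less_trans)
  have "s (N 1) - u \<in> rL2 M" using dI[of "N 1"] by (simp add: wL2_def fun_diff_def)
  then have "s (N 1) - (s (N 1) - u) \<in> rL2 M" using L.mem(3)[OF sL] by blast
  then have uL: "u \<in> rL2 M" by simp
  have dI': "integrable M (\<lambda>x. (s m x - u x)\<^sup>2)" for m
    using L.mem(3)[OF sL[of m] uL] by (simp add: wL2_def)
  have "(\<lambda>n. \<integral>x. (s n x - u x)\<^sup>2 \<partial>M) \<longlonglongrightarrow> 0"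
  proof (rule LIMSEQ_I)
    fix e :: real assume e: "0 < e"
    have "norm ((\<integral>x. (s n x - u x)\<^sup>2 \<partial>M) - 0) < e" if "N (e/2) \<le> n" for n
    proof -
      have "ennreal (\<integral>x. (s n x - u x)\<^sup>2 \<partial>M) \<le> ennreal (e / 2)"
        using bound[of "e/2" n] that e dI'[of n] by (simp add: nn_integral_eq_integral)
      then show ?thesis using e by simp
    qed
    then show "\<exists>no. \<forall>n\<ge>no. norm ((\<integral>x. (s n x - u x)\<^sup>2 \<partial>M) - 0) < e" by blast
  qed
  then show ?thesis using uL by (auto simp: wL2_def)
qed

section \<open>The real part of a form\<close>

abbreviation cplx :: "('a \<Rightarrow> real) \<Rightarrow> 'a \<Rightarrow> complex" where
  "cplx u \<equiv> \<lambda>x. complex_of_real (u x)"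

locale real_form =
  fixes M :: "'a measure" and D :: "('a \<Rightarrow> complex) set" and t :: "('a \<Rightarrow> complex) \<Rightarrow> real"
  assumes closed: "closed_nonneg_form M D t"
    and Re_closed: "w \<in> D \<Longrightarrow> cplx (\<lambda>x. Re (w x)) \<in> D"
    and t_Re_Im: "cplx u \<in> D \<Longrightarrow> cplx v \<in> D \<Longrightarrow>
      t (\<lambda>x. complex_of_real (u x) + \<i> * complex_of_real (v x)) = t (cplx u) + t (cplx v)"
    and abs_closed: "cplx u \<in> D \<Longrightarrow> cplx (\<lambda>x. \<bar>u x\<bar>) \<in> D"
    and t_abs: "cplx u \<in> D \<Longrightarrow> t (cplx (\<lambda>x. \<bar>u x\<bar>)) \<le> t (cplx u)"
begin

lemma D_L2: "u \<in> D \<Longrightarrow> u \<in> L2 M"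
  and D_subspace: "csubspace_fun D"
  and t_nonneg: "u \<in> D \<Longrightarrow> 0 \<le> t u"
  and t_closed: "closed_form M D t"
  and t_sesq: "\<exists>a. sesquilinear_on D a \<and> (\<forall>u\<in>D. complex_of_real (t u) = a u u)"
  using closed by (auto simp: closed_nonneg_form_def quadratic_form_def)

definition a where "a = (SOME a. sesquilinear_on D a \<and> (\<forall>u\<in>D. complex_of_real (t u) = a u u))"

lemma a: "sesquilinear_on D a" "u \<in> D \<Longrightarrow> a u u = complex_of_real (t u)"
  using someI_ex[OF t_sesq] by (auto simp: a_def)

definition DR :: "('a \<Rightarrow> real) set" where "DR = {u. cplx u \<in> D}"

definition tr :: "('a \<Rightarrow> real) \<Rightarrow> ('a \<Rightarrow> real) \<Rightarrow> real" where
  "tr u v = Re (a (cplx u) (cplx v))"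

lemma D_add: "u \<in> D \<Longrightarrow> v \<in> D \<Longrightarrow> (\<lambda>x. u x + v x) \<in> D"
  and D_scale: "u \<in> D \<Longrightarrow> (\<lambda>x. c * u x) \<in> D"
  and D_zero: "(\<lambda>x. 0) \<in> D"
  using D_subspace unfolding csubspace_fun_def by blast+

lemma Im_closed: "w \<in> D \<Longrightarrow> cplx (\<lambda>x. Im (w x)) \<in> D"
  using Re_closed[OF D_scale[of w "- \<i>"]] by simp

lemma t_split: "w \<in> D \<Longrightarrow> t w = t (cplx (\<lambda>x. Re (w x))) + t (cplx (\<lambda>x. Im (w x)))"
  using t_Re_Im[OF Re_closed Im_closed, of w w] by (simp add: complex_eq[symmetric])

lemma DR_rL2: "DR \<subseteq> rL2 M"
proof
  fix u assume "u \<in> DR"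
  then have u: "cplx u \<in> borel_measurable M" "integrable M (\<lambda>x. (cmod (cplx u x))\<^sup>2)"
    using D_L2[of "cplx u"] by (auto simp: DR_def L2_def)
  have "(\<lambda>x. Re (cplx u x)) \<in> borel_measurable M" using u(1) by measurable
  then show "u \<in> rL2 M" using u(2) by (simp add: wL2_def)
qed

lemma tr_self: "u \<in> DR \<Longrightarrow> tr u u = t (cplx u)"
  by (simp add: tr_def DR_def a)

lemma a_add:
  assumes "u \<in> D" "v \<in> D" "w \<in> D"
  shows "a (\<lambda>x. u x + v x) w = a u w + a v w" "a w (\<lambda>x. u x + v x) = a w u + a w v"
  using a(1)[unfolded sesquilinear_on_def, THEN conjunct1, rule_format, OF assms] by auto

lemma a_scale:
  assumes "u \<in> D" "w \<in> D"
  shows "a (\<lambda>x. c * u x) w = cnj c * a u w" "a w (\<lambda>x. c * u x) = c * a w u"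
  using a(1)[unfolded sesquilinear_on_def, THEN conjunct2, rule_format, OF assms] by auto

text \<open>The form is real on the diagonal, and the imaginary part of its value at u + \<i> v
  yields the difference of the two sides. This supplies the symmetry of \<open>tr\<close>, which
  sesquilinearity alone does not contain.\<close>

lemma a_herm:
  assumes u: "u \<in> D" and v: "v \<in> D"
  shows "Re (a u v) = Re (a v u)"
proof -
  define iv where "iv = (\<lambda>x. \<i> * v x)"
  have iv: "iv \<in> D" using v unfolding iv_def by (rule D_scale)
  have uiv: "(\<lambda>x. u x + iv x) \<in> D" using u iv by (rule D_add)
  have "a (\<lambda>x. u x + iv x) (\<lambda>x. u x + iv x) = a u u + a u iv + (a iv u + a iv iv)"
    using u iv uiv by (simp add: a_add)
  moreover have "a u iv = \<i> * a u v" "a iv u = - \<i> * a v u"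
    unfolding iv_def using u v by (simp_all add: a_scale)
  moreover have "Im (a u u) = 0" "Im (a iv iv) = 0" "Im (a (\<lambda>x. u x + iv x) (\<lambda>x. u x + iv x)) = 0"
    using a(2)[OF u] a(2)[OF iv] a(2)[OF uiv] by simp_all
  ultimately show ?thesis by simp
qed

sublocale tr: semi_inner DR tr
proof
  show "subspace DR"
  proof (rule subspaceI)
    show "0 \<in> DR" using D_zero by (simp add: DR_def zero_fun_def)
    show "u + v \<in> DR" if "u \<in> DR" "v \<in> DR" for u v
      using D_add[of "cplx u" "cplx v"] that by (simp add: DR_def)
    show "c *\<^sub>R u \<in> DR" if "u \<in> DR" for u c
      using D_scale[of "cplx u" "complex_of_real c"] that by (simp add: DR_def)
  qed
  fix u v w and c :: real
  assume u: "u \<in> DR"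
  then have u': "cplx u \<in> D" by (simp add: DR_def)
  show "0 \<le> tr u u" using u t_nonneg by (simp add: tr_self DR_def)
  { assume v: "v \<in> DR"
    then have v': "cplx v \<in> D" by (simp add: DR_def)
    show "tr u v = tr v u" unfolding tr_def using u' v' by (rule a_herm)
    assume w: "w \<in> DR"
    then have w': "cplx w \<in> D" by (simp add: DR_def)
    have "a (\<lambda>x. cplx u x + cplx v x) (cplx w) = a (cplx u) (cplx w) + a (cplx v) (cplx w)"
      using u' v' w' by (rule a_add)
    then show "tr (u + v) w = tr u w + tr v w" by (simp add: tr_def) }
  assume "w \<in> DR"
  then have w': "cplx w \<in> D" by (simp add: DR_def)
  have "a (\<lambda>x. complex_of_real c * cplx u x) (cplx w) = cnj (complex_of_real c) * a (cplx u) (cplx w)"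
    using u' w' by (rule a_scale)
  then show "tr (c *\<^sub>R u) w = c * tr u w" by (simp add: tr_def)
qed

sublocale l2: semi_inner "rL2 M" "ip0 M" by (rule semi_inner_wip) auto

definition te :: "real \<Rightarrow> ('a \<Rightarrow> real) \<Rightarrow> ('a \<Rightarrow> real) \<Rightarrow> real" where
  "te \<epsilon> u v = tr u v + \<epsilon> * ip0 M u v"

lemma te_semi_inner:
  assumes "0 \<le> \<epsilon>"
  shows "semi_inner DR (te \<epsilon>)"
proof
  show "subspace DR" by (rule tr.subspace)
  fix u v w and c :: real
  assume u: "u \<in> DR"
  then have u': "u \<in> rL2 M" using DR_rL2 by auto
  show "0 \<le> te \<epsilon> u u" using tr.nonneg[OF u] l2.nonneg[OF u'] assms by (simp add: te_def)
  { assume v: "v \<in> DR"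
    then have v': "v \<in> rL2 M" using DR_rL2 by auto
    show "te \<epsilon> u v = te \<epsilon> v u" unfolding te_def using tr.sym[OF u v] l2.sym[OF u' v'] by simp
    assume w: "w \<in> DR"
    then have w': "w \<in> rL2 M" using DR_rL2 by auto
    show "te \<epsilon> (u + v) w = te \<epsilon> u w + te \<epsilon> v w"
      unfolding te_def tr.add_left[OF u v w] l2.add_left[OF u' v' w'] by (simp add: algebra_simps) }
  assume w: "w \<in> DR"
  then have w': "w \<in> rL2 M" using DR_rL2 by auto
  show "te \<epsilon> (c *\<^sub>R u) w = c * te \<epsilon> u w"
    unfolding te_def tr.scale_left[OF u w] l2.scale_left[OF u' w'] by (simp add: algebra_simps)
qed

text \<open>Because \<epsilon> is positive, a Cauchy sequence for the form is also Cauchy in L^2.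
  Its limit there belongs to the domain because the form is closed.\<close>

lemma te_complete:
  assumes "0 < \<epsilon>"
  shows "semi_inner.complete DR (te \<epsilon>)"
proof -
  interpret te: semi_inner DR "te \<epsilon>" using assms by (intro te_semi_inner) simp
  show ?thesis unfolding te.complete_def
  proof (intro allI impI, elim conjE)
    fix s :: "nat \<Rightarrow> 'a \<Rightarrow> real"
    assume s: "\<forall>n. s n \<in> DR"
      and cau: "\<forall>e>0. \<exists>N. \<forall>m\<ge>N. \<forall>n\<ge>N. te \<epsilon> (s m - s n) (s m - s n) < e"
    have sD: "s n \<in> DR" "s n \<in> rL2 M" "cplx (s n) \<in> D" for n using s DR_rL2 by (auto simp: DR_def)
    have dD: "s m - s n \<in> DR" "s m - s n \<in> rL2 M" for m n using sD by auto
    have 1: "\<exists>N. \<forall>m\<ge>N. \<forall>n\<ge>N. (\<integral>x. (s m x - s n x)\<^sup>2 \<partial>M) < e" if "0 < e" for e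
    proof -
      obtain N where N: "\<forall>m\<ge>N. \<forall>n\<ge>N. te \<epsilon> (s m - s n) (s m - s n) < \<epsilon> * e"
        using cau[rule_format, of "\<epsilon> * e"] assms \<open>0 < e\<close> by auto
      have "(\<integral>x. (s m x - s n x)\<^sup>2 \<partial>M) < e" if "m \<ge> N" "n \<ge> N" for m n
      proof -
        have "\<epsilon> * ip0 M (s m - s n) (s m - s n) < \<epsilon> * e"
          using N[rule_format, OF that] tr.nonneg[OF dD(1), of m n] by (simp add: te_def)
        then show ?thesis using assms by (simp add: wip_self)
      qed
      then show ?thesis by blast
    qed
    have "\<exists>u\<in>borel_measurable M. integrable M (\<lambda>x. (u x)\<^sup>2) \<and> (\<lambda>n. \<integral>x. (s n x - u x)\<^sup>2 \<partial>M) \<longlonglongrightarrow> 0"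
      by (rule L2_complete) (use sD(2) 1 in \<open>auto simp: wL2_def\<close>)
    then obtain u where u: "u \<in> borel_measurable M" "integrable M (\<lambda>x. (u x)\<^sup>2)"
      "(\<lambda>n. \<integral>x. (s n x - u x)\<^sup>2 \<partial>M) \<longlonglongrightarrow> 0" by blast
    have uL: "cplx u \<in> L2 M" using u by (auto simp: L2_def)
    have "(\<lambda>n. L2_sq M (\<lambda>x. cplx (s n) x - cplx u x)) \<longlonglongrightarrow> 0"
      using u(3) by (simp add: L2_sq_def flip: of_real_diff)
    moreover have "\<exists>N. \<forall>m\<ge>N. \<forall>n\<ge>N. t (\<lambda>x. cplx (s m) x - cplx (s n) x) < e" if "0 < e" for e
    proof -
      obtain N where N: "\<forall>m\<ge>N. \<forall>n\<ge>N. te \<epsilon> (s m - s n) (s m - s n) < e"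
        using cau \<open>0 < e\<close> by blast
      have "t (\<lambda>x. cplx (s m) x - cplx (s n) x) < e" if "m \<ge> N" "n \<ge> N" for m n
      proof -
        have "0 \<le> \<epsilon> * ip0 M (s m - s n) (s m - s n)"
          using l2.nonneg[OF dD(2)] assms by simp
        then have "tr (s m - s n) (s m - s n) < e"
          using N[rule_format, OF that] by (simp add: te_def)
        then show ?thesis using tr_self[OF dD(1), of m n] by simp
      qed
      then show ?thesis by blast
    qed
    ultimately have "cplx u \<in> D \<and> (\<lambda>n. t (\<lambda>x. cplx (s n) x - cplx u x)) \<longlonglongrightarrow> 0"
      using t_closed[unfolded closed_form_def, rule_format, of "\<lambda>n. cplx (s n)" "cplx u"] sD(3) uL by blast
    then have uD: "u \<in> DR" and tl: "(\<lambda>n. t (\<lambda>x. cplx (s n) x - cplx u x)) \<longlonglongrightarrow> 0"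
      by (auto simp: DR_def)
    have "te \<epsilon> (s n - u) (s n - u) = t (\<lambda>x. cplx (s n) x - cplx u x) + \<epsilon> * (\<integral>x. (s n x - u x)\<^sup>2 \<partial>M)" for n
      using tr_self[OF tr.mem(3)[OF sD(1) uD], of n] by (simp add: te_def wip_self)
    moreover have "(\<lambda>n. t (\<lambda>x. cplx (s n) x - cplx u x) + \<epsilon> * (\<integral>x. (s n x - u x)\<^sup>2 \<partial>M)) \<longlonglongrightarrow> 0 + \<epsilon> * 0"
      by (intro tendsto_intros tl u(3))
    ultimately have "(\<lambda>n. te \<epsilon> (s n - u) (s n - u)) \<longlonglongrightarrow> 0" by simp
    then show "\<exists>u\<in>DR. (\<lambda>n. te \<epsilon> (s n - u) (s n - u)) \<longlonglongrightarrow> 0" using uD by blast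
  qed
qed

end

section \<open>Decay of the resolvent iterates under a Sobolev inequality\<close>

locale sobolev_form = real_form +
  fixes \<kappa> q S :: real and V :: "'a \<Rightarrow> real"
  assumes \<kappa>: "1 < \<kappa>" and q: "q = 2 * \<kappa> / (\<kappa> - 1)" and S: "0 < S"
    and sobolev: "sobolev_inequality M D t q S"
    and V_meas [measurable]: "V \<in> borel_measurable M" and V_nonneg: "0 \<le> V x"
    and V_int: "integrable M (\<lambda>x. V x powr \<kappa>)"
begin

definition A :: real where "A = (\<integral>x. V x powr \<kappa> \<partial>M)"

text \<open>Hoelder and Sobolev bound the integral of V u^2 by G t[u]; the same constant governs the
  decay inequality x \<le> G D^(1 - 1/\<kappa>).\<close>

definition G :: real where "G = A powr (1 / \<kappa>) / S"

lemma A_nonneg: "0 \<le> A"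
  unfolding A_def by (rule integral_nonneg_AE) simp

lemma G_nonneg: "0 \<le> G"
  using S by (simp add: G_def)

lemma exponents: "0 < q" "2 / q = 1 - 1 / \<kappa>" "q * (1 - 1 / \<kappa>) = 2" "0 < 1 / \<kappa>" "1 / \<kappa> < 1"
  using \<kappa> by (auto simp: q field_simps)

sublocale ip: semi_inner "wL2 M V" "wip M V"
  by (rule semi_inner_wip) (auto simp: V_nonneg)

lemma sobolev_real:
  assumes "u \<in> DR"
  shows "integrable M (\<lambda>x. \<bar>u x\<bar> powr q)" "S * (\<integral>x. \<bar>u x\<bar> powr q \<partial>M) powr (2 / q) \<le> tr u u"
  using sobolev assms tr_self[OF assms] unfolding sobolev_inequality_def DR_def by fastforce+

lemma wip_le:
  assumes u: "u \<in> DR"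
  shows "u \<in> wL2 M V" "wip M V u u \<le> G * tr u u"
proof -
  have [measurable]: "u \<in> borel_measurable M" using DR_rL2 u wL2_measurable by blast
  have eq: "(V x powr \<kappa>) powr (1 / \<kappa>) * (\<bar>u x\<bar> powr q) powr (1 - 1 / \<kappa>) = V x * (u x)\<^sup>2" for x
    using V_nonneg[of x] \<kappa> by (simp add: powr_powr exponents powr_one_gt_zero_iff)
  note H = Hoelder[OF exponents(4,5) V_int _ sobolev_real(1)[OF u], unfolded eq]
  show "u \<in> wL2 M V" using H(1) by (simp add: wL2_def)
  have "wip M V u u \<le> A powr (1 / \<kappa>) * (\<integral>x. \<bar>u x\<bar> powr q \<partial>M) powr (2 / q)"
    using H(2) by (simp add: wip_self A_def exponents(2))
  also have "\<dots> = G * (S * (\<integral>x. \<bar>u x\<bar> powr q \<partial>M) powr (2 / q))"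
    using S by (simp add: G_def)
  also have "\<dots> \<le> G * tr u u"
    using sobolev_real(2)[OF u] G_nonneg by (rule mult_left_mono)
  finally show "wip M V u u \<le> G * tr u u" .
qed

text \<open>Chosen so that V f^2 = V^\<kappa>. Its products with the cell vectors carry the factor
  in Hoelder's inequality that Bessel's inequality later sums to \<open>A\<close>.\<close>

definition f :: "'a \<Rightarrow> real" where "f x = V x powr ((\<kappa> - 1) / 2)"

lemma f: "f \<in> wL2 M V" "wip M V f f = A"
proof -
  have [measurable]: "f \<in> borel_measurable M" unfolding f_def[abs_def] by measurable
  have eq: "V x * (f x)\<^sup>2 = V x powr \<kappa>" for x
  proof (cases "V x = 0")
    case False
    then have "0 < V x" using V_nonneg[of x] by simp
    then have "V x * (f x)\<^sup>2 = V x powr (1 + (\<kappa> - 1) / 2 + (\<kappa> - 1) / 2)"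
      unfolding powr_add by (simp add: f_def power2_eq_square)
    also have "1 + (\<kappa> - 1) / 2 + (\<kappa> - 1) / 2 = \<kappa>" by simp
    finally show ?thesis .
  qed (use \<kappa> in simp)
  show "f \<in> wL2 M V" using V_int by (simp add: wL2_def eq)
  show "wip M V f f = A" by (simp add: wip_self eq A_def)
qed

end

locale sobolev_form_eps = sobolev_form +
  fixes \<epsilon> :: real
  assumes \<epsilon>: "0 < \<epsilon>"
begin

lemma tr_le_te: "u \<in> DR \<Longrightarrow> tr u u \<le> te \<epsilon> u u"
  using l2.nonneg[of u] DR_rL2 \<epsilon> by (auto simp: te_def)

sublocale fp: form_pair "wL2 M V" DR "wip M V" "te \<epsilon>" G
proof -
  interpret te: semi_inner DR "te \<epsilon>" using \<epsilon> by (intro te_semi_inner) simp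
  show "form_pair (wL2 M V) DR (wip M V) (te \<epsilon>) G"
  proof
    show "DR \<subseteq> wL2 M V" using wip_le by blast
    show "te.complete" using \<epsilon> by (rule te_complete)
    show "0 \<le> G" by (rule G_nonneg)
    fix u assume u: "u \<in> DR"
    have "G * tr u u \<le> G * te \<epsilon> u u" using tr_le_te[OF u] G_nonneg by (rule mult_left_mono)
    then show "wip M V u u \<le> G * te \<epsilon> u u" using wip_le(2)[OF u] by linarith
  qed
qed

text \<open>With \<open>w = B g\<close>, the number \<open>b g g\<close> is both the integral of V g
  w and \<open>te \<epsilon> w w\<close>. Hoelder with three factors bounds the integral by a
  multiple of the L^q norm of \<open>w\<close>, Sobolev bounds the square of that norm by
  \<open>b g g / S\<close>, and after squaring one factor \<open>b g g\<close> cancels.\<close>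

lemma b_le:
  assumes g: "g \<in> wL2 M V" and g0: "AE x in M. 0 \<le> g x"
  shows "fp.b g g \<le> (1 / S) * ((wip M V g g) powr (1 - 1 / \<kappa>) * ((wip M V f g)\<^sup>2) powr (1 / \<kappa>))"
proof -
  define w where "w = fp.B g"
  define \<beta> where "\<beta> = fp.b g g"
  define P where "P = wip M V g g"
  define F where "F = wip M V f g"
  define W where "W = (\<integral>x. \<bar>w x\<bar> powr q \<partial>M)"
  \<comment> \<open>Forced by homogeneity: with exponents \<open>p\<close>, 1/\<kappa> and 1/q on V
    g^2, V f g and |w|^q, the powers of V and of g each add up to 1.\<close>
  define p where "p = (1 - 1 / \<kappa>) / 2"
  have p: "0 < p" "p + 1 / \<kappa> < 1" "1 - p - 1 / \<kappa> = 1 / q" "2 * p + 1 / \<kappa> = 1" "2 * p = 1 - 1 / \<kappa>"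
    "p + (1 / \<kappa>) * (1 + (\<kappa> - 1) / 2) = 1"
    using \<kappa> by (auto simp: p_def q field_simps)
  have w: "w \<in> DR" using g fp.B(1) by (simp add: w_def)
  have [measurable]: "g \<in> borel_measurable M" "w \<in> borel_measurable M" "f \<in> borel_measurable M"
    by (rule wL2_measurable[OF g], rule wL2_measurable[OF wip_le(1)[OF w]], rule wL2_measurable[OF f(1)])
  have \<beta>_te: "\<beta> = te \<epsilon> w w" using g by (simp add: \<beta>_def w_def fp.b_eq_te)
  have \<beta>0: "0 \<le> \<beta>" unfolding \<beta>_def using g by (rule fp.b.nonneg)
  have P0: "0 \<le> P" unfolding P_def using g by (rule ip.nonneg)
  have F0: "0 \<le> F" unfolding F_def wip_def
    using g0 by (intro integral_nonneg_AE) (auto simp: f_def V_nonneg)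
  have W0: "0 \<le> W" unfolding W_def by (rule integral_nonneg_AE) simp
  have SW: "S * W powr (2 / q) \<le> \<beta>"
    using sobolev_real(2)[OF w] tr_le_te[OF w] \<beta>_te by (simp add: W_def)
  have eq: "AE x in M. V x * (g x * \<bar>w x\<bar>)
      = (V x * (g x)\<^sup>2) powr p * (V x * (f x * g x)) powr (1 / \<kappa>) * (\<bar>w x\<bar> powr q) powr (1 - p - 1 / \<kappa>)"
    using g0
  proof eventually_elim
    case (elim x)
    show ?case
    proof (cases "V x = 0 \<or> g x = 0")
      case False
      then have pos: "0 < V x" "0 < g x" using V_nonneg[of x] elim by auto
      have "(V x * (g x)\<^sup>2) powr p = V x powr p * g x powr (2 * p)"
        using pos by (simp add: powr_mult powr_powr flip: powr_numeral)
      moreover have "(V x * (f x * g x)) powr (1 / \<kappa>)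
          = V x powr ((1 / \<kappa>) * (1 + (\<kappa> - 1) / 2)) * g x powr (1 / \<kappa>)"
      proof -
        have "V x * f x = V x powr (1 + (\<kappa> - 1) / 2)"
          using pos unfolding powr_add by (simp add: f_def)
        then have "(V x * (f x * g x)) powr (1 / \<kappa>)
            = (V x powr (1 + (\<kappa> - 1) / 2) * g x) powr (1 / \<kappa>)"
          by (simp flip: mult.assoc)
        then show ?thesis using pos by (simp add: powr_mult powr_powr mult.commute)
      qed
      moreover have "(\<bar>w x\<bar> powr q) powr (1 - p - 1 / \<kappa>) = \<bar>w x\<bar>"
        using exponents(1) by (simp add: p(3) powr_powr)
      ultimately have "(V x * (g x)\<^sup>2) powr p * (V x * (f x * g x)) powr (1 / \<kappa>) * (\<bar>w x\<bar> powr q) powr (1 - p - 1 / \<kappa>)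
          = V x powr (p + (1 / \<kappa>) * (1 + (\<kappa> - 1) / 2)) * (g x powr (2 * p + 1 / \<kappa>) * \<bar>w x\<bar>)"
        by (simp add: powr_add)
      also have "\<dots> = V x * (g x * \<bar>w x\<bar>)" using pos unfolding p by simp
      finally show ?thesis by simp
    qed auto
  qed
  have fg: "integrable M (\<lambda>x. V x * (f x * g x))" and gg: "integrable M (\<lambda>x. V x * (g x)\<^sup>2)"
    using wip_integrable[OF V_meas _ f(1) g] V_nonneg g by (auto simp: wL2_def)
  have fg0: "AE x in M. 0 \<le> V x * (f x * g x)"
    using g0 by eventually_elim (simp add: f_def V_nonneg)
  have gg0: "AE x in M. 0 \<le> V x * (g x)\<^sup>2" by (simp add: V_nonneg)
  have wq0: "AE x in M. 0 \<le> \<bar>w x\<bar> powr q" by simp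
  have H2: "(\<integral>x. (V x * (g x)\<^sup>2) powr p * (V x * (f x * g x)) powr (1 / \<kappa>) * (\<bar>w x\<bar> powr q) powr (1 - p - 1 / \<kappa>) \<partial>M)
      \<le> P powr p * F powr (1 / \<kappa>) * W powr (1 / q)"
    using Hoelder3(2)[OF p(1) exponents(4) p(2) gg gg0 fg fg0 sobolev_real(1)[OF w] wq0]
    by (simp add: P_def F_def W_def wip_self wip_def[of M V f g] p(3))
  have "\<beta> = (\<integral>x. V x * (g x * w x) \<partial>M)"
    by (simp add: \<beta>_def fp.b_def w_def wip_def)
  also have "\<dots> \<le> (\<integral>x. V x * (g x * \<bar>w x\<bar>) \<partial>M)"
  proof (rule integral_mono_AE)
    show i: "integrable M (\<lambda>x. V x * (g x * w x))"
      using wip_integrable[OF V_meas _ g wip_le(1)[OF w]] V_nonneg by simp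
    have "integrable M (\<lambda>x. \<bar>V x * (g x * w x)\<bar>)" using i by (rule integrable_abs)
    moreover have "AE x in M. \<bar>V x * (g x * w x)\<bar> = V x * (g x * \<bar>w x\<bar>)"
      using g0 by eventually_elim (simp add: abs_mult V_nonneg)
    ultimately show "integrable M (\<lambda>x. V x * (g x * \<bar>w x\<bar>))"
      by (subst (asm) integrable_cong_AE) auto
    show "AE x in M. V x * (g x * w x) \<le> V x * (g x * \<bar>w x\<bar>)"
      using g0 by eventually_elim (auto intro!: mult_left_mono simp: V_nonneg)
  qed
  also have "\<dots> = (\<integral>x. (V x * (g x)\<^sup>2) powr p * (V x * (f x * g x)) powr (1 / \<kappa>) * (\<bar>w x\<bar> powr q) powr (1 - p - 1 / \<kappa>) \<partial>M)"
    using eq by (intro integral_cong_AE) auto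
  also note H2
  finally have "\<beta>\<^sup>2 \<le> (P powr p * F powr (1 / \<kappa>) * W powr (1 / q))\<^sup>2"
    using \<beta>0 by (intro power_mono)
  also have "\<dots> = P powr (2 * p) * (F\<^sup>2) powr (1 / \<kappa>) * W powr (2 / q)"
    using P0 F0 W0 by (simp add: power_mult_distrib powr_power power2_eq_square powr_mult mult_ac flip: powr_add)
  also have "\<dots> \<le> P powr (2 * p) * (F\<^sup>2) powr (1 / \<kappa>) * (\<beta> / S)"
    using SW S by (intro mult_left_mono) (auto simp: field_simps)
  finally have sq: "\<beta> * \<beta> \<le> (1 / S) * (P powr (1 - 1 / \<kappa>) * (F\<^sup>2) powr (1 / \<kappa>)) * \<beta>"
    unfolding p(5) by (simp add: power2_eq_square mult_ac)
  have "\<beta> \<le> (1 / S) * (P powr (1 - 1 / \<kappa>) * (F\<^sup>2) powr (1 / \<kappa>))"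
  proof (cases "\<beta> = 0")
    case False
    then show ?thesis using mult_right_le_imp_le[OF sq] \<beta>0 by simp
  qed (use S in simp)
  then show ?thesis by (simp add: \<beta>_def P_def F_def)
qed

end

section \<open>Positivity of the resolvent\<close>

locale sobolev_resolvent = sobolev_form_eps +
  fixes d :: real
  assumes d: "0 < d"
begin

sublocale fr: form_resolvent "wL2 M V" DR "wip M V" "te \<epsilon>" G d
  by standard (rule d)

text \<open>\<open>J \<phi>\<close> minimizes Q(v, v) - 2 \<integral> V \<phi> v. Passing from
  \<open>v\<close> to its absolute value does not increase this functional, by the second
  Beurling--Deny condition, so both are minimizers and \<open>Q\<close> vanishes on their
  difference. The part of \<open>Q\<close> coming from \<epsilon> makes them equal almost
  everywhere, also where \<open>V\<close> is zero.\<close>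

lemma J_nonneg:
  assumes \<phi>: "\<phi> \<in> wL2 M V" and pos: "AE x in M. 0 \<le> \<phi> x"
  shows "AE x in M. 0 \<le> fr.J \<phi> x"
proof -
  define v where "v = fr.J \<phi>"
  define w where "w = (\<lambda>x. \<bar>v x\<bar>)"
  have v: "v \<in> DR" using fr.J(1)[OF \<phi>] by (simp add: v_def)
  have w: "w \<in> DR" using v abs_closed by (simp add: DR_def w_def)
  have vX: "v \<in> wL2 M V" and wX: "w \<in> wL2 M V" using v w wip_le(1) by auto
  have eq: "fr.Q v z = wip M V \<phi> z" if "z \<in> DR" for z
    using fr.J(2)[OF \<phi> that] by (simp add: v_def fr.Q_def)
  have "tr w w \<le> tr v v" using t_abs v w tr_self by (simp add: DR_def w_def)
  then have "te \<epsilon> w w \<le> te \<epsilon> v v" by (simp add: te_def w_def wip_def)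
  then have Qw: "fr.Q w w \<le> fr.Q v v"
    using d by (simp add: fr.Q_def w_def wip_def)
  have "wip M V \<phi> v \<le> wip M V \<phi> w"
    unfolding wip_def
  proof (rule integral_mono_AE)
    show "integrable M (\<lambda>x. V x * (\<phi> x * v x))" "integrable M (\<lambda>x. V x * (\<phi> x * w x))"
      using wip_integrable[OF V_meas _ \<phi>] vX wX V_nonneg by auto
    show "AE x in M. V x * (\<phi> x * v x) \<le> V x * (\<phi> x * w x)"
      using pos by eventually_elim (auto intro!: mult_left_mono simp: V_nonneg w_def)
  qed
  moreover have "fr.Q (w - v) (w - v) = fr.Q w w - 2 * fr.Q v w + fr.Q v v"
    using v w fr.Q.sym[OF v w] by (simp add: fr.Q.bilinear)
  ultimately have "fr.Q (w - v) (w - v) \<le> 0"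
    using Qw eq[OF v] eq[OF w] by simp
  moreover have "d * te \<epsilon> (w - v) (w - v) \<le> fr.Q (w - v) (w - v)"
    using v w by (intro fr.te_le_Q) auto
  ultimately have "te \<epsilon> (w - v) (w - v) \<le> 0"
    using d by (smt (verit) mult_pos_pos)
  moreover have wv: "w - v \<in> DR" using v w by auto
  ultimately have "\<epsilon> * ip0 M (w - v) (w - v) \<le> 0"
    using tr.nonneg[OF wv] by (simp add: te_def)
  moreover have wv2: "w - v \<in> rL2 M" using wv DR_rL2 by blast
  ultimately have "ip0 M (w - v) (w - v) = 0"
    using \<epsilon> l2.nonneg[OF wv2] by (smt (verit) mult_pos_pos)
  then have "(\<integral>x. ((w - v) x)\<^sup>2 \<partial>M) = 0" by (simp add: wip_self)
  moreover have "integrable M (\<lambda>x. ((w - v) x)\<^sup>2)" using wv2 by (simp add: wL2_def)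
  ultimately have "AE x in M. ((w - v) x)\<^sup>2 = 0"
    by (subst (asm) integral_nonneg_eq_0_iff_AE) auto
  then show ?thesis
    by eventually_elim (simp add: w_def flip: v_def)
qed

lemma Jn_nonneg:
  assumes "\<phi> \<in> wL2 M V" "AE x in M. 0 \<le> \<phi> x"
  shows "AE x in M. 0 \<le> fr.Jn m \<phi> x"
  by (induction m) (use assms J_nonneg[of "fr.Jn _ \<phi>"] in auto)

end

text \<open>Supplies \<open>discrete_decay\<close> with the partial traces over the
  \<open>e y\<close>. The bound \<open>K\<close> is the number of these vectors, since
  \<open>J\<close> is a contraction, and does not depend on the step. The half in the conclusion
  undoes the doubling in \<open>trace_lower\<close>.\<close>

lemma (in sobolev_form_eps) orthonormal_count:
  fixes \<sigma> :: "nat \<Rightarrow> ('a \<Rightarrow> real) \<times> ('a \<Rightarrow> real)" and n :: nat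
  assumes I: "finite I" and e: "\<And>y. y \<in> I \<Longrightarrow> e y \<in> wL2 M V"
    and e0: "\<And>y. y \<in> I \<Longrightarrow> AE x in M. 0 \<le> e y x"
    and orth: "\<And>y y'. y \<in> I \<Longrightarrow> y' \<in> I \<Longrightarrow> wip M V (e y) (e y') = (if y = y' then 1 else 0)"
    and \<sigma>: "\<And>i. i < n \<Longrightarrow> \<sigma> i = ((\<Sum>y\<in>I. p i y *\<^sub>R e y), (\<Sum>y\<in>I. r i y *\<^sub>R e y))"
    and pos: "\<And>c i0. i0 < n \<Longrightarrow> c i0 = 1 \<Longrightarrow>
        0 < wip M V (fst (\<Sum>i<n. c i *\<^sub>R \<sigma> i)) (fst (\<Sum>i<n. c i *\<^sub>R \<sigma> i))
          + wip M V (snd (\<Sum>i<n. c i *\<^sub>R \<sigma> i)) (snd (\<Sum>i<n. c i *\<^sub>R \<sigma> i))"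
    and ge: "\<And>c. wip M V (fst (\<Sum>i<n. c i *\<^sub>R \<sigma> i)) (fst (\<Sum>i<n. c i *\<^sub>R \<sigma> i))
          + wip M V (snd (\<Sum>i<n. c i *\<^sub>R \<sigma> i)) (snd (\<Sum>i<n. c i *\<^sub>R \<sigma> i))
        \<le> fp.b (fst (\<Sum>i<n. c i *\<^sub>R \<sigma> i)) (fst (\<Sum>i<n. c i *\<^sub>R \<sigma> i))
          + fp.b (snd (\<Sum>i<n. c i *\<^sub>R \<sigma> i)) (snd (\<Sum>i<n. c i *\<^sub>R \<sigma> i))"
  shows "real n / 2 * exp (- (\<kappa> - 1)) \<le> A / S powr \<kappa>"
proof (cases "n = 0")
  case True
  then show ?thesis using A_nonneg by simp
next
  case False
  define X0 where "X0 = real n / 2 * exp (- (\<kappa> - 1))"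
  have X0: "0 < X0" using False by (simp add: X0_def)
  have ex: "\<exists>x D. X0 \<le> x k \<and>
      (\<forall>m<k. 0 \<le> D (Suc m) \<and> x (Suc m) \<le> G * D (Suc m) powr (1 - 1 / \<kappa>) \<and>
         2 * d * D (Suc m) \<le> x m - x (Suc m) \<and> x m - x (Suc m) \<le> 2 * d * real (card I))"
    if k: "0 < k" and d_eq: "d = (\<kappa> - 1) / (2 * real k)" for k :: nat and d :: real
  proof -
    interpret r: sobolev_resolvent M D t \<kappa> q S V \<epsilon> d
      by standard (use \<kappa> k d_eq in simp)
    define x where "x m = (\<Sum>y\<in>I. fp.b (r.fr.Jn m (e y)) (r.fr.Jn m (e y)))" for m
    define D where "D m = (\<Sum>y\<in>I. wip M V (r.fr.Jn m (e y)) (r.fr.Jn m (e y)))" for m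
    have JX: "r.fr.Jn m (e y) \<in> wL2 M V" if "y \<in> I" for m y using e[OF that] by (rule r.fr.Jn_X)
    have "X0 \<le> x k"
    proof -
      have "1 + d \<le> exp d" by (rule exp_ge_add_one_self)
      then have "(1 + d) ^ (2 * k) \<le> exp d ^ (2 * k)" using r.d by (intro power_mono) auto
      also have "\<dots> = exp (\<kappa> - 1)" using k by (simp add: d_eq flip: exp_of_nat_mult)
      finally have "(1 + d) ^ (2 * k) \<le> exp (\<kappa> - 1)" .
      then have "1 / exp (\<kappa> - 1) \<le> 1 / (1 + d) ^ (2 * k)"
        using r.d by (intro divide_left_mono) auto
      then have "exp (- (\<kappa> - 1)) \<le> r.fr.\<rho> ^ (2 * k)"
        by (simp only: r.fr.\<rho>_def power_one_over exp_minus inverse_eq_divide)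
      then have "exp (- (\<kappa> - 1)) * real n \<le> r.fr.\<rho> ^ (2 * k) * real n"
        by (intro mult_right_mono) auto
      also have "\<dots> \<le> 2 * x k"
        unfolding x_def by (rule r.fr.trace_lower[OF I e orth \<sigma> pos ge])
      finally show ?thesis by (simp add: X0_def mult.commute)
    qed
    moreover have "0 \<le> D m" for m unfolding D_def using JX by (intro sum_nonneg ip.nonneg)
    moreover have "x m \<le> G * D m powr (1 - 1 / \<kappa>)" for m
    proof -
      define F where "F y = (wip M V f (r.fr.Jn m (e y)))\<^sup>2" for y
      \<comment> \<open>The vectors \<open>Jn m (e y)\<close> need not be orthonormal, but the
        \<open>e y\<close> are; moving the powers of \<open>J\<close> to \<open>f\<close> makes
        Bessel's inequality applicable.\<close>
      have "(\<Sum>y\<in>I. F y) = (\<Sum>y\<in>I. (wip M V (r.fr.Jn m f) (e y))\<^sup>2)"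
        using f(1) e by (simp add: F_def r.fr.ip_Jn_sym)
      also have "\<dots> \<le> wip M V (r.fr.Jn m f) (r.fr.Jn m f)"
        using I e orth f(1) by (intro ip.Bessel) auto
      also have "\<dots> \<le> A" using r.fr.ip_Jn_le[OF f(1)] f(2) by simp
      finally have FA: "(\<Sum>y\<in>I. F y) \<le> A" .
      have "x m \<le> (\<Sum>y\<in>I. (1 / S) *
          (wip M V (r.fr.Jn m (e y)) (r.fr.Jn m (e y)) powr (1 - 1 / \<kappa>) * F y powr (1 / \<kappa>)))"
        unfolding x_def F_def using JX e e0 r.Jn_nonneg by (intro sum_mono b_le) auto
      also have "\<dots> = (1 / S) * (\<Sum>y\<in>I. wip M V (r.fr.Jn m (e y)) (r.fr.Jn m (e y)) powr (1 - 1 / \<kappa>)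
          * F y powr (1 - (1 - 1 / \<kappa>)))" by (simp add: sum_distrib_left)
      also have "\<dots> \<le> (1 / S) * (D m powr (1 - 1 / \<kappa>) * (\<Sum>y\<in>I. F y) powr (1 - (1 - 1 / \<kappa>)))"
        unfolding D_def using S JX exponents I
        by (intro mult_left_mono Hoelder_sum ip.nonneg) (auto simp: F_def)
      also have "\<dots> \<le> (1 / S) * (D m powr (1 - 1 / \<kappa>) * A powr (1 / \<kappa>))"
        using FA S \<kappa> by (intro mult_left_mono) (auto intro!: powr_mono2 sum_nonneg simp: F_def)
      finally show ?thesis by (simp add: G_def mult_ac)
    qed
    moreover have "2 * d * D (Suc m) \<le> x m - x (Suc m)" for m
    proof -
      have "2 * d * D (Suc m) = (\<Sum>y\<in>I. 2 * d * wip M V (r.fr.Jn (Suc m) (e y)) (r.fr.Jn (Suc m) (e y)))"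
        by (simp add: D_def sum_distrib_left)
      also have "\<dots> \<le> (\<Sum>y\<in>I. fp.b (r.fr.Jn m (e y)) (r.fr.Jn m (e y)) - fp.b (r.fr.Jn (Suc m) (e y)) (r.fr.Jn (Suc m) (e y)))"
        using r.fr.b_decrease(1)[OF JX] by (intro sum_mono) simp
      finally show ?thesis by (simp add: x_def sum_subtractf)
    qed
    moreover have "x m - x (Suc m) \<le> 2 * d * real (card I)" for m
    proof -
      have "x m - x (Suc m) = (\<Sum>y\<in>I. fp.b (r.fr.Jn m (e y)) (r.fr.Jn m (e y)) - fp.b (r.fr.Jn (Suc m) (e y)) (r.fr.Jn (Suc m) (e y)))"
        by (simp add: x_def sum_subtractf)
      also have "\<dots> \<le> (\<Sum>y\<in>I. 2 * d * 1)"
      proof (rule sum_mono)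
        fix y assume y: "y \<in> I"
        have "2 * d * wip M V (r.fr.Jn m (e y)) (r.fr.Jn m (e y)) \<le> 2 * d * 1"
          using r.fr.ip_Jn_le[OF e[OF y]] orth[OF y y] r.d by (intro mult_left_mono) auto
        then show "fp.b (r.fr.Jn m (e y)) (r.fr.Jn m (e y)) - fp.b (r.fr.Jn (Suc m) (e y)) (r.fr.Jn (Suc m) (e y)) \<le> 2 * d * 1"
          using r.fr.b_decrease(2)[OF JX[OF y, of m]] by simp
      qed
      finally show ?thesis by (simp add: mult_ac)
    qed
    ultimately show ?thesis by blast
  qed
  have "0 < G"
  proof -
    obtain x D where "X0 \<le> x (Suc 0)" "x (Suc 0) \<le> G * D (Suc 0) powr (1 - 1 / \<kappa>)"
      using ex[of "Suc 0" "(\<kappa> - 1) / (2 * real (Suc 0))"] by auto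
    then have "G \<noteq> 0" using X0 by auto
    then show ?thesis using G_nonneg by simp
  qed
  then have "X0 \<le> G powr \<kappa>"
    using \<kappa> X0 ex by (intro discrete_decay[of \<kappa> G "real (card I)"]) auto
  also have "\<dots> = A / S powr \<kappa>"
    using A_nonneg S \<kappa> by (simp add: G_def powr_divide powr_powr)
  finally show ?thesis by (simp add: X0_def)
qed

section \<open>Approximation by simple functions\<close>

lemma simple_approx:
  fixes \<phi> :: "'a \<Rightarrow> real"
  assumes w_meas [measurable]: "w \<in> borel_measurable M" and w0: "\<And>x. 0 \<le> w x"
    and \<phi>: "\<phi> \<in> wL2 M w" and "0 < \<eta>"
  shows "\<exists>s. simple_function M s \<and> s \<in> wL2 M w \<and> (\<integral>x. w x * (\<phi> x - s x)\<^sup>2 \<partial>M) < \<eta>"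
proof -
  have \<phi>_meas [measurable]: "\<phi> \<in> borel_measurable M" using \<phi> by (rule wL2_measurable)
  obtain F where F: "\<And>i. simple_function M (F i)"
    "\<And>x. x \<in> space M \<Longrightarrow> (\<lambda>i. F i x) \<longlonglongrightarrow> \<phi> x"
    "\<And>i x. x \<in> space M \<Longrightarrow> dist (F i x) 0 \<le> 2 * dist (\<phi> x) 0"
    using borel_measurable_implies_sequence_metric[OF \<phi>_meas, of 0] by blast
  have F_meas [measurable]: "F i \<in> borel_measurable M" for i using F(1) by (rule borel_measurable_simple_function)
  have int: "integrable M (\<lambda>x. w x * (\<phi> x)\<^sup>2)" using \<phi> by (simp add: wL2_def)
  have F_bound: "\<bar>F i x\<bar> \<le> 2 * \<bar>\<phi> x\<bar>" if "x \<in> space M" for i x using F(3)[OF that, of i] by simp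
  have FL: "F i \<in> wL2 M w" for i
  proof -
    have "integrable M (\<lambda>x. w x * (F i x)\<^sup>2)"
    proof (rule Bochner_Integration.integrable_bound)
      show "integrable M (\<lambda>x. 4 * (w x * (\<phi> x)\<^sup>2))" using int by simp
      show "AE x in M. norm (w x * (F i x)\<^sup>2) \<le> norm (4 * (w x * (\<phi> x)\<^sup>2))"
      proof (rule AE_I2)
        fix x assume x: "x \<in> space M"
        have "(F i x)\<^sup>2 \<le> (2 * \<bar>\<phi> x\<bar>)\<^sup>2"
          using F_bound[OF x, of i] by (intro power2_le_iff_abs_le[THEN iffD2]) auto
        then have "w x * (F i x)\<^sup>2 \<le> w x * (4 * (\<phi> x)\<^sup>2)"
          using w0 by (intro mult_left_mono) (auto simp: power_mult_distrib)
        then show "norm (w x * (F i x)\<^sup>2) \<le> norm (4 * (w x * (\<phi> x)\<^sup>2))"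
          using w0[of x] by simp
      qed
    qed simp
    then show ?thesis by (simp add: wL2_def)
  qed
  have "(\<lambda>i. \<integral>x. w x * (\<phi> x - F i x)\<^sup>2 \<partial>M) \<longlonglongrightarrow> (\<integral>x. 0 \<partial>M)"
  proof (rule integral_dominated_convergence)
    show "integrable M (\<lambda>x. 9 * (w x * (\<phi> x)\<^sup>2))" using int by simp
    show "AE x in M. (\<lambda>i. w x * (\<phi> x - F i x)\<^sup>2) \<longlonglongrightarrow> 0"
    proof (rule AE_I2)
      fix x assume "x \<in> space M"
      then have "(\<lambda>i. w x * (\<phi> x - F i x)\<^sup>2) \<longlonglongrightarrow> w x * (\<phi> x - \<phi> x)\<^sup>2"
        by (intro tendsto_intros F(2))
      then show "(\<lambda>i. w x * (\<phi> x - F i x)\<^sup>2) \<longlonglongrightarrow> 0" by simp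
    qed
    show "AE x in M. norm (w x * (\<phi> x - F i x)\<^sup>2) \<le> 9 * (w x * (\<phi> x)\<^sup>2)" for i
    proof (rule AE_I2)
      fix x assume x: "x \<in> space M"
      have "\<bar>\<phi> x - F i x\<bar> \<le> 3 * \<bar>\<phi> x\<bar>" using F_bound[OF x, of i] by linarith
      then have "(\<phi> x - F i x)\<^sup>2 \<le> (3 * \<bar>\<phi> x\<bar>)\<^sup>2"
        by (intro power2_le_iff_abs_le[THEN iffD2]) auto
      then have "w x * (\<phi> x - F i x)\<^sup>2 \<le> w x * (9 * (\<phi> x)\<^sup>2)"
        using w0 by (intro mult_left_mono) (auto simp: power_mult_distrib)
      then show "norm (w x * (\<phi> x - F i x)\<^sup>2) \<le> 9 * (w x * (\<phi> x)\<^sup>2)"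
        using w0[of x] by simp
    qed
  qed simp_all
  then have "\<forall>\<^sub>F i in sequentially. (\<integral>x. w x * (\<phi> x - F i x)\<^sup>2 \<partial>M) < \<eta>"
    using \<open>0 < \<eta>\<close> by (intro order_tendstoD(2)) auto
  then obtain i where "(\<integral>x. w x * (\<phi> x - F i x)\<^sup>2 \<partial>M) < \<eta>"
    by (auto simp: eventually_sequentially)
  then show ?thesis using F(1) FL by blast
qed

text \<open>The cells are the joint level sets of simple approximants of all
  \<open>\<phi> j\<close>, and an index in \<open>I\<close> is the vector of values taken on its
  cell. Disjointness of the cells gives orthogonality of their indicators.\<close>

lemma simultaneous_simple_approx:
  fixes \<phi> :: "'j \<Rightarrow> 'a \<Rightarrow> real"
  assumes w_meas [measurable]: "w \<in> borel_measurable M" and w0: "\<And>x. 0 \<le> w x"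
    and J: "finite J" and \<phi>: "\<And>j. j \<in> J \<Longrightarrow> \<phi> j \<in> wL2 M w" and "0 < \<eta>"
  shows "\<exists>(I :: ('j \<Rightarrow> real) set) e p. finite I \<and>
    (\<forall>y\<in>I. e y \<in> wL2 M w \<and> (\<forall>x. 0 \<le> e y x)) \<and>
    (\<forall>y\<in>I. \<forall>y'\<in>I. wip M w (e y) (e y') = (if y = y' then 1 else 0)) \<and>
    (\<forall>j\<in>J. wip M w (\<phi> j - (\<Sum>y\<in>I. p j y *\<^sub>R e y)) (\<phi> j - (\<Sum>y\<in>I. p j y *\<^sub>R e y)) < \<eta>)"
proof -
  have "\<forall>j\<in>J. \<exists>s. simple_function M s \<and> s \<in> wL2 M w \<and> (\<integral>x. w x * (\<phi> j x - s x)\<^sup>2 \<partial>M) < \<eta>"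
    using simple_approx[OF w_meas w0 \<phi> \<open>0 < \<eta>\<close>] by blast
  then obtain s where s: "\<And>j. j \<in> J \<Longrightarrow> simple_function M (s j)" "\<And>j. j \<in> J \<Longrightarrow> s j \<in> wL2 M w"
    "\<And>j. j \<in> J \<Longrightarrow> (\<integral>x. w x * (\<phi> j x - s j x)\<^sup>2 \<partial>M) < \<eta>" by metis
  define v where "v x = restrict (\<lambda>j. s j x) J" for x
  define Y where "Y = v ` space M"
  define E where "E y = {x \<in> space M. v x = y}" for y
  have Y: "finite Y"
  proof (rule finite_subset)
    show "Y \<subseteq> PiE J (\<lambda>j. s j ` space M)" by (auto simp: Y_def v_def)
    show "finite (PiE J (\<lambda>j. s j ` space M))"
      using J s(1) by (intro finite_PiE) (auto simp: simple_function_def)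
  qed
  have E_sets [measurable]: "E y \<in> sets M" for y
  proof (cases "y \<in> extensional J")
    case True
    then have "E y = {x \<in> space M. \<forall>j\<in>J. s j x = y j}"
      by (auto simp: E_def v_def fun_eq_iff extensional_def)
    moreover have "{x \<in> space M. s j x = y j} \<in> sets M" if "j \<in> J" for j
      using borel_measurable_simple_function[OF s(1)[OF that]] by measurable
    ultimately show ?thesis using J by (auto intro: sets.sets_Collect_finite_All)
  next
    case False
    then have "E y = {}" by (auto simp: E_def v_def)
    then show ?thesis by simp
  qed
  define \<nu> where "\<nu> y = (\<integral>x. w x * indicator (E y) x \<partial>M)" for y
  have ind_int: "integrable M (\<lambda>x. w x * indicator (E y) x)" if j: "j \<in> J" "y j \<noteq> 0" for y j
  proof (rule Bochner_Integration.integrable_bound)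
    have [measurable]: "s j \<in> borel_measurable M" using s(2)[OF j(1)] by (rule wL2_measurable)
    show "integrable M (\<lambda>x. (w x * (s j x)\<^sup>2) / (y j)\<^sup>2)" using s(2)[OF j(1)] by (simp add: wL2_def)
    show "AE x in M. norm (w x * indicator (E y) x) \<le> norm ((w x * (s j x)\<^sup>2) / (y j)\<^sup>2)"
    proof (rule AE_I2)
      fix x
      have "s j x = y j" if "x \<in> E y" using that j by (auto simp: E_def v_def)
      then show "norm (w x * indicator (E y) x) \<le> norm ((w x * (s j x)\<^sup>2) / (y j)\<^sup>2)"
        using j w0[of x] by (auto simp: indicator_def)
    qed
  qed measurable
  \<comment> \<open>The cell on which all values vanish may have infinite weighted measure and
    contributes nothing. On any other cell a nonzero value of some \<open>s j\<close> forces finite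
    measure; those of measure zero cannot be normalized and are negligible.\<close>
  define I where "I = {y \<in> Y. 0 < \<nu> y \<and> (\<exists>j\<in>J. y j \<noteq> 0)}"
  define e where "e y x = indicator (E y) x / sqrt (\<nu> y)" for y and x :: 'a
  define p where "p j y = y j * sqrt (\<nu> y)" for j :: 'j and y
  have I: "finite I" using Y by (simp add: I_def)
  have \<nu>: "0 < \<nu> y" if "y \<in> I" for y using that by (simp add: I_def)
  have e_meas: "e y \<in> borel_measurable M" for y unfolding e_def[abs_def] by measurable
  have e_prod: "w x * (e y x * e y' x) = (if y = y' then w x * indicator (E y) x / \<nu> y else 0)"
    if "y \<in> I" for y y' x
    using \<nu>[OF that] by (auto simp: e_def E_def indicator_def)
  have eX: "e y \<in> wL2 M w" if "y \<in> I" for y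
  proof -
    obtain j where "j \<in> J" "y j \<noteq> 0" using \<open>y \<in> I\<close> by (auto simp: I_def)
    then have "integrable M (\<lambda>x. w x * indicator (E y) x / \<nu> y)" using ind_int[of j y] by simp
    then show ?thesis
      using e_meas e_prod[OF that, of _ y] by (simp add: wL2_def power2_eq_square)
  qed
  have orth: "wip M w (e y) (e y') = (if y = y' then 1 else 0)" if "y \<in> I" for y y'
  proof -
    have "wip M w (e y) (e y') = (\<integral>x. (if y = y' then w x * indicator (E y) x / \<nu> y else 0) \<partial>M)"
      unfolding wip_def by (intro Bochner_Integration.integral_cong refl e_prod that)
    then show ?thesis using \<nu>[OF that] by (cases "y = y'") (simp_all flip: \<nu>_def)
  qed
  have null: "AE x in M. \<forall>y\<in>Y. (\<exists>j\<in>J. y j \<noteq> 0) \<and> \<not> 0 < \<nu> y \<longrightarrow> w x * indicator (E y) x = 0"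
  proof (rule AE_finite_allI[OF Y])
    fix y assume "y \<in> Y"
    show "AE x in M. (\<exists>j\<in>J. y j \<noteq> 0) \<and> \<not> 0 < \<nu> y \<longrightarrow> w x * indicator (E y) x = 0"
    proof (cases "(\<exists>j\<in>J. y j \<noteq> 0) \<and> \<not> 0 < \<nu> y")
      case True
      then have i: "integrable M (\<lambda>x. w x * indicator (E y) x)" using ind_int by blast
      have "0 \<le> \<nu> y" unfolding \<nu>_def by (rule integral_nonneg_AE) (use w0 in auto)
      then have "\<nu> y = 0" using True by simp
      then have "AE x in M. w x * indicator (E y) x = 0"
        unfolding \<nu>_def using i w0 by (subst (asm) integral_nonneg_eq_0_iff_AE) auto
      then show ?thesis by eventually_elim simp
    qed auto
  qed
  have sum_eq: "(\<Sum>y\<in>I. p j y *\<^sub>R e y) x = (if v x \<in> I then s j x else 0)" if "x \<in> space M" "j \<in> J" for x j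
  proof -
    have "(\<Sum>y\<in>I. p j y *\<^sub>R e y) x = (\<Sum>y\<in>I. y j * indicator (E y) x)"
      unfolding sum_fun_apply
    proof (rule sum.cong)
      fix y assume "y \<in> I"
      then show "(p j y *\<^sub>R e y) x = y j * indicator (E y) x" using \<nu>[of y] by (simp add: p_def e_def)
    qed simp
    also have "\<dots> = (\<Sum>y\<in>I. if y = v x then y j else 0)"
      using that by (intro sum.cong) (auto simp: E_def)
    also have "\<dots> = (if v x \<in> I then s j x else 0)"
      using I that by (simp add: v_def)
    finally show ?thesis .
  qed
  have approx: "wip M w (\<phi> j - (\<Sum>y\<in>I. p j y *\<^sub>R e y)) (\<phi> j - (\<Sum>y\<in>I. p j y *\<^sub>R e y)) < \<eta>" if j: "j \<in> J" for j
  proof -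
    have [measurable]: "s j \<in> borel_measurable M" "\<phi> j \<in> borel_measurable M"
      by (rule wL2_measurable[OF s(2)[OF j]], rule wL2_measurable[OF \<phi>[OF j]])
    have [measurable]: "(\<lambda>x. \<Sum>y\<in>I. p j y * e y x) \<in> borel_measurable M"
      using e_meas by (intro borel_measurable_sum borel_measurable_times) auto
    have "AE x in M. w x * ((\<phi> j - (\<Sum>y\<in>I. p j y *\<^sub>R e y)) x)\<^sup>2 = w x * (\<phi> j x - s j x)\<^sup>2"
      using null AE_space
    proof eventually_elim
      case (elim x)
      show ?case
      proof (cases "v x \<in> I")
        case False
        have vY: "v x \<in> Y" using elim(2) by (simp add: Y_def)
        have "w x = 0 \<or> s j x = 0"
        proof (cases "\<exists>j\<in>J. v x j \<noteq> 0")
          case True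
          then have "w x * indicator (E (v x)) x = 0" using elim(1) vY False by (auto simp: I_def)
          then show ?thesis using elim(2) by (simp add: E_def)
        next
          case False
          then show ?thesis using j by (simp add: v_def)
        qed
        then show ?thesis using sum_eq[OF elim(2) j] False by auto
      qed (use sum_eq[OF elim(2) j] in simp)
    qed
    then have "wip M w (\<phi> j - (\<Sum>y\<in>I. p j y *\<^sub>R e y)) (\<phi> j - (\<Sum>y\<in>I. p j y *\<^sub>R e y))
        = (\<integral>x. w x * (\<phi> j x - s j x)\<^sup>2 \<partial>M)"
      unfolding wip_self by (intro integral_cong_AE) simp_all
    then show ?thesis using s(3)[OF j] by simp
  qed
  show ?thesis
    by (intro exI[of _ I] exI[of _ e] exI[of _ p]) (use I eX orth approx in \<open>auto simp: e_def \<nu>_def w0 intro!: integral_nonneg_AE\<close>)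
qed

section \<open>Counting on negative subspaces\<close>

context sobolev_form
begin

lemma null_t:
  assumes "u \<in> D" "AE x in M. u x = 0"
  shows "t u = 0"
proof -
  have inv: "\<forall>u\<in>D. \<forall>v\<in>borel_measurable M. (AE x in M. u x = v x) \<longrightarrow> v \<in> D \<and> t v = t u"
    using closed by (auto simp: closed_nonneg_form_def quadratic_form_def)
  have "t (\<lambda>x. 0) = t u" using inv[rule_format, OF assms(1), of "\<lambda>x. 0"] assms(2) by simp
  moreover have "t (\<lambda>x. 0) = 0"
    using tr_self[OF tr.mem(1)] tr.zero_left[OF tr.mem(1)] by (simp add: zero_fun_def)
  ultimately show ?thesis by simp
qed

definition pair :: "('a \<Rightarrow> complex) \<Rightarrow> ('a \<Rightarrow> real) \<times> ('a \<Rightarrow> real)" where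
  "pair u = ((\<lambda>x. Re (u x)), (\<lambda>x. Im (u x)))"

definition ip2 where "ip2 u v = wip M V (fst u) (fst v) + wip M V (snd u) (snd v)"
definition tr2 where "tr2 u v = tr (fst u) (fst v) + tr (snd u) (snd v)"
definition l22 where "l22 u v = ip0 M (fst u) (fst v) + ip0 M (snd u) (snd v)"

lemma pair_DR: "u \<in> D \<Longrightarrow> pair u \<in> DR \<times> DR"
  using Re_closed Im_closed by (simp add: pair_def DR_def)

lemma tr2_pair: "u \<in> D \<Longrightarrow> tr2 (pair u) (pair u) = t u"
  using pair_DR[of u] t_split[of u] by (simp add: tr2_def pair_def tr_self)

lemma ip2_pair:
  assumes "u \<in> D"
  shows "(\<integral>\<^sup>+x. ennreal (V x * (cmod (u x))\<^sup>2) \<partial>M) = ennreal (ip2 (pair u) (pair u))"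
proof -
  have "pair u \<in> DR \<times> DR" using assms by (rule pair_DR)
  then have "integrable M (\<lambda>x. V x * (Re (u x))\<^sup>2)" "integrable M (\<lambda>x. V x * (Im (u x))\<^sup>2)"
    using wip_le(1) by (force simp: pair_def wL2_def)+
  then show ?thesis
    using nn_integral_eq_integral[of M "\<lambda>x. V x * (Re (u x))\<^sup>2 + V x * (Im (u x))\<^sup>2"]
    by (simp add: cmod_power2 distrib_left ip2_def pair_def wip_self V_nonneg)
qed

text \<open>\<open>P\<close> is positive on the non-null part of the negative space. After
  Gram--Schmidt for \<open>P\<close>, a combination of the \<open>z i\<close> has margin
  \<open>N2 c\<close>, the sum of the squared coefficients. Half of it absorbs the shift by
  \<epsilon> and a quarter the passage to step functions, uniformly in \<open>c\<close>.\<close>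

lemma count_bound:
  assumes KD: "K \<subseteq> D" and K: "csubspace_fun K"
    and neg: "\<And>u. u \<in> K \<Longrightarrow> \<not> (AE x in M. u x = 0) \<Longrightarrow>
        ennreal (t u) < (\<integral>\<^sup>+x. ennreal (V x * (cmod (u x))\<^sup>2) \<partial>M)"
    and bK: "\<And>i. i < N \<Longrightarrow> \<beta> i \<in> K" and indep: "ae_independent M N \<beta>"
  shows "real N * exp (- (\<kappa> - 1)) \<le> A / S powr \<kappa>"
proof -
  interpret ip2: semi_inner "wL2 M V \<times> wL2 M V" ip2
    unfolding ip2_def by (rule semi_inner_prod) (rule ip.semi_inner_axioms)
  interpret tr2: semi_inner "DR \<times> DR" tr2
    unfolding tr2_def by (rule semi_inner_prod) (rule tr.semi_inner_axioms)
  interpret l22: semi_inner "rL2 M \<times> rL2 M" l22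
    unfolding l22_def by (rule semi_inner_prod) (rule l2.semi_inner_axioms)
  have DX: "u \<in> wL2 M V \<times> wL2 M V" and DL: "u \<in> rL2 M \<times> rL2 M" if "u \<in> DR \<times> DR" for u
    using that wip_le(1) DR_rL2 by auto
  have K_add: "(\<lambda>x. u x + v x) \<in> K" if "u \<in> K" "v \<in> K" for u v
    using K[unfolded csubspace_fun_def] that by simp
  have K_scale: "(\<lambda>x. c * u x) \<in> K" if "u \<in> K" for u c
    using K[unfolded csubspace_fun_def] that by simp
  define KR where "KR = pair ` K"
  have KR_DR: "KR \<subseteq> DR \<times> DR" using KD pair_DR unfolding KR_def by blast
  define P where "P u v = ip2 u v - tr2 u v" for u v
  have P_pos: "0 < P (pair u) (pair u)" if "u \<in> K" "\<not> (AE x in M. u x = 0)" for u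
  proof -
    have u: "u \<in> D" using that KD by auto
    have "t u < ip2 (pair u) (pair u)"
      using neg[OF that] t_nonneg[OF u] by (simp add: ip2_pair[OF u] ennreal_less_iff)
    then show ?thesis by (simp add: P_def tr2_pair[OF u])
  qed
  interpret P: semi_inner KR P
  proof
    show "subspace KR"
    proof (rule subspaceI)
      show "0 \<in> KR"
        using K unfolding KR_def csubspace_fun_def
        by (intro image_eqI[of _ _ "\<lambda>x. 0"]) (auto simp: pair_def zero_prod_def zero_fun_def)
      show "u + v \<in> KR" if "u \<in> KR" "v \<in> KR" for u v
      proof -
        obtain u' v' where "u' \<in> K" "v' \<in> K" "u = pair u'" "v = pair v'"
          using \<open>u \<in> KR\<close> \<open>v \<in> KR\<close> by (auto simp: KR_def)
        then show ?thesis unfolding KR_def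
          by (intro image_eqI[OF _ K_add[of u' v']]) (auto simp: pair_def plus_fun_def)
      qed
      show "c *\<^sub>R u \<in> KR" if "u \<in> KR" for c u
      proof -
        obtain u' where "u' \<in> K" "u = pair u'" using \<open>u \<in> KR\<close> by (auto simp: KR_def)
        then show ?thesis unfolding KR_def
          by (intro image_eqI[OF _ K_scale[of u' "complex_of_real c"]]) (auto simp: pair_def scaleR_fun_def)
      qed
    qed
    fix u v w and c :: real
    assume u: "u \<in> KR"
    then have u': "u \<in> DR \<times> DR" using KR_DR by auto
    show "0 \<le> P u u"
    proof -
      obtain u0 where u0: "u0 \<in> K" "u = pair u0" using u by (auto simp: KR_def)
      show ?thesis
      proof (cases "AE x in M. u0 x = 0")
        case True
        have "u0 \<in> D" using u0 KD by auto
        then have "tr2 u u = 0" using null_t True u0 by (simp add: tr2_pair)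
        then show ?thesis using ip2.nonneg[OF DX[OF u']] by (simp add: P_def)
      qed (use P_pos u0 in \<open>auto intro: less_imp_le\<close>)
    qed
    { assume v: "v \<in> KR"
      then have v': "v \<in> DR \<times> DR" using KR_DR by auto
      show "P u v = P v u" unfolding P_def
        using ip2.sym[OF DX[OF u'] DX[OF v']] tr2.sym[OF u' v'] by simp
      assume w: "w \<in> KR"
      then have w': "w \<in> DR \<times> DR" using KR_DR by auto
      show "P (u + v) w = P u w + P v w" unfolding P_def
        using ip2.add_left[OF DX[OF u'] DX[OF v'] DX[OF w']] tr2.add_left[OF u' v' w'] by simp }
    assume w: "w \<in> KR"
    then have w': "w \<in> DR \<times> DR" using KR_DR by auto
    show "P (c *\<^sub>R u) w = c * P u w" unfolding P_def
      using ip2.scale_left[OF DX[OF u'] DX[OF w'], of c] tr2.scale_left[OF u' w', of c]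
      by (simp add: algebra_simps)
  qed
  define n where "n = 2 * N"
  \<comment> \<open>The \<beta> j together with \<i> \<beta> j: complex independence of the former
    is real independence of all \<open>2 * N\<close>.\<close>
  define \<gamma> where "\<gamma> j = (if j < N then \<beta> j else (\<lambda>x. \<i> * \<beta> (j - N) x))" for j
  have \<gamma>K: "\<gamma> j \<in> K" if "j < n" for j
    using bK[of j] bK[of "j - N"] K_scale that by (auto simp: \<gamma>_def n_def)
  have comb: "(\<lambda>x. \<Sum>j\<in>J. complex_of_real (c j) * \<gamma> j x) \<in> K" if "J \<subseteq> {..<n}" for J c
    using finite_subset[OF that finite_lessThan] that
  proof (induction J rule: finite_induct)
    case empty
    then show ?case using K by (simp add: csubspace_fun_def)
  next
    case (insert j J)
    have "(\<lambda>x. complex_of_real (c j) * \<gamma> j x + (\<Sum>j\<in>J. complex_of_real (c j) * \<gamma> j x)) \<in> K"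
      using insert \<gamma>K[of j] by (intro K_add K_scale) auto
    then show ?case using insert by simp
  qed
  have pair_comb: "pair (\<lambda>x. \<Sum>j\<in>J. complex_of_real (c j) * \<gamma> j x) = (\<Sum>j\<in>J. c j *\<^sub>R pair (\<gamma> j))" for J c
    by (simp add: pair_def prod_eq_iff fst_sum snd_sum fun_eq_iff)
  have nonnull: "\<not> (AE x in M. (\<Sum>j<n. complex_of_real (c j) * \<gamma> j x) = 0)" if "i < n" "c i \<noteq> 0" for c i
  proof
    assume null: "AE x in M. (\<Sum>j<n. complex_of_real (c j) * \<gamma> j x) = 0"
    define c' where "c' j = complex_of_real (c j) + \<i> * complex_of_real (c (j + N))" for j
    have "(\<Sum>j<n. complex_of_real (c j) * \<gamma> j x) = (\<Sum>j<N. c' j * \<beta> j x)" for x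
    proof -
      have "(\<Sum>j<n. complex_of_real (c j) * \<gamma> j x)
          = (\<Sum>j<N. complex_of_real (c j) * \<gamma> j x) + (\<Sum>j=N..<N+N. complex_of_real (c j) * \<gamma> j x)"
        using sum.atLeastLessThan_concat[of 0 N "N + N" "\<lambda>j. complex_of_real (c j) * \<gamma> j x"]
        by (simp add: lessThan_atLeast0 n_def mult_2)
      also have "(\<Sum>j=N..<N+N. complex_of_real (c j) * \<gamma> j x) = (\<Sum>j<N. complex_of_real (c (j + N)) * \<gamma> (j + N) x)"
        using sum.shift_bounds_nat_ivl[of "\<lambda>j. complex_of_real (c j) * \<gamma> j x" 0 N N]
        by (simp add: lessThan_atLeast0)
      finally show ?thesis
        by (simp add: \<gamma>_def c'_def algebra_simps flip: sum.distrib)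
    qed
    then have "AE x in M. (\<Sum>j<N. c' j * \<beta> j x) = 0" using null by simp
    then have "\<forall>j<N. c' j = 0" using indep unfolding ae_independent_def by blast
    then have c0: "c j = 0 \<and> c (j + N) = 0" if "j < N" for j
      using that by (auto simp: c'_def complex_eq_iff)
    show False
    proof (cases "i < N")
      case True
      then show False using c0[of i] that by simp
    next
      case False
      then have "i - N < N" "i - N + N = i" using that(1) by (auto simp: n_def)
      then show False using c0[of "i - N"] that(2) by simp
    qed
  qed
  have "P (pair (\<gamma> i) - (\<Sum>j<i. c j *\<^sub>R pair (\<gamma> j))) (pair (\<gamma> i) - (\<Sum>j<i. c j *\<^sub>R pair (\<gamma> j))) > 0"
    if i: "i < n" for i c
  proof -
    define c' where "c' j = (if j < i then - c j else if j = i then 1 else 0)" for j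
    have "(\<Sum>j<n. c' j *\<^sub>R pair (\<gamma> j)) = (\<Sum>j<Suc i. c' j *\<^sub>R pair (\<gamma> j))"
      using i by (intro sum.mono_neutral_right) (auto simp: c'_def)
    also have "\<dots> = pair (\<gamma> i) - (\<Sum>j<i. c j *\<^sub>R pair (\<gamma> j))"
      by (simp add: c'_def sum_negf)
    finally have "pair (\<gamma> i) - (\<Sum>j<i. c j *\<^sub>R pair (\<gamma> j))
        = pair (\<lambda>x. \<Sum>j<n. complex_of_real (c' j) * \<gamma> j x)" by (simp only: pair_comb)
    moreover have "\<not> (AE x in M. (\<Sum>j<n. complex_of_real (c' j) * \<gamma> j x) = 0)"
      using i by (intro nonnull[of i]) (auto simp: c'_def)
    ultimately show ?thesis using P_pos[OF comb[OF order_refl]] by simp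
  qed
  moreover have \<gamma>KR: "pair (\<gamma> i) \<in> KR" if "i < n" for i using \<gamma>K[OF that] by (simp add: KR_def)
  ultimately obtain a where a: "\<forall>i<n. \<forall>j<n. P (\<Sum>k<n. a i k *\<^sub>R pair (\<gamma> k)) (\<Sum>k<n. a j k *\<^sub>R pair (\<gamma> k))
      = (if i = j then 1 else 0)"
    using P.Gram_Schmidt[of n "\<lambda>i. pair (\<gamma> i)"] by blast
  define z where "z i = (\<Sum>k<n. a i k *\<^sub>R pair (\<gamma> k))" for i
  have zKR: "z i \<in> KR" for i unfolding z_def by (intro P.sum_mem P.mem(4)) (use \<gamma>KR in simp)
  have zDR: "z i \<in> DR \<times> DR" for i using zKR KR_DR by auto
  have zz: "P (z i) (z j) = (if i = j then 1 else 0)" if "i < n" "j < n" for i j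
    using a that by (simp add: z_def)
  define Z where "Z = (\<Sum>i<n. l22 (z i) (z i))"
  have Z0: "0 \<le> Z" unfolding Z_def by (intro sum_nonneg l22.nonneg DL zDR)
  \<comment> \<open>Chosen to get \<open>\<epsilon> * Z \<le> 1 / 2\<close>. There is no
    circularity: \<open>P\<close> contains the unshifted form, so the \<open>z i\<close> do not
    depend on \<epsilon>.\<close>
  define \<epsilon> where "\<epsilon> = 1 / (2 * (Z + 1))"
  have \<epsilon>: "0 < \<epsilon>" "\<epsilon> * Z \<le> 1 / 2" using Z0 by (auto simp: \<epsilon>_def field_simps)
  interpret eps: sobolev_form_eps M D t \<kappa> q S V \<epsilon> by standard (rule \<epsilon>)
  \<comment> \<open>Keeps the total squared error \<open>n * (2 * \<eta>)\<close> below 1/4, with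
    two components for each of the \<open>n\<close> pairs.\<close>
  define \<eta> where "\<eta> = 1 / (8 * (real n + 1))"
  have \<eta>: "0 < \<eta>" by (simp add: \<eta>_def)
  define \<phi> where "\<phi> j = (if snd j then fst (z (fst j)) else snd (z (fst j)))" for j :: "nat \<times> bool"
  have \<phi>X: "\<phi> j \<in> wL2 M V" for j
    using DX[OF zDR, of "fst j"] by (auto simp: \<phi>_def mem_Times_iff)
  obtain I :: "(nat \<times> bool \<Rightarrow> real) set" and e p where I: "finite I"
    and e: "\<forall>y\<in>I. e y \<in> wL2 M V \<and> (\<forall>x. 0 \<le> e y x)"
    and orth: "\<forall>y\<in>I. \<forall>y'\<in>I. wip M V (e y) (e y') = (if y = y' then 1 else 0)"
    and approx: "\<forall>j\<in>{..<n} \<times> UNIV. wip M V (\<phi> j - (\<Sum>y\<in>I. p j y *\<^sub>R e y)) (\<phi> j - (\<Sum>y\<in>I. p j y *\<^sub>R e y)) < \<eta>"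
    using simultaneous_simple_approx[of V M "{..<n} \<times> (UNIV :: bool set)" \<phi> \<eta>] V_nonneg \<phi>X \<eta> V_meas
    by (auto simp del: split_paired_All split_paired_Ball_Sigma)
  define \<sigma> where "\<sigma> i = ((\<Sum>y\<in>I. p (i, True) y *\<^sub>R e y), (\<Sum>y\<in>I. p (i, False) y *\<^sub>R e y))" for i
  have \<sigma>X: "\<sigma> i \<in> wL2 M V \<times> wL2 M V" for i
    using e by (auto simp: \<sigma>_def intro!: ip.sum_mem ip.mem(4))
  have z\<sigma>: "ip2 (z i - \<sigma> i) (z i - \<sigma> i) \<le> 2 * \<eta>" if "i < n" for i
  proof -
    have "(i, True) \<in> {..<n} \<times> UNIV" "(i, False) \<in> {..<n} \<times> UNIV" using that by auto
    from approx[rule_format, OF this(1)] approx[rule_format, OF this(2)]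
    show ?thesis by (simp add: ip2_def \<sigma>_def \<phi>_def)
  qed
  have sum4: "(\<Sum>i<n. ip2 (z i - \<sigma> i) (z i - \<sigma> i)) \<le> 1 / 4"
  proof -
    have "(\<Sum>i<n. ip2 (z i - \<sigma> i) (z i - \<sigma> i)) \<le> (\<Sum>i<n. 2 * \<eta>)" using z\<sigma> by (intro sum_mono) simp
    also have "\<dots> \<le> 1 / 4" by (simp add: \<eta>_def field_simps)
    finally show ?thesis .
  qed
  define uz where "uz c = (\<Sum>i<n. c i *\<^sub>R z i)" for c :: "nat \<Rightarrow> real"
  define us where "us c = (\<Sum>i<n. c i *\<^sub>R \<sigma> i)" for c :: "nat \<Rightarrow> real"
  define N2 where "N2 c = (\<Sum>i<n. (c i)\<^sup>2)" for c :: "nat \<Rightarrow> real"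
  have N2: "0 \<le> N2 c" for c by (simp add: N2_def sum_nonneg)
  have uzKR: "uz c \<in> KR" for c unfolding uz_def by (intro P.sum_mem P.mem(4) zKR)
  have uzDR: "uz c \<in> DR \<times> DR" for c using uzKR KR_DR by auto
  have uzX: "uz c \<in> wL2 M V \<times> wL2 M V" for c by (rule DX[OF uzDR])
  have usX: "us c \<in> wL2 M V \<times> wL2 M V" for c unfolding us_def by (intro ip2.sum_mem ip2.mem(4) \<sigma>X)
  have Puz: "P (uz c) (uz c) = N2 c" for c
  proof -
    have "P (uz c) (uz c) = (\<Sum>i<n. \<Sum>j<n. c i * (c j * P (z i) (z j)))"
      unfolding uz_def by (rule P.double_sum) (rule zKR)+
    also have "\<dots> = (\<Sum>i<n. \<Sum>j<n. if i = j then c i * c j else 0)"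
      by (intro sum.cong refl) (auto simp: zz)
    finally show ?thesis by (simp add: N2_def power2_eq_square)
  qed
  have diff: "ip2 (uz c - us c) (uz c - us c) \<le> N2 c / 4" for c
  proof -
    have "uz c - us c = (\<Sum>i<n. c i *\<^sub>R (z i - \<sigma> i))"
      by (simp add: uz_def us_def scaleR_diff_right sum_subtractf)
    then have "ip2 (uz c - us c) (uz c - us c) \<le> N2 c * (\<Sum>i<n. ip2 (z i - \<sigma> i) (z i - \<sigma> i))"
      unfolding N2_def using ip2.norm_sum_le[of "{..<n}" "\<lambda>i. z i - \<sigma> i" c] ip2.mem(3)[OF DX[OF zDR] \<sigma>X]
      by simp
    also have "\<dots> \<le> N2 c * (1 / 4)" by (intro mult_left_mono sum4 N2)
    finally show ?thesis by simp
  qed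
  have ip_uz: "N2 c \<le> ip2 (uz c) (uz c)" for c
    using Puz[of c] tr2.nonneg[OF uzDR, of c] by (simp add: P_def)
  have l_uz: "\<epsilon> * l22 (uz c) (uz c) \<le> N2 c / 2" for c
  proof -
    have "l22 (uz c) (uz c) \<le> N2 c * Z"
      unfolding N2_def Z_def uz_def by (rule l22.norm_sum_le) (rule DL[OF zDR])
    then have "\<epsilon> * l22 (uz c) (uz c) \<le> \<epsilon> * (N2 c * Z)" using \<epsilon> by (intro mult_left_mono) auto
    also have "\<dots> = N2 c * (\<epsilon> * Z)" by simp
    also have "\<dots> \<le> N2 c * (1 / 2)" by (intro mult_left_mono \<epsilon> N2)
    finally show ?thesis by simp
  qed
  \<comment> \<open>If \<open>us c\<close> were null, \<open>uz c\<close> would be as long as the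
    difference, whose square is at most \<open>N2 c / 4\<close>, whereas \<open>ip_uz\<close> gives
    at least \<open>N2 c\<close>.\<close>
  have pos: "0 < ip2 (us c) (us c)" if "i < n" "c i = 1" for c i
  proof (rule ccontr)
    assume "\<not> 0 < ip2 (us c) (us c)"
    then have null: "ip2 (us c) (us c) = 0" using ip2.nonneg[OF usX, of c] by simp
    have "ip2 (uz c - us c) (uz c - us c) = ip2 (uz c) (uz c)"
      using ip2.null_left[OF usX uzX null] ip2.sym[OF usX uzX, of c c] null
      by (simp add: ip2.bilinear[OF uzX usX] ip2.diff_left ip2.diff_right uzX usX)
    then have "N2 c \<le> N2 c / 4" using diff[of c] ip_uz[of c] by linarith
    moreover have "(c i)\<^sup>2 \<le> N2 c" unfolding N2_def using that(1) by (intro member_le_sum) auto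
    ultimately show False using that(2) by simp
  qed
  have ge: "ip2 (us c) (us c) \<le> eps.fp.b (fst (us c)) (fst (us c)) + eps.fp.b (snd (us c)) (snd (us c))" for c
  proof -
    have X: "fst (us c) \<in> wL2 M V" "snd (us c) \<in> wL2 M V" using usX[of c] by (auto simp: mem_Times_iff)
    have Dz: "fst (uz c) \<in> DR" "snd (uz c) \<in> DR" using uzDR[of c] by (auto simp: mem_Times_iff)
    \<comment> \<open>\<open>b_ge\<close> at the step function \<open>us c\<close> with trial vector
      \<open>uz c\<close>. Completing the square, \<open>b\<close> exceeds \<open>ip2\<close> at
      \<open>us c\<close> by at least \<open>N2 c - N2 c / 2 - N2 c / 4\<close>.\<close>
    have "2 * ip2 (us c) (uz c) - (tr2 (uz c) (uz c) + \<epsilon> * l22 (uz c) (uz c))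
        \<le> eps.fp.b (fst (us c)) (fst (us c)) + eps.fp.b (snd (us c)) (snd (us c))"
      using eps.fp.b_ge[OF X(1) Dz(1)] eps.fp.b_ge[OF X(2) Dz(2)]
      by (simp add: ip2_def tr2_def l22_def te_def algebra_simps)
    moreover have "ip2 (uz c - us c) (uz c - us c) = ip2 (uz c) (uz c) - 2 * ip2 (us c) (uz c) + ip2 (us c) (us c)"
      using ip2.sym[OF usX uzX, of c c] by (simp add: ip2.diff_left ip2.diff_right uzX usX)
    ultimately show ?thesis
      using diff[of c] l_uz[of c] Puz[of c] N2[of c] by (simp add: P_def)
  qed
  have "real n / 2 * exp (- (\<kappa> - 1)) \<le> A / S powr \<kappa>"
  proof (rule eps.orthonormal_count[where I = I and e = e and \<sigma> = \<sigma> and n = n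
        and p = "\<lambda>i. p (i, True)" and r = "\<lambda>i. p (i, False)"])
    show "0 < wip M V (fst (\<Sum>i<n. c i *\<^sub>R \<sigma> i)) (fst (\<Sum>i<n. c i *\<^sub>R \<sigma> i))
          + wip M V (snd (\<Sum>i<n. c i *\<^sub>R \<sigma> i)) (snd (\<Sum>i<n. c i *\<^sub>R \<sigma> i))"
      if "i0 < n" "c i0 = 1" for c i0
      using pos[of i0 c] that unfolding us_def ip2_def by blast
    show "wip M V (fst (\<Sum>i<n. c i *\<^sub>R \<sigma> i)) (fst (\<Sum>i<n. c i *\<^sub>R \<sigma> i))
          + wip M V (snd (\<Sum>i<n. c i *\<^sub>R \<sigma> i)) (snd (\<Sum>i<n. c i *\<^sub>R \<sigma> i))
        \<le> eps.fp.b (fst (\<Sum>i<n. c i *\<^sub>R \<sigma> i)) (fst (\<Sum>i<n. c i *\<^sub>R \<sigma> i))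
          + eps.fp.b (snd (\<Sum>i<n. c i *\<^sub>R \<sigma> i)) (snd (\<Sum>i<n. c i *\<^sub>R \<sigma> i))" for c
      using ge[of c] unfolding us_def ip2_def by blast
  qed (use I e orth in \<open>auto simp: \<sigma>_def\<close>)
  then show ?thesis by (simp add: n_def)
qed

end

section \<open>The equivalence\<close>

lemma real_form_of_beurling_deny:
  assumes "closed_nonneg_form M D t" "beurling_deny M D t \<kappa>"
  shows "real_form M D t"
proof
  show "closed_nonneg_form M D t" by fact
qed (use assms(2)[unfolded beurling_deny_def] in \<open>simp_all\<close>)

lemma clr_of_sobolev:
  assumes "closed_nonneg_form M D t" "beurling_deny M D t \<kappa>" "1 < \<kappa>" "q = 2 * \<kappa> / (\<kappa> - 1)"
    and S: "0 < S" "sobolev_inequality M D t q S"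
  shows "clr_inequality M D t \<kappa> (exp (\<kappa> - 1) * S powr - \<kappa>)"
  unfolding clr_inequality_def
proof (intro ballI impI, elim conjE)
  fix V :: "'a \<Rightarrow> real"
  assume V [measurable]: "V \<in> borel_measurable M" and V0: "AE x in M. 0 \<le> V x"
    and int: "integrable M (\<lambda>x. \<bar>V x\<bar> powr \<kappa>)"
  interpret real_form M D t using assms(1,2) by (rule real_form_of_beurling_deny)
  interpret sobolev_form M D t \<kappa> q S "\<lambda>x. \<bar>V x\<bar>"
    by standard (use assms int in auto)
  have abs_eq: "(\<integral>\<^sup>+x. ennreal (V x * (cmod (u x))\<^sup>2) \<partial>M) = (\<integral>\<^sup>+x. ennreal (\<bar>V x\<bar> * (cmod (u x))\<^sup>2) \<partial>M)" for u
    by (rule nn_integral_cong_AE) (use V0 in eventually_elim, simp)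
  define R where "R = exp (\<kappa> - 1) * S powr - \<kappa> * A"
  have R0: "0 \<le> R" using A_nonneg by (simp add: R_def)
  \<comment> \<open>The count is an extended natural number, so the real bound enters through its
    floor.\<close>
  have "eigenvalue_count M D t 0 V \<le> enat (nat \<lfloor>R\<rfloor>)"
    unfolding eigenvalue_count_def ae_dim_def
  proof (rule SUP_least, rule Sup_least)
    fix K x
    assume K: "K \<in> {K. K \<subseteq> D \<and> csubspace_fun K \<and>
        (\<forall>u\<in>K. \<not> (AE x in M. u x = 0) \<longrightarrow>
           ennreal (t u + 0 * L2_sq M u) < (\<integral>\<^sup>+x. ennreal (V x * (cmod (u x))\<^sup>2) \<partial>M))}"
      and "x \<in> {enat n | n. \<exists>b. (\<forall>i<n. b i \<in> K) \<and> ae_independent M n b}"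
    then obtain n b where n: "x = enat n" "\<forall>i<n. b i \<in> K" "ae_independent M n b" by blast
    have "real n * exp (- (\<kappa> - 1)) \<le> A / S powr \<kappa>"
      by (rule count_bound[of K n b]) (use K n in \<open>auto simp: abs_eq\<close>)
    then have "exp (\<kappa> - 1) * (real n * exp (- (\<kappa> - 1))) \<le> exp (\<kappa> - 1) * (A / S powr \<kappa>)"
      by (intro mult_left_mono) auto
    also have "exp (\<kappa> - 1) * (real n * exp (- (\<kappa> - 1))) = real n"
    proof -
      have "exp (\<kappa> - 1) * exp (- (\<kappa> - 1)) = 1" by (simp flip: exp_add)
      then show ?thesis by (metis mult.left_commute mult.right_neutral)
    qed
    also have "exp (\<kappa> - 1) * (A / S powr \<kappa>) = R"
      by (simp add: R_def powr_minus_divide)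
    finally show "x \<le> enat (nat \<lfloor>R\<rfloor>)" unfolding n(1) by (simp add: le_nat_floor)
  qed
  then have "ennreal_of_enat (eigenvalue_count M D t 0 V) \<le> ennreal_of_enat (enat (nat \<lfloor>R\<rfloor>))"
    by (simp only: ennreal_of_enat_le_iff)
  also have "\<dots> = ennreal (real (nat \<lfloor>R\<rfloor>))"
    by (simp add: ennreal_of_nat_eq_real_of_nat)
  also have "\<dots> \<le> ennreal R"
    using R0 by (intro ennreal_leI) simp
  finally show "ennreal_of_enat (eigenvalue_count M D t 0 V)
      \<le> ennreal (exp (\<kappa> - 1) * S powr - \<kappa> * (\<integral>x. \<bar>V x\<bar> powr \<kappa> \<partial>M))"
    by (simp add: R_def A_def)
qed

section \<open>From the CLR inequality to the Sobolev inequality\<close>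

lemma form_scale:
  assumes "quadratic_form M D t" "u \<in> D"
  shows "t (\<lambda>x. c * u x) = (cmod c)\<^sup>2 * t u"
proof -
  obtain a where a: "sesquilinear_on D a" "\<forall>u\<in>D. complex_of_real (t u) = a u u"
    using assms(1) by (auto simp: quadratic_form_def)
  have D: "csubspace_fun D" using assms(1) by (simp add: quadratic_form_def)
  have cu: "(\<lambda>x. c * u x) \<in> D" using D[unfolded csubspace_fun_def] assms(2) by simp
  have s: "a (\<lambda>x. c * u x) w = cnj c * a u w" "a w (\<lambda>x. c * u x) = c * a w u" if "w \<in> D" for w
    using a(1)[unfolded sesquilinear_on_def, THEN conjunct2, rule_format, OF assms(2) that] by auto
  have "complex_of_real (t (\<lambda>x. c * u x)) = cnj c * (c * a u u)"
    using a(2) cu assms(2) by (simp add: s)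
  also have "\<dots> = complex_of_real ((cmod c)\<^sup>2 * t u)"
    using a(2) assms(2) complex_norm_square[of c] by (simp add: mult_ac)
  finally show ?thesis by (simp only: of_real_eq_iff)
qed

text \<open>The potential is tested on the line spanned by \<open>u\<close>: if the CLR bound is below 1, the form is
  nonnegative there.\<close>

lemma potential_le_form:
  assumes form: "quadratic_form M D t" and t0: "\<And>u. u \<in> D \<Longrightarrow> 0 \<le> t u"
    and clr: "clr_inequality M D t \<kappa> L"
    and V [measurable]: "V \<in> borel_measurable M" and V0: "\<And>x. 0 \<le> V x"
    and int: "integrable M (\<lambda>x. \<bar>V x\<bar> powr \<kappa>)"
    and small: "L * (\<integral>x. \<bar>V x\<bar> powr \<kappa> \<partial>M) < 1"
    and u: "u \<in> D"
  shows "(\<integral>\<^sup>+x. ennreal (V x * (cmod (u x))\<^sup>2) \<partial>M) \<le> ennreal (t u)"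
proof (rule ccontr)
  assume "\<not> ?thesis"
  then have less: "ennreal (t u) < (\<integral>\<^sup>+x. ennreal (V x * (cmod (u x))\<^sup>2) \<partial>M)" by simp
  have D: "csubspace_fun D" "D \<subseteq> L2 M" using form by (auto simp: quadratic_form_def)
  have [measurable]: "u \<in> borel_measurable M" using D u by (auto simp: L2_def)
  define K where "K = range (\<lambda>c x. c * u x)"
  have KD: "K \<subseteq> D" using D(1)[unfolded csubspace_fun_def] u by (auto simp: K_def)
  have K: "csubspace_fun K"
    unfolding csubspace_fun_def
  proof (intro conjI ballI allI)
    show "(\<lambda>x. 0) \<in> K" unfolding K_def by (intro image_eqI[of _ _ 0]) auto
    show "(\<lambda>x. v x + w x) \<in> K" if "v \<in> K" "w \<in> K" for v w
    proof -
      obtain c d where "v = (\<lambda>x. c * u x)" "w = (\<lambda>x. d * u x)"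
        using \<open>v \<in> K\<close> \<open>w \<in> K\<close> by (auto simp: K_def)
      then show ?thesis unfolding K_def by (intro image_eqI[of _ _ "c + d"]) (auto simp: algebra_simps)
    qed
    show "(\<lambda>x. c * v x) \<in> K" if "v \<in> K" for c v
    proof -
      obtain d where "v = (\<lambda>x. d * u x)" using \<open>v \<in> K\<close> by (auto simp: K_def)
      then show ?thesis unfolding K_def by (intro image_eqI[of _ _ "c * d"]) (auto simp: mult_ac)
    qed
  qed
  have neg: "ennreal (t v + 0 * L2_sq M v) < (\<integral>\<^sup>+x. ennreal (V x * (cmod (v x))\<^sup>2) \<partial>M)"
    if v: "v \<in> K" "\<not> (AE x in M. v x = 0)" for v
  proof -
    obtain c where c: "v = (\<lambda>x. c * u x)" using v(1) by (auto simp: K_def)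
    have c0: "c \<noteq> 0" using v(2) c by auto
    have "ennreal (t v) = ennreal ((cmod c)\<^sup>2) * ennreal (t u)"
      unfolding c form_scale[OF form u] using t0[OF u] by (simp add: ennreal_mult)
    also have "\<dots> < ennreal ((cmod c)\<^sup>2) * (\<integral>\<^sup>+x. ennreal (V x * (cmod (u x))\<^sup>2) \<partial>M)"
      using less c0 by (intro ennreal_mult_strict_left_mono) auto
    also have "\<dots> = (\<integral>\<^sup>+x. ennreal ((cmod c)\<^sup>2) * ennreal (V x * (cmod (u x))\<^sup>2) \<partial>M)"
      by (rule nn_integral_cmult[symmetric]) measurable
    also have "\<dots> = (\<integral>\<^sup>+x. ennreal (V x * (cmod (v x))\<^sup>2) \<partial>M)"
      using V0 by (intro nn_integral_cong) (simp add: c norm_mult power_mult_distrib mult_ac flip: ennreal_mult)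
    finally show ?thesis by simp
  qed
  have u0: "\<not> (AE x in M. u x = 0)"
  proof
    assume "AE x in M. u x = 0"
    then have "AE x in M. ennreal (V x * (cmod (u x))\<^sup>2) = 0" by (rule eventually_mono) simp
    then have "(\<integral>\<^sup>+x. ennreal (V x * (cmod (u x))\<^sup>2) \<partial>M) = (\<integral>\<^sup>+x. 0 \<partial>M)"
      by (rule nn_integral_cong_AE)
    then show False using less by simp
  qed
  have "enat 1 \<le> ae_dim M K"
    unfolding ae_dim_def
  proof (rule Sup_upper, intro CollectI exI conjI)
    show "enat 1 = enat 1" ..
    have "u \<in> K" unfolding K_def by (intro image_eqI[of _ _ 1]) auto
    then show "\<forall>i<1. (\<lambda>_. u) i \<in> K" by simp
    show "ae_independent M 1 (\<lambda>_. u)"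
      using u0 unfolding ae_independent_def by (auto simp: lessThan_Suc elim: contrapos_np)
  qed
  also have "\<dots> \<le> eigenvalue_count M D t 0 V"
    unfolding eigenvalue_count_def by (rule SUP_upper) (use KD K neg in auto)
  finally have "ennreal_of_enat (enat 1) \<le> ennreal_of_enat (eigenvalue_count M D t 0 V)"
    by (simp only: ennreal_of_enat_le_iff)
  also have "\<dots> \<le> ennreal (L * (\<integral>x. \<bar>V x\<bar> powr \<kappa> \<partial>M))"
    by (rule clr[unfolded clr_inequality_def, rule_format, OF V conjI[OF AE_I2[OF V0] int]])
  also have "\<dots> < 1" using small by (simp add: ennreal_less_one_iff)
  finally show False by (simp add: one_enat_def[symmetric] ennreal_of_enat_1)
qed

text \<open>The potential is a multiple of |u|^(q - 2), the equality case of Hoelder: as (q - 2)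
  \<kappa> = q, both V^\<kappa> and V |u|^2 are multiples of |u|^q. Truncation at height n gives
  finite integrals before |u|^q is known to be integrable.\<close>

lemma sobolev_of_clr:
  assumes form: "quadratic_form M D t" and t0: "\<And>u. u \<in> D \<Longrightarrow> 0 \<le> t u"
    and \<kappa>: "1 < \<kappa>" and q: "q = 2 * \<kappa> / (\<kappa> - 1)"
    and L: "0 < L" and clr: "clr_inequality M D t \<kappa> L"
  shows "sobolev_inequality M D t q (L powr - (1 / \<kappa>))"
  unfolding sobolev_inequality_def
proof
  fix u assume u: "u \<in> D"
  have "D \<subseteq> L2 M" using form by (simp add: quadratic_form_def)
  then have [measurable]: "u \<in> borel_measurable M" and u2: "integrable M (\<lambda>x. (cmod (u x))\<^sup>2)"
    using u by (auto simp: L2_def)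
  have q2: "2 < q" "(q - 2) * \<kappa> = q" "2 / q = 1 - 1 / \<kappa>" "0 < 1 - 1 / \<kappa>"
    using \<kappa> by (auto simp: q field_simps)
  define h where "h n x = min (cmod (u x)) (real n)" for n x
  have h0: "0 \<le> h n x" for n x by (simp add: h_def)
  have [measurable]: "h n \<in> borel_measurable M" for n unfolding h_def[abs_def] by measurable
  have h_split: "h n x powr q = h n x powr (q - 2) * (h n x)\<^sup>2" for n x
  proof (cases "h n x = 0")
    case False
    then have "0 < h n x" using h0[of n x] by simp
    then have "h n x powr (q - 2) * (h n x)\<^sup>2 = h n x powr (q - 2 + 2)"
      unfolding powr_add by simp
    then show ?thesis by simp
  qed simp
  have h_sq: "(h n x)\<^sup>2 \<le> (cmod (u x))\<^sup>2" for n x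
    using h0 by (intro power_mono) (auto simp: h_def)
  have h_int: "integrable M (\<lambda>x. h n x powr q)" for n
  proof (rule Bochner_Integration.integrable_bound)
    show "integrable M (\<lambda>x. real n powr (q - 2) * (cmod (u x))\<^sup>2)" using u2 by simp
    show "AE x in M. norm (h n x powr q) \<le> norm (real n powr (q - 2) * (cmod (u x))\<^sup>2)"
    proof (rule AE_I2)
      fix x
      have "h n x powr (q - 2) * (h n x)\<^sup>2 \<le> real n powr (q - 2) * (cmod (u x))\<^sup>2"
        using h_sq q2(1) h0[of n x] by (intro mult_mono powr_mono2) (auto simp: h_def)
      then show "norm (h n x powr q) \<le> norm (real n powr (q - 2) * (cmod (u x))\<^sup>2)"
        by (simp add: h_split[symmetric])
    qed
  qed measurable
  define I where "I n = (\<integral>x. h n x powr q \<partial>M)" for n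
  have I0: "0 \<le> I n" for n unfolding I_def by (rule integral_nonneg_AE) simp
  have test: "l * I n \<le> t u" if l: "0 < l" "L * l powr \<kappa> * I n < 1" for l n
  proof -
    define V where "V x = l * h n x powr (q - 2)" for x
    have [measurable]: "V \<in> borel_measurable M" unfolding V_def[abs_def] by measurable
    have V0: "0 \<le> V x" for x using l by (simp add: V_def)
    have V_powr: "\<bar>V x\<bar> powr \<kappa> = l powr \<kappa> * h n x powr q" for x
      using l h0 by (simp add: V_def powr_mult powr_powr q2(2))
    have le: "(\<integral>\<^sup>+x. ennreal (V x * (cmod (u x))\<^sup>2) \<partial>M) \<le> ennreal (t u)"
    proof (rule potential_le_form[OF form t0 clr _ V0 _ _ u])
      show "integrable M (\<lambda>x. \<bar>V x\<bar> powr \<kappa>)" unfolding V_powr using h_int by simp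
      show "L * (\<integral>x. \<bar>V x\<bar> powr \<kappa> \<partial>M) < 1"
        unfolding V_powr using l(2) by (simp add: I_def mult.assoc)
    qed measurable
    have "ennreal (l * I n) = (\<integral>\<^sup>+x. ennreal (l * h n x powr q) \<partial>M)"
      using h_int l by (simp add: nn_integral_eq_integral I_def)
    also have "\<dots> \<le> (\<integral>\<^sup>+x. ennreal (V x * (cmod (u x))\<^sup>2) \<partial>M)"
    proof (intro nn_integral_mono ennreal_leI)
      fix x
      have "l * (h n x powr (q - 2) * (h n x)\<^sup>2) \<le> l * (h n x powr (q - 2) * (cmod (u x))\<^sup>2)"
        using l h_sq by (intro mult_left_mono) auto
      then show "l * h n x powr q \<le> V x * (cmod (u x))\<^sup>2" by (simp add: V_def h_split mult_ac)
    qed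
    also note le
    finally show ?thesis using t0[OF u] by simp
  qed
  have bound: "L powr - (1 / \<kappa>) * I n powr (1 - 1 / \<kappa>) \<le> t u" for n
  proof (cases "I n = 0")
    case False
    then have I: "0 < I n" using I0[of n] by simp
    \<comment> \<open>The critical factor, with \<open>L * l powr \<kappa> * I n = 1\<close>. As
      \<open>test\<close> needs a strict inequality, it is applied to \<open>z * l\<close> with
      \<open>z < 1\<close>.\<close>
    define l where "l = (L * I n) powr - (1 / \<kappa>)"
    have l0: "0 < l" using L I by (simp add: l_def)
    have "l powr \<kappa> = (L * I n) powr - 1" using \<kappa> by (simp add: l_def powr_powr)
    also have "\<dots> = 1 / (L * I n)" unfolding powr_minus_divide using L I by simp
    finally have lk: "L * l powr \<kappa> * I n = 1" using L I by simp
    have "l * I n \<le> t u"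
    proof (rule field_le_mult_one_interval)
      fix z :: real assume z: "0 < z" "z < 1"
      have "L * (z * l) powr \<kappa> * I n = z powr \<kappa> * (L * l powr \<kappa> * I n)"
        using z l0 by (simp add: powr_mult mult_ac)
      also have "\<dots> < 1" using z \<kappa> powr_less_mono2[of \<kappa> z 1] by (simp add: lk)
      finally have "z * l * I n \<le> t u" using z l0 by (intro test) auto
      then show "z * (l * I n) \<le> t u" by (simp add: mult_ac)
    qed
    also have "l * I n = L powr - (1 / \<kappa>) * (I n powr - (1 / \<kappa>) * I n powr 1)"
      using L I by (simp add: l_def powr_mult)
    also have "I n powr - (1 / \<kappa>) * I n powr 1 = I n powr (1 - 1 / \<kappa>)"
      unfolding powr_add[symmetric] by simp
    finally show ?thesis .
  qed (use t0[OF u] in simp)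
  \<comment> \<open>\<open>bound\<close> solved for \<open>I n\<close>; being uniform in
    \<open>n\<close>, it gives integrability of |u|^q by monotone convergence.\<close>
  define B where "B = (t u * L powr (1 / \<kappa>)) powr (1 / (1 - 1 / \<kappa>))"
  have IB: "I n \<le> B" for n
  proof -
    have "I n powr (1 - 1 / \<kappa>) \<le> t u * L powr (1 / \<kappa>)"
      using bound[of n] L by (simp add: powr_minus_divide field_simps)
    then have "(I n powr (1 - 1 / \<kappa>)) powr (1 / (1 - 1 / \<kappa>)) \<le> B"
      unfolding B_def using q2(4) by (intro powr_mono2) auto
    then have "I n powr ((1 - 1 / \<kappa>) * (1 / (1 - 1 / \<kappa>))) \<le> B" by (simp only: powr_powr)
    moreover have "(1 - 1 / \<kappa>) * (1 / (1 - 1 / \<kappa>)) = 1" using \<kappa> by simp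
    ultimately show ?thesis using I0[of n] by (simp only: powr_one)
  qed
  have I_mono: "I m \<le> I n" if "m \<le> n" for m n
    unfolding I_def
    by (intro integral_mono h_int powr_mono2) (use q2(1) h0 that in \<open>auto simp: h_def\<close>)
  have "convergent I"
    by (rule Bseq_mono_convergent) (use I_mono IB I0 in \<open>auto intro!: BseqI'[of _ B]\<close>)
  then obtain y where y: "I \<longlonglongrightarrow> y" by (auto simp: convergent_def)
  have yB: "y \<le> B" using y IB by (intro LIMSEQ_le_const2[OF y]) auto
  have y0: "0 \<le> y" using I0 by (intro LIMSEQ_le_const[OF y]) auto
  have conv: "(\<lambda>n. h n x powr q) \<longlonglongrightarrow> cmod (u x) powr q" for x
  proof (rule tendsto_eventually)
    obtain k where k: "cmod (u x) \<le> real k" using real_arch_simple by blast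
    show "\<forall>\<^sub>F n in sequentially. h n x powr q = cmod (u x) powr q"
      using eventually_ge_at_top[of k] by eventually_elim (use k in \<open>auto simp: h_def min_def\<close>)
  qed
  have mono: "incseq (\<lambda>n. h n x powr q)" for x
    by (intro incseq_SucI powr_mono2) (use q2(1) h0 in \<open>auto simp: h_def\<close>)
  have lim: "integrable M (\<lambda>x. cmod (u x) powr q)" "(\<integral>x. cmod (u x) powr q \<partial>M) = y"
    using integrable_monotone_convergence[of M "\<lambda>n x. h n x powr q" "\<lambda>x. cmod (u x) powr q" y]
      integral_monotone_convergence[of M "\<lambda>n x. h n x powr q" "\<lambda>x. cmod (u x) powr q" y]
      h_int mono conv y by (auto simp: I_def[abs_def])
  have "y powr (1 - 1 / \<kappa>) \<le> B powr (1 - 1 / \<kappa>)"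
    using y0 yB q2(4) by (intro powr_mono2) auto
  also have "\<dots> = t u * L powr (1 / \<kappa>)"
    using \<kappa> t0[OF u] by (simp add: B_def powr_powr)
  finally have "L powr - (1 / \<kappa>) * y powr (1 - 1 / \<kappa>) \<le> t u"
    using L by (simp add: powr_minus_divide field_simps)
  then show "integrable M (\<lambda>x. cmod (u x) powr q) \<and>
      L powr - (1 / \<kappa>) * (\<integral>x. cmod (u x) powr q \<partial>M) powr (2 / q) \<le> t u"
    using lim q2(3) by simp
qed

section \<open>Comparison of the sharp constants\<close>

lemma sharp_clr_le:
  assumes clr: "\<And>S. 0 < S \<Longrightarrow> sobolev_inequality M D t q S \<Longrightarrow> clr_inequality M D t \<kappa> (c * S powr - \<kappa>)"
    and "0 < c" "0 < \<kappa>" "0 < S0" "sobolev_inequality M D t q S0"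
  shows "sharp_clr_const M D t \<kappa> \<le> ennreal c * ennreal_neg_powr (sharp_sobolev_const M D t q) \<kappa>"
proof -
  define s where "s = sharp_sobolev_const M D t q"
  \<comment> \<open>Attainment of the supremum is not presupposed: the bound is shown for numbers
    strictly below it and then passed to the limit.\<close>
  have le: "sharp_clr_const M D t \<kappa> \<le> ennreal (c * y powr - \<kappa>)" if y: "0 < y" "ennreal y < s" for y
  proof -
    obtain S where S: "0 < S" "sobolev_inequality M D t q S" "ennreal y < ennreal S"
      using y(2) unfolding s_def sharp_sobolev_const_def less_SUP_iff by auto
    have "sharp_clr_const M D t \<kappa> \<le> ennreal (c * S powr - \<kappa>)"
      unfolding sharp_clr_const_def using S \<open>0 < c\<close> clr by (intro INF_lower) auto
    also have "\<dots> \<le> ennreal (c * y powr - \<kappa>)"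
      using S y assms by (intro ennreal_leI mult_left_mono powr_mono2') (auto simp: ennreal_less_iff)
    finally show ?thesis .
  qed
  have "ennreal S0 \<le> s"
    unfolding s_def sharp_sobolev_const_def using assms by (intro SUP_upper) auto
  then have s0: "s \<noteq> 0" using \<open>0 < S0\<close> by auto
  have "sharp_clr_const M D t \<kappa> \<le> ennreal c * ennreal_neg_powr s \<kappa>"
  proof (cases "s = \<infinity>")
    case True
    \<comment> \<open>When the sharp Sobolev constant is infinite, arbitrarily large
      \<open>y\<close> are allowed and the CLR bound tends to zero.\<close>
    have "(\<lambda>n. c * real (Suc n) powr - \<kappa>) \<longlonglongrightarrow> 0"
      using \<open>0 < \<kappa>\<close> by real_asymp
    then have lim: "(\<lambda>n. ennreal (c * real (Suc n) powr - \<kappa>)) \<longlonglongrightarrow> ennreal 0"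
      by (rule tendsto_ennrealI)
    have "sharp_clr_const M D t \<kappa> \<le> ennreal 0"
      using le True by (intro LIMSEQ_le_const[OF lim]) auto
    then show ?thesis by simp
  next
    case False
    define r where "r = enn2real s"
    have s: "s = ennreal r" using False by (simp add: r_def less_top)
    have r: "0 < r" using s s0 by (metis ennreal_neg linorder_not_less)
    have "(\<lambda>n. r * (real n / real (Suc n))) \<longlonglongrightarrow> r * 1"
      by (intro tendsto_intros LIMSEQ_n_over_Suc_n)
    from tendsto_mult[OF tendsto_const tendsto_powr[OF this tendsto_const], of c "- \<kappa>"] r
    have lim: "(\<lambda>n. ennreal (c * (r * (real n / real (Suc n))) powr - \<kappa>)) \<longlonglongrightarrow> ennreal (c * r powr - \<kappa>)"
      by (intro tendsto_ennrealI) (simp del: of_nat_Suc)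
    have "sharp_clr_const M D t \<kappa> \<le> ennreal (c * r powr - \<kappa>)"
    proof (rule LIMSEQ_le_const[OF lim], intro exI allI impI)
      fix n :: nat assume "1 \<le> n"
      then show "sharp_clr_const M D t \<kappa> \<le> ennreal (c * (r * (real n / real (Suc n))) powr - \<kappa>)"
        using r by (intro le) (auto simp: s ennreal_less_iff field_simps)
    qed
    also have "\<dots> = ennreal c * ennreal_neg_powr s \<kappa>"
      using r \<open>0 < c\<close> False s0 by (simp add: ennreal_neg_powr_def r_def ennreal_mult)
    finally show ?thesis .
  qed
  then show ?thesis by (simp add: s_def)
qed

text \<open>An admissible \<open>L\<close> puts \<open>L powr - (1 / \<kappa>)\<close> below the
  sharp Sobolev constant; the power \<open>- \<kappa>\<close> inverts this exactly, so no factor is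
  lost.\<close>

lemma neg_powr_le_sharp_clr:
  assumes sob: "\<And>L. 0 < L \<Longrightarrow> clr_inequality M D t \<kappa> L \<Longrightarrow> sobolev_inequality M D t q (L powr - (1 / \<kappa>))"
    and "0 < \<kappa>"
  shows "ennreal_neg_powr (sharp_sobolev_const M D t q) \<kappa> \<le> sharp_clr_const M D t \<kappa>"
  unfolding sharp_clr_const_def
proof (rule INF_greatest, elim CollectE conjE)
  fix L assume L: "0 < L" "clr_inequality M D t \<kappa> L"
  define s where "s = sharp_sobolev_const M D t q"
  have ge: "ennreal (L powr - (1 / \<kappa>)) \<le> s"
    unfolding s_def sharp_sobolev_const_def using sob L by (intro SUP_upper) auto
  then have s0: "s \<noteq> 0" using L by auto
  have "ennreal_neg_powr s \<kappa> \<le> ennreal L"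
  proof (cases "s = \<infinity>")
    case False
    define r where "r = enn2real s"
    have s: "s = ennreal r" "0 \<le> r" using False by (auto simp: r_def less_top)
    have "L powr - (1 / \<kappa>) \<le> r" using ge s by simp
    then have "r powr - \<kappa> \<le> (L powr - (1 / \<kappa>)) powr - \<kappa>"
      using L \<open>0 < \<kappa>\<close> by (intro powr_mono2') auto
    also have "\<dots> = L" using L \<open>0 < \<kappa>\<close> by (simp add: powr_powr)
    finally show ?thesis using False s0 by (simp add: ennreal_neg_powr_def r_def ennreal_leI)
  qed (simp add: ennreal_neg_powr_def)
  then show "ennreal_neg_powr (sharp_sobolev_const M D t q) \<kappa> \<le> ennreal L" by (simp add: s_def)
qed

theorem theorem2p1:
  fixes M :: "'a measure"
    and D :: "('a \<Rightarrow> complex) set"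
    and t :: "('a \<Rightarrow> complex) \<Rightarrow> real"
    and \<kappa> q :: real
  assumes "sigma_finite_measure M"
    and "closed_nonneg_form M D t"
    and "1 < \<kappa>"
    and "beurling_deny M D t \<kappa>"
    and "q = 2 * \<kappa> / (\<kappa> - 1)"
  shows "((\<exists>S>0. sobolev_inequality M D t q S) \<longleftrightarrow> (\<exists>L>0. clr_inequality M D t \<kappa> L)) \<and>
    ((\<exists>S>0. sobolev_inequality M D t q S) \<longrightarrow>
       ennreal_neg_powr (sharp_sobolev_const M D t q) \<kappa> \<le> sharp_clr_const M D t \<kappa> \<and>
       sharp_clr_const M D t \<kappa> \<le>
         ennreal (exp (\<kappa> - 1)) * ennreal_neg_powr (sharp_sobolev_const M D t q) \<kappa>)"
proof -
  have clr: "clr_inequality M D t \<kappa> (exp (\<kappa> - 1) * S powr - \<kappa>)"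
    if "0 < S" "sobolev_inequality M D t q S" for S
    using assms(2,4,3,5) that by (rule clr_of_sobolev)
  have sob: "sobolev_inequality M D t q (L powr - (1 / \<kappa>))" if "0 < L" "clr_inequality M D t \<kappa> L" for L
    using _ _ assms(3,5) that
  proof (rule sobolev_of_clr)
    show "quadratic_form M D t" "\<And>u. u \<in> D \<Longrightarrow> 0 \<le> t u"
      using assms(2) by (auto simp: closed_nonneg_form_def)
  qed
  have pos: "0 < exp (\<kappa> - 1) * S powr - \<kappa>" "0 < S powr - (1 / \<kappa>)" if "0 < S" for S :: real
    using that by auto
  show ?thesis
  proof (intro conjI impI)
    show "(\<exists>S>0. sobolev_inequality M D t q S) \<longleftrightarrow> (\<exists>L>0. clr_inequality M D t \<kappa> L)"
    proof
      assume "\<exists>S>0. sobolev_inequality M D t q S"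
      then obtain S where "0 < S" "sobolev_inequality M D t q S" by blast
      then show "\<exists>L>0. clr_inequality M D t \<kappa> L" using clr pos(1) by meson
    next
      assume "\<exists>L>0. clr_inequality M D t \<kappa> L"
      then obtain L where "0 < L" "clr_inequality M D t \<kappa> L" by blast
      then show "\<exists>S>0. sobolev_inequality M D t q S" using sob pos(2) by meson
    qed
    show "ennreal_neg_powr (sharp_sobolev_const M D t q) \<kappa> \<le> sharp_clr_const M D t \<kappa>"
      by (rule neg_powr_le_sharp_clr[OF sob]) (use assms(3) in auto)
    assume "\<exists>S>0. sobolev_inequality M D t q S"
    then obtain S where "0 < S" "sobolev_inequality M D t q S" by blast
    then show "sharp_clr_const M D t \<kappa> \<le>
         ennreal (exp (\<kappa> - 1)) * ennreal_neg_powr (sharp_sobolev_const M D t q) \<kappa>"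
      using assms(3) by (intro sharp_clr_le[OF clr]) auto
  qed
qed

end
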